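(* Let $\kappa\in\mathbb{N}^n$, $\gamma\in\mathbb{N}^m$, and let $T:\mathbb{R}_\kappa[x_1,\dots,x_n]\to\mathbb{R}_\gamma[y_1,\dots,y_m]$ be a linear operator, with symbol $$\mathrm{sym}_T(y,u):=T\Big(\prod_{i=1}^n(x_i+u_i)^{\kappa_i}\Big)\in\mathbb{R}[y_1,\dots,y_m,u_1,\dots,u_n],$$ where $T$ acts on the $x$-variables and the $u_i$ are treated as constants. If $\mathrm{sym}_T(y,u)$ is a Gårding polynomial with nonnegative coefficients (it lies in $\mathbb{R}_{\gamma\oplus\kappa}[y,u]$), then for every Gårding polynomial $f\in\mathbb{R}_\kappa[x]$ with nonnegative coefficients, $T(f)\in\mathbb{R}_\gamma[y]$ is a Gårding polynomial with nonnegative coefficients.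
   Context: For $\kappa\in\mathbb{N}^n$, $\mathbb{R}_\kappa[x]$ is the space of polynomials $f\in\mathbb{R}[x_1,\dots,x_n]$ with $\deg_{x_i}f\le\kappa_i$ for all $i$. Let $\Gamma_n^+=\{x\in\mathbb{R}^n:x_i>0\ \forall i\}$. A set $R\subset\mathbb{R}^n$ passes the positive ray test (PRT) if $R+\overline{\Gamma_n^+}\subset R$. A multi-affine polynomial $g$ (degree at most 1 in each variable) is multi-affine Gårding if $g=0$ or some nonempty connected component of $\{g>0\}$ passes PRT. A polynomial $f\in\mathbb{R}[x_1,\dots,x_n]$ is Gårding if $f=g\circ\mu$ for some multi-affine Gårding polynomial $g$ in $m$ variables (some $m$) and some strictly positive affine map $\mu:\mathbb{R}^n\to\mathbb{R}^m$, $\mu(x)=Ax+b$, where $A$ has nonnegative entries and every row of $A$ has positive sum. In particular the zero polynomial is Gårding. *)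

theory Defs
  imports "HOL-Analysis.Analysis" "HOL-Library.Poly_Mapping"
begin

text \<open>
  Polynomials in variables indexed by natural numbers are finitely supported maps from
  exponent vectors to coefficients. The ring structure is the one of
  theory \<open>Poly_Mapping\<close> (convolution product).
  The points of real \<open>n\<close>-space are the \<open>x :: nat \<Rightarrow> real\<close> with
  \<open>x i = 0\<close> for all \<open>i \<ge> n\<close>, that is, the points of the library space
  \<open>Euclidean_space n\<close>.
\<close>

type_synonym 'a mpoly = "(nat \<Rightarrow>\<^sub>0 nat) \<Rightarrow>\<^sub>0 'a"

definition Monom :: "(nat \<Rightarrow>\<^sub>0 nat) \<Rightarrow> 'a::comm_semiring_1 mpoly" where
  "Monom \<alpha> = Poly_Mapping.single \<alpha> 1"

definition Var :: "nat \<Rightarrow> 'a::comm_semiring_1 mpoly" where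
  "Var i = Monom (Poly_Mapping.single i 1)"

definition Const :: "'a::comm_semiring_1 \<Rightarrow> 'a mpoly" where
  "Const c = Poly_Mapping.single 0 c"

definition poly_eval :: "real mpoly \<Rightarrow> (nat \<Rightarrow> real) \<Rightarrow> real" where
  "poly_eval f x = (\<Sum>\<alpha>\<in>Poly_Mapping.keys f. Poly_Mapping.lookup f \<alpha> *
      (\<Prod>i\<in>Poly_Mapping.keys \<alpha>. x i ^ Poly_Mapping.lookup \<alpha> i))"

definition polys_in :: "nat \<Rightarrow> real mpoly set" where
  "polys_in n = {f. \<forall>\<alpha>\<in>Poly_Mapping.keys f. Poly_Mapping.keys \<alpha> \<subseteq> {..<n}}"

definition polys_bounded :: "nat \<Rightarrow> (nat \<Rightarrow> nat) \<Rightarrow> real mpoly set" where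
  "polys_bounded n \<kappa> =
     {f \<in> polys_in n. \<forall>\<alpha>\<in>Poly_Mapping.keys f. \<forall>i<n. Poly_Mapping.lookup \<alpha> i \<le> \<kappa> i}"

definition nonneg_coeffs :: "real mpoly \<Rightarrow> bool" where
  "nonneg_coeffs f \<longleftrightarrow> (\<forall>\<alpha>. Poly_Mapping.lookup f \<alpha> \<ge> 0)"

definition Gamma_plus :: "nat \<Rightarrow> (nat \<Rightarrow> real) set" where
  "Gamma_plus n = {x \<in> topspace (Euclidean_space n). \<forall>i<n. x i > 0}"

definition passes_PRT :: "nat \<Rightarrow> (nat \<Rightarrow> real) set \<Rightarrow> bool" where
  "passes_PRT n R \<longleftrightarrow>
     (\<forall>x\<in>R. \<forall>v\<in>Euclidean_space n closure_of Gamma_plus n. (\<lambda>i. x i + v i) \<in> R)"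

definition multiaffine_garding :: "nat \<Rightarrow> real mpoly \<Rightarrow> bool" where
  "multiaffine_garding m g \<longleftrightarrow>
     g \<in> polys_bounded m (\<lambda>_. 1) \<and>
     (g = 0 \<or>
      (\<exists>C \<in> connected_components_of (subtopology (Euclidean_space m) {x. poly_eval g x > 0}).
         C \<noteq> {} \<and> passes_PRT m C))"

definition affine_map :: "nat \<Rightarrow> nat \<Rightarrow> (nat \<Rightarrow> nat \<Rightarrow> real) \<Rightarrow> (nat \<Rightarrow> real) \<Rightarrow>
    (nat \<Rightarrow> real) \<Rightarrow> (nat \<Rightarrow> real)" where
  "affine_map n m A b x = (\<lambda>i. if i < m then (\<Sum>j<n. A i j * x j) + b i else 0)"

definition strictly_positive_affine :: "nat \<Rightarrow> nat \<Rightarrow> ((nat \<Rightarrow> real) \<Rightarrow> (nat \<Rightarrow> real)) \<Rightarrow> bool" where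
  "strictly_positive_affine n m \<mu> \<longleftrightarrow>
     (\<exists>A b. (\<forall>i<m. \<forall>j<n. A i j \<ge> 0) \<and> (\<forall>i<m. (\<Sum>j<n. A i j) > 0) \<and> \<mu> = affine_map n m A b)"

text \<open>
  The equation \<open>f = g \<circ> \<mu>\<close> is stated as an equality of functions on real \<open>n\<close>-space.
\<close>

definition garding :: "nat \<Rightarrow> real mpoly \<Rightarrow> bool" where
  "garding n f \<longleftrightarrow>
     f \<in> polys_in n \<and>
     (\<exists>m g \<mu>. multiaffine_garding m g \<and> strictly_positive_affine n m \<mu> \<and>
        (\<forall>x\<in>topspace (Euclidean_space n). poly_eval f x = poly_eval g (\<mu> x)))"

definition linear_operator :: "nat \<Rightarrow> (nat \<Rightarrow> nat) \<Rightarrow> nat \<Rightarrow> (nat \<Rightarrow> nat) \<Rightarrow>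
    (real mpoly \<Rightarrow> real mpoly) \<Rightarrow> bool" where
  "linear_operator n \<kappa> m \<gamma> T \<longleftrightarrow>
     (\<forall>f\<in>polys_bounded n \<kappa>. T f \<in> polys_bounded m \<gamma>) \<and>
     (\<forall>f\<in>polys_bounded n \<kappa>. \<forall>g\<in>polys_bounded n \<kappa>. T (f + g) = T f + T g) \<and>
     (\<forall>c. \<forall>f\<in>polys_bounded n \<kappa>. T (Const c * f) = Const c * T f)"

text \<open>
  The symbol has \<open>m + n\<close> variables: \<open>y\<^sub>i\<close> is variable \<open>i\<close> for
  \<open>i < m\<close>, and \<open>u\<^sub>i\<close> is variable \<open>m + i\<close> for \<open>i < n\<close>.
  To treat the \<open>u\<^sub>i\<close> as constants, the product to which \<open>T\<close> is applied is
  a polynomial in the \<open>x\<^sub>i\<close> whose coefficients are themselves polynomials, in the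
  \<open>u\<^sub>i\<close>; \<open>T\<close> is extended to such polynomials linearly over the coefficients.
\<close>

definition symbol_kernel :: "nat \<Rightarrow> (nat \<Rightarrow> nat) \<Rightarrow> nat \<Rightarrow> real mpoly mpoly" where
  "symbol_kernel n \<kappa> m = (\<Prod>i<n. (Var i + Const (Var (m + i))) ^ \<kappa> i)"

definition extend_coeffs :: "(real mpoly \<Rightarrow> real mpoly) \<Rightarrow> real mpoly mpoly \<Rightarrow> real mpoly" where
  "extend_coeffs T P =
     (\<Sum>\<alpha>\<in>Poly_Mapping.keys P. Poly_Mapping.lookup P \<alpha> * T (Monom \<alpha>))"

definition symb :: "nat \<Rightarrow> (nat \<Rightarrow> nat) \<Rightarrow> nat \<Rightarrow> (real mpoly \<Rightarrow> real mpoly) \<Rightarrow> real mpoly" where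
  "symb n \<kappa> m T = extend_coeffs T (symbol_kernel n \<kappa> m)"

end

theory Submission
  imports Defs
begin

text \<open>
  The proof works with polynomial functions and with one property of them. Let \<open>g\<close> be
  multi-affine and let \<open>C\<close> be a component of \<open>{g > 0}\<close> that is stable under adding nonnegative
  vectors. Along every coordinate ray in \<open>C\<close> an iterated derivative of \<open>g\<close> is affine and, by
  induction, bounded below; so all iterated derivatives of \<open>g\<close> are nonnegative on \<open>C\<close>. Conversely,
  let \<open>D\<close> be the set of points where \<open>g\<close> is positive and all iterated derivatives are nonnegative.
  It is stable under adding nonnegative vectors, hence connected, and it is closed in \<open>{g > 0}\<close>;
  it is a component if and only if it is open. Openness means that from every point of \<open>D\<close>
  one can go down a little in the diagonal direction without losing the nonnegativity of the
  derivatives: \<open>g\<close> is \<open>lowerable\<close>. A \<open>garding_fun\<close> is a polynomial function all of whose iterated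
  derivatives are lowerable. For polynomials with nonnegative coefficients this is the same as being
  Garding (\<open>garding_imp_garding_fun\<close>, \<open>garding_fun_imp_garding\<close>), whatever their degrees are.

  Two inequalities hold where all iterated derivatives of \<open>f\<^sub>i\<close> are nonnegative (subscripts are
  partial derivatives): \<open>f f\<^sub>i\<^sub>j \<le> f\<^sub>i f\<^sub>j\<close> (\<open>rayleigh\<close>) and \<open>k f f\<^sub>i\<^sub>i \<le> (k - 1) f\<^sub>i\<^sup>2\<close> if the degree in
  variable \<open>i\<close> is at most \<open>k\<close> (\<open>laguerre\<close>). Both follow by moving along the line in direction \<open>i\<close>
  away from the root of \<open>f\<close>, by induction on the degree. They imply two closure properties.

  First, the polar form \<open>f + (x\<^sub>s - x\<^sub>i) f\<^sub>i / k\<close> with a new variable \<open>s\<close> is again a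
  \<open>garding_fun\<close> (\<open>garding_fun_polar\<close>). Iterating it, one replaces \<open>f\<close> by a multi-affine function
  for every bound on the degrees of \<open>f\<close> (\<open>polarization_exists\<close>). This takes the place of the
  Grace-Walsh-Szego theorem.

  Second, if \<open>H\<close> is affine in \<open>s\<close> and in \<open>t\<close>, then \<open>H\<^sub>s + H\<^sub>t\<close> is a \<open>garding_fun\<close>
  (\<open>garding_fun_pd_sum\<close>), because it is the sum of a translate of \<open>H\<^sub>s\<close> and a translate of \<open>H\<^sub>t\<close> that
  can be chosen such that both are positive at a given point. Evaluation at \<open>s = t = 0\<close>, which is
  harmless for nonnegative coefficients, gives the operation \<open>contract\<close>.

  The theorem follows as in the multi-affine proof of Borcea and Braenden. The product of the symbol
  and of \<open>f(x)\<close> is a \<open>garding_fun\<close> in \<open>y, u, x\<close>, and \<open>T f\<close> arises from it by the linear map that sends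
  \<open>x\<^sub>i\<^sup>a u\<^sub>i\<^sup>b\<close> to the inverse of the binomial coefficient of \<open>\<kappa>\<^sub>i\<close> over \<open>a\<close> if \<open>a + b = \<kappa>\<^sub>i\<close> and to zero
  otherwise, for every \<open>i\<close> (\<open>apolars_symbol\<close>). This map is a composition of \<open>\<kappa>\<^sub>i\<close> steps
  that each split off one copy of \<open>x\<^sub>i\<close> and one of \<open>u\<^sub>i\<close> by polar forms and contract the two copies.
\<close>

section \<open>Polynomial functions and their partial derivatives\<close>

text \<open>Functions are used instead of formal polynomials so that substituting for variables is plain
  composition. The number \<open>N\<close> bounds the variables that may occur; all points have infinitely many
  coordinates, and a new variable is an index above this bound.\<close>

inductive_set polyfun :: "nat \<Rightarrow> ((nat \<Rightarrow> real) \<Rightarrow> real) set" for N where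
  const: "(\<lambda>_. c) \<in> polyfun N"
| coord: "i < N \<Longrightarrow> (\<lambda>x. x i) \<in> polyfun N"
| add: "f \<in> polyfun N \<Longrightarrow> g \<in> polyfun N \<Longrightarrow> (\<lambda>x. f x + g x) \<in> polyfun N"
| mult: "f \<in> polyfun N \<Longrightarrow> g \<in> polyfun N \<Longrightarrow> (\<lambda>x. f x * g x) \<in> polyfun N"

definition pd :: "nat \<Rightarrow> ((nat \<Rightarrow> real) \<Rightarrow> real) \<Rightarrow> (nat \<Rightarrow> real) \<Rightarrow> real" where
  "pd i f = (\<lambda>x. deriv (\<lambda>t. f (x(i := t))) (x i))"

lemma polyfun_mono: "f \<in> polyfun N \<Longrightarrow> N \<le> M \<Longrightarrow> f \<in> polyfun M"
  by (induction rule: polyfun.induct) (auto intro: polyfun.intros)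

lemma polyfun_cong:
  assumes "f \<in> polyfun N" "\<And>j. j < N \<Longrightarrow> x j = y j"
  shows "f x = f y"
  using assms by (induction rule: polyfun.induct) auto

lemma polyfun_uminus: "f \<in> polyfun N \<Longrightarrow> (\<lambda>x. - f x) \<in> polyfun N"
  using polyfun.mult[OF polyfun.const[of "-1" N]] by fastforce

lemma polyfun_diff: "f \<in> polyfun N \<Longrightarrow> g \<in> polyfun N \<Longrightarrow> (\<lambda>x. f x - g x) \<in> polyfun N"
  using polyfun.add[OF _ polyfun_uminus, of f N g] by simp

lemma polyfun_cmult: "f \<in> polyfun N \<Longrightarrow> (\<lambda>x. c * f x) \<in> polyfun N"
  by (rule polyfun.mult[OF polyfun.const])

lemma polyfun_sum:
  "(\<And>a. a \<in> A \<Longrightarrow> f a \<in> polyfun N) \<Longrightarrow> (\<lambda>x. \<Sum>a\<in>A. f a x) \<in> polyfun N"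
  by (induction A rule: infinite_finite_induct) (auto intro: polyfun.intros)

lemma polyfun_prod:
  "(\<And>a. a \<in> A \<Longrightarrow> f a \<in> polyfun N) \<Longrightarrow> (\<lambda>x. \<Prod>a\<in>A. f a x) \<in> polyfun N"
  by (induction A rule: infinite_finite_induct) (auto intro: polyfun.intros)

lemma polyfun_power: "f \<in> polyfun N \<Longrightarrow> (\<lambda>x. f x ^ k) \<in> polyfun N"
  by (induction k) (auto intro: polyfun.intros)

lemma polyfun_compose:
  assumes "f \<in> polyfun M" "\<And>j. j < M \<Longrightarrow> (\<lambda>x. \<mu> x j) \<in> polyfun N"
  shows "(\<lambda>x. f (\<mu> x)) \<in> polyfun N"
  using assms by (induction rule: polyfun.induct) (auto intro: polyfun.intros)

lemma polyfun_continuous: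
  assumes "f \<in> polyfun N" "\<And>j. j < N \<Longrightarrow> continuous_on S (\<lambda>t. \<gamma> t j)"
  shows "continuous_on S (\<lambda>t. f (\<gamma> t))"
  using assms by (induction rule: polyfun.induct) (auto intro!: continuous_intros)

lemma polyfun_coord_differentiable:
  assumes "f \<in> polyfun N"
  shows "\<exists>D. ((\<lambda>t. f (x(i := t))) has_real_derivative D) (at a)"
  using assms
proof (induction rule: polyfun.induct)
  case (coord j)
  show ?case
    by (cases "j = i") (auto intro: derivative_eq_intros)
next
  case (add f g)
  then obtain D E where
    "((\<lambda>t. f (x(i := t))) has_real_derivative D) (at a)"
    "((\<lambda>t. g (x(i := t))) has_real_derivative E) (at a)" by blast
  from DERIV_add[OF this] show ?case by blast
next
  case (mult f g)
  then obtain D E where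
    "((\<lambda>t. f (x(i := t))) has_real_derivative D) (at a)"
    "((\<lambda>t. g (x(i := t))) has_real_derivative E) (at a)" by blast
  from DERIV_mult[OF this] show ?case by blast
qed (auto intro: derivative_eq_intros)

lemma pd_has_derivative:
  assumes "f \<in> polyfun N"
  shows "((\<lambda>t. f (x(i := t))) has_real_derivative pd i f (x(i := a))) (at a)"
proof -
  obtain D where D: "((\<lambda>t. f (x(i := t))) has_real_derivative D) (at a)"
    using polyfun_coord_differentiable[OF assms] by blast
  then have "pd i f (x(i := a)) = D"
    unfolding pd_def by (simp add: DERIV_imp_deriv)
  with D show ?thesis by simp
qed

lemma pd_eqI:
  assumes "\<And>x. ((\<lambda>t. f (x(i := t))) has_real_derivative g x) (at (x i))"
  shows "pd i f = g"
  using assms unfolding pd_def by (auto intro!: DERIV_imp_deriv)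

lemma pd_has_derivative':
  assumes "f \<in> polyfun N"
  shows "((\<lambda>t. f (x(i := t))) has_real_derivative pd i f x) (at (x i))"
  using pd_has_derivative[OF assms, of x i "x i"] by simp

lemma pd_const [simp]: "pd i (\<lambda>_. c) = (\<lambda>_. 0)"
  by (rule pd_eqI) simp

lemma pd_coord: "pd i (\<lambda>x. x j) = (\<lambda>_. if i = j then 1 else 0)"
  by (rule pd_eqI) (auto intro!: derivative_eq_intros)

lemma pd_coord_same [simp]: "pd i (\<lambda>x. x i) = (\<lambda>_. 1)"
  and pd_coord_other [simp]: "i \<noteq> j \<Longrightarrow> pd i (\<lambda>x. x j) = (\<lambda>_. 0)"
  by (auto simp: pd_coord)

lemma pd_add:
  assumes "f \<in> polyfun N" "g \<in> polyfun M"
  shows "pd i (\<lambda>x. f x + g x) = (\<lambda>x. pd i f x + pd i g x)"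
  by (rule pd_eqI) (auto intro!: derivative_eq_intros pd_has_derivative' assms)

lemma pd_mult:
  assumes "f \<in> polyfun N" "g \<in> polyfun M"
  shows "pd i (\<lambda>x. f x * g x) = (\<lambda>x. pd i f x * g x + f x * pd i g x)"
  by (rule pd_eqI) (auto intro!: derivative_eq_intros pd_has_derivative' assms)

lemma pd_cmult:
  assumes "f \<in> polyfun N"
  shows "pd i (\<lambda>x. c * f x) = (\<lambda>x. c * pd i f x)"
  by (rule pd_eqI) (auto intro!: derivative_eq_intros pd_has_derivative' assms)

lemma pd_diff:
  assumes "f \<in> polyfun N" "g \<in> polyfun M"
  shows "pd i (\<lambda>x. f x - g x) = (\<lambda>x. pd i f x - pd i g x)"
  by (rule pd_eqI) (auto intro!: derivative_eq_intros pd_has_derivative' assms)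

lemma pd_sum:
  assumes "\<And>a. a \<in> A \<Longrightarrow> f a \<in> polyfun N"
  shows "pd i (\<lambda>x. \<Sum>a\<in>A. f a x) = (\<lambda>x. \<Sum>a\<in>A. pd i (f a) x)"
  by (rule pd_eqI) (auto intro!: derivative_eq_intros pd_has_derivative' assms)

lemma polyfun_pd: "f \<in> polyfun N \<Longrightarrow> pd i f \<in> polyfun N"
  by (induction rule: polyfun.induct)
     (auto simp: pd_add pd_mult pd_coord intro: polyfun.intros)

lemma pd_commute:
  assumes "f \<in> polyfun N"
  shows "pd i (pd j f) = pd j (pd i f)"
  using assms
  by (induction rule: polyfun.induct)
     (auto simp: pd_add[of _ N _ N] pd_mult[of _ N _ N] pd_coord polyfun_pd polyfun.mult algebra_simps)

lemma pd_outside: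
  assumes "f \<in> polyfun N" "N \<le> i"
  shows "pd i f = (\<lambda>_. 0)"
  using assms
  by (induction rule: polyfun.induct) (auto simp: pd_add[of _ N _ N] pd_mult[of _ N _ N] pd_coord)

lemma polyfun_chain_rule:
  assumes "f \<in> polyfun N" "\<And>j. j < N \<Longrightarrow> ((\<lambda>t. \<gamma> t j) has_real_derivative d j) (at t)"
  shows "((\<lambda>t. f (\<gamma> t)) has_real_derivative (\<Sum>j<N. d j * pd j f (\<gamma> t))) (at t)"
  using assms
proof (induction rule: polyfun.induct)
  case (const c)
  then show ?case by simp
next
  case (coord i)
  have "(\<Sum>j<N. d j * pd j (\<lambda>x. x i) (\<gamma> t)) = (\<Sum>j<N. if j = i then d j else 0)"
    by (rule sum.cong) (auto simp: pd_coord)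
  then show ?case using coord by (simp add: sum.delta)
next
  case (add f g)
  show ?case
    by (rule derivative_eq_intros add.IH add.prems | assumption)+
       (simp add: pd_add[OF add.hyps] algebra_simps sum.distrib)
next
  case (mult f g)
  show ?case
    by (rule derivative_eq_intros mult.IH mult.prems | assumption)+
       (simp add: pd_mult[OF mult.hyps] algebra_simps sum.distrib sum_distrib_left sum_distrib_right)
qed

lemma pd_zero_imp_indep:
  assumes "f \<in> polyfun N" "pd i f = (\<lambda>_. 0)"
  shows "f (x(i := v)) = f x"
proof -
  have "\<And>t. ((\<lambda>t. f (x(i := t))) has_real_derivative 0) (at t)"
    using pd_has_derivative[OF assms(1), of x i] assms(2) by simp
  then have "(\<lambda>t. f (x(i := t))) v = (\<lambda>t. f (x(i := t))) (x i)"
    using DERIV_isconst_all by blast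
  then show ?thesis by simp
qed

lemma indep_imp_pd_zero: "(\<And>x v. f (x(i := v)) = f x) \<Longrightarrow> pd i f = (\<lambda>_. 0)"
  by (rule pd_eqI) simp

lemma affine_in_coord:
  assumes "f \<in> polyfun N" "pd i (pd i f) = (\<lambda>_. 0)"
  shows "f (x(i := v)) = f x + (v - x i) * pd i f x"
proof -
  have 1: "((\<lambda>t. f (x(i := t)) - t * pd i f x) has_real_derivative 0) (at t)" for t
    using pd_has_derivative[OF assms(1), of x i t] pd_zero_imp_indep[OF polyfun_pd[OF assms(1)] assms(2), of x t]
    by (auto intro!: derivative_eq_intros)
  then have "(\<lambda>t. f (x(i := t)) - t * pd i f x) v = (\<lambda>t. f (x(i := t)) - t * pd i f x) (x i)"
    using DERIV_isconst_all by blast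
  then show ?thesis by (simp add: algebra_simps)
qed

text \<open>A bound on the total degree. It is the measure for inductions that pass from a function to its
  partial derivatives.\<close>

primrec vanish :: "nat \<Rightarrow> ((nat \<Rightarrow> real) \<Rightarrow> real) \<Rightarrow> bool" where
  "vanish 0 f \<longleftrightarrow> f = (\<lambda>_. 0)"
| "vanish (Suc d) f \<longleftrightarrow> (\<forall>i. vanish d (pd i f))"

lemma vanish_zero: "vanish d (\<lambda>_. 0)"
  by (induction d) auto

lemma vanish_Suc: "vanish d f \<Longrightarrow> vanish (Suc d) f"
  by (induction d arbitrary: f) (auto simp: vanish_zero)

lemma vanish_mono: "vanish d f \<Longrightarrow> d \<le> e \<Longrightarrow> vanish e f"
  by (induction e) (auto simp: le_Suc_eq intro: vanish_Suc simp del: vanish.simps)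

lemma vanish_add:
  "f \<in> polyfun N \<Longrightarrow> g \<in> polyfun N \<Longrightarrow> vanish d f \<Longrightarrow> vanish d g \<Longrightarrow> vanish d (\<lambda>x. f x + g x)"
  by (induction d arbitrary: f g) (auto simp: pd_add polyfun_pd)

lemma vanish_mult:
  "f \<in> polyfun N \<Longrightarrow> g \<in> polyfun N \<Longrightarrow> vanish a f \<Longrightarrow> vanish b g \<Longrightarrow> vanish (a + b) (\<lambda>x. f x * g x)"
proof (induction "a + b" arbitrary: a b f g)
  case 0
  then show ?case by simp
next
  case (Suc n)
  show ?case
  proof (cases "a = 0 \<or> b = 0")
    case True
    then have "(\<lambda>x. f x * g x) = (\<lambda>_. 0)" using Suc.prems by auto
    then show ?thesis using vanish_zero by metis
  next
    case False
    then obtain a' b' where ab: "a = Suc a'" "b = Suc b'" by (meson not0_implies_Suc)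
    have "vanish n (\<lambda>x. pd i f x * g x)" for i
      using Suc.hyps(1)[of a' b "pd i f" g] Suc.prems Suc.hyps(2) ab by (simp add: polyfun_pd)
    moreover have "vanish n (\<lambda>x. f x * pd i g x)" for i
      using Suc.hyps(1)[of a b' f "pd i g"] Suc.prems Suc.hyps(2) ab by (simp add: polyfun_pd)
    ultimately have "vanish n (\<lambda>x. pd i f x * g x + f x * pd i g x)" for i
      using Suc.prems by (intro vanish_add[of _ N]) (auto intro: polyfun.mult polyfun_pd)
    then show ?thesis
      unfolding Suc.hyps(2)[symmetric] by (simp add: pd_mult[OF Suc.prems(1,2)])
  qed
qed

lemma polyfun_vanish: "f \<in> polyfun N \<Longrightarrow> \<exists>d. vanish d f"
proof (induction rule: polyfun.induct)
  case (const c)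
  have "vanish 1 (\<lambda>_. c)" by simp
  then show ?case by blast
next
  case (coord i)
  have "vanish 2 (\<lambda>x. x i)" by (simp add: numeral_2_eq_2 pd_coord)
  then show ?case by blast
next
  case (add f g)
  then obtain d e where "vanish d f" "vanish e g" by blast
  then have "vanish (max d e) f" "vanish (max d e) g" by (auto intro: vanish_mono)
  then show ?case using vanish_add add.hyps by blast
next
  case (mult f g)
  then show ?case using vanish_mult by blast
qed

text \<open>Taking a partial derivative lowers the total degree.\<close>

lemma polyfun_deriv_induct [consumes 1, case_names zero step]:
  assumes f: "f \<in> polyfun N"
    and z: "P (\<lambda>_. 0)"
    and s: "\<And>f. f \<in> polyfun N \<Longrightarrow> (\<And>i. P (pd i f)) \<Longrightarrow> P f"
  shows "P f"
proof -
  obtain d where "vanish d f" using polyfun_vanish[OF f] by blast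
  with f show ?thesis
    proof (induction d arbitrary: f)
    case 0
    then show ?case using z by simp
  next
    case (Suc d)
    show ?case by (rule s) (use Suc in \<open>auto simp: polyfun_pd\<close>)
  qed
qed

subsection \<open>Iterated derivatives\<close>

primrec pds :: "nat list \<Rightarrow> ((nat \<Rightarrow> real) \<Rightarrow> real) \<Rightarrow> (nat \<Rightarrow> real) \<Rightarrow> real" where
  "pds [] f = f"
| "pds (i # is) f = pds is (pd i f)"

lemma polyfun_pds: "f \<in> polyfun N \<Longrightarrow> pds is f \<in> polyfun N"
  by (induction "is" arbitrary: f) (auto intro: polyfun_pd)

lemma pds_append: "pds (is @ js) f = pds js (pds is f)"
  by (induction "is" arbitrary: f) auto

lemma pds_zero [simp]: "pds is (\<lambda>_. 0) = (\<lambda>_. 0)"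
  by (induction "is") auto

lemma pd_pds_commute: "f \<in> polyfun N \<Longrightarrow> pd i (pds is f) = pds is (pd i f)"
  by (induction "is" arbitrary: f) (auto simp: polyfun_pd pd_commute)

lemma pds_add:
  "f \<in> polyfun N \<Longrightarrow> g \<in> polyfun M \<Longrightarrow> pds is (\<lambda>x. f x + g x) = (\<lambda>x. pds is f x + pds is g x)"
  by (induction "is" arbitrary: f g) (auto simp: pd_add polyfun_pd)

lemma pds_cmult: "f \<in> polyfun N \<Longrightarrow> pds is (\<lambda>x. c * f x) = (\<lambda>x. c * pds is f x)"
  by (induction "is" arbitrary: f) (auto simp: pd_cmult polyfun_pd)


section \<open>Points with nonnegative Taylor coefficients\<close>

text \<open>Equivalently, the Taylor expansion of \<open>f\<close> at \<open>x\<close> has nonnegative coefficients.\<close>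

definition nonneg_derivs :: "((nat \<Rightarrow> real) \<Rightarrow> real) \<Rightarrow> (nat \<Rightarrow> real) \<Rightarrow> bool" where
  "nonneg_derivs f x \<longleftrightarrow> (\<forall>is. pds is f x \<ge> 0)"

lemma nonneg_derivs_value: "nonneg_derivs f x \<Longrightarrow> 0 \<le> f x"
  unfolding nonneg_derivs_def by (metis pds.simps(1))

lemma nonneg_derivs_pd: "nonneg_derivs f x \<Longrightarrow> nonneg_derivs (pd i f) x"
  unfolding nonneg_derivs_def by (metis pds.simps(2))

lemma nonneg_derivs_pds: "nonneg_derivs f x \<Longrightarrow> nonneg_derivs (pds is f) x"
  unfolding nonneg_derivs_def by (metis pds_append)

lemma nonneg_derivsI:
  assumes "0 \<le> f x" "\<And>i. nonneg_derivs (pd i f) x"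
  shows "nonneg_derivs f x"
  unfolding nonneg_derivs_def
proof
  fix "is"
  show "0 \<le> pds is f x"
    using assms by (cases "is") (auto simp: nonneg_derivs_def)
qed

lemma nonneg_derivs_const [simp]: "nonneg_derivs (\<lambda>_. c) x \<longleftrightarrow> 0 \<le> c"
proof
  assume "0 \<le> c"
  have zero: "nonneg_derivs (\<lambda>_. 0) x" by (simp add: nonneg_derivs_def)
  show "nonneg_derivs (\<lambda>_. c) x"
    by (rule nonneg_derivsI) (auto simp: \<open>0 \<le> c\<close> zero)
qed (auto dest: nonneg_derivs_value)

lemma nonneg_derivs_add:
  "f \<in> polyfun N \<Longrightarrow> g \<in> polyfun N \<Longrightarrow> nonneg_derivs f x \<Longrightarrow> nonneg_derivs g x
    \<Longrightarrow> nonneg_derivs (\<lambda>x. f x + g x) x"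
  unfolding nonneg_derivs_def by (auto simp: pds_add)

lemma nonneg_derivs_cmult:
  "f \<in> polyfun N \<Longrightarrow> 0 \<le> c \<Longrightarrow> nonneg_derivs f x \<Longrightarrow> nonneg_derivs (\<lambda>x. c * f x) x"
  unfolding nonneg_derivs_def by (auto simp: pds_cmult)

lemma nonneg_derivs_sum:
  assumes "\<And>a. a \<in> A \<Longrightarrow> f a \<in> polyfun N" "\<And>a. a \<in> A \<Longrightarrow> nonneg_derivs (f a) x"
  shows "nonneg_derivs (\<lambda>x. \<Sum>a\<in>A. f a x) x"
  using assms
  by (induction A rule: infinite_finite_induct) (auto intro!: nonneg_derivs_add polyfun_sum)

lemma nonneg_derivs_mult:
  assumes "f \<in> polyfun N" "g \<in> polyfun N" "nonneg_derivs f x" "nonneg_derivs g x"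
  shows "nonneg_derivs (\<lambda>x. f x * g x) x"
proof -
  have "0 \<le> pds is (\<lambda>x. f x * g x) x" for "is"
    using assms
  proof (induction "is" arbitrary: f g)
    case Nil
    then show ?case by (simp add: nonneg_derivs_value)
  next
    case (Cons i js)
    have "pds (i # js) (\<lambda>x. f x * g x) x
        = pds js (\<lambda>x. pd i f x * g x) x + pds js (\<lambda>x. f x * pd i g x) x"
      using Cons.prems
      by (simp add: pd_mult[OF Cons.prems(1,2)] pds_add[of _ N _ N] polyfun.mult polyfun_pd)
    then show ?case
      using Cons by (simp add: polyfun_pd nonneg_derivs_pd)
  qed
  then show ?thesis by (simp add: nonneg_derivs_def)
qed

lemma nonneg_derivs_indep:
  assumes "f \<in> polyfun N" "pd i f = (\<lambda>_. 0)"
  shows "nonneg_derivs f (x(i := v)) \<longleftrightarrow> nonneg_derivs f x"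
  unfolding nonneg_derivs_def
  using pd_zero_imp_indep[OF polyfun_pds[OF assms(1)]] assms by (simp add: pd_pds_commute)

text \<open>On the segment from \<open>x\<close> to \<open>y\<close> the derivative of \<open>f\<close> is a nonnegative combination of the values of
  \<open>pd j f\<close>, and these are nonnegative there by induction.\<close>

lemma nonneg_derivs_imp_le:
  assumes "f \<in> polyfun N" "nonneg_derivs f x" "\<And>j. j < N \<Longrightarrow> x j \<le> y j"
  shows "f x \<le> f y"
proof -
  have "\<forall>x y. nonneg_derivs f x \<longrightarrow> (\<forall>j<N. x j \<le> y j) \<longrightarrow> f x \<le> f y"
    using assms(1)
  proof (induction rule: polyfun_deriv_induct)
    case (step f)
    show ?case
    proof (intro allI impI)
      fix x y assume x: "nonneg_derivs f x" and le: "\<forall>j<N. x j \<le> y j"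
      define \<gamma> where "\<gamma> = (\<lambda>(t::real) j. x j + t * (y j - x j))"
      have "f (\<gamma> 0) \<le> f (\<gamma> 1)"
      proof (rule DERIV_nonneg_imp_nondecreasing[of 0 1 "\<lambda>t. f (\<gamma> t)"])
        fix t :: real assume "0 \<le> t" "t \<le> 1"
        have "0 \<le> pd j f (\<gamma> t)" for j
        proof -
          have "0 \<le> pd j f x" using x nonneg_derivs_pd nonneg_derivs_value by blast
          also have "\<dots> \<le> pd j f (\<gamma> t)"
            using step.IH[of j] nonneg_derivs_pd[OF x] le \<open>0 \<le> t\<close> by (auto simp: \<gamma>_def)
          finally show ?thesis .
        qed
        moreover have "((\<lambda>t. f (\<gamma> t)) has_real_derivative (\<Sum>j<N. (y j - x j) * pd j f (\<gamma> t))) (at t)"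
          by (rule polyfun_chain_rule[OF step.hyps]) (auto simp: \<gamma>_def intro!: derivative_eq_intros)
        ultimately show "\<exists>D. ((\<lambda>t. f (\<gamma> t)) has_real_derivative D) (at t) \<and> 0 \<le> D"
          using le by (intro exI conjI) (auto intro!: sum_nonneg)
      qed simp
      then show "f x \<le> f y" by (simp add: \<gamma>_def)
    qed
  qed simp
  then show ?thesis using assms by blast
qed

lemma nonneg_derivs_mono:
  assumes "f \<in> polyfun N" "nonneg_derivs f x" "\<And>j. j < N \<Longrightarrow> x j \<le> y j"
  shows "nonneg_derivs f y"
  unfolding nonneg_derivs_def
proof
  fix "is"
  have "0 \<le> pds is f x" using assms(2) by (simp add: nonneg_derivs_def)
  also have "\<dots> \<le> pds is f y"
    by (rule nonneg_derivs_imp_le[OF polyfun_pds]) (use assms nonneg_derivs_pds in auto)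
  finally show "0 \<le> pds is f y" .
qed

lemma pd_all_zero_imp_const:
  assumes "f \<in> polyfun N" "\<And>j. pd j f = (\<lambda>_. 0)"
  shows "f x = f y"
proof -
  define \<gamma> where "\<gamma> = (\<lambda>(t::real) j. x j + t * (y j - x j))"
  have "((\<lambda>t. f (\<gamma> t)) has_real_derivative (\<Sum>j<N. (y j - x j) * pd j f (\<gamma> t))) (at t)" for t
    by (rule polyfun_chain_rule[OF assms(1)]) (auto simp: \<gamma>_def intro!: derivative_eq_intros)
  then have "\<forall>t. ((\<lambda>t. f (\<gamma> t)) has_real_derivative 0) (at t)"
    using assms(2) by simp
  then have "f (\<gamma> 0) = f (\<gamma> 1)"
    by (rule DERIV_isconst_all)
  then show ?thesis by (simp add: \<gamma>_def)
qed

text \<open>By monotonicity \<open>f\<close> vanishes on the segment from \<open>z\<close> to \<open>y\<close>. So every \<open>pd j f\<close> vanishes at the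
  midpoint of this segment, and is zero by induction.\<close>

lemma nonneg_derivs_zero_above:
  assumes "f \<in> polyfun N" "nonneg_derivs f z" "\<And>j. j < N \<Longrightarrow> z j < y j" "f y = 0"
  shows "f = (\<lambda>_. 0)"
proof -
  have "\<forall>z y. nonneg_derivs f z \<longrightarrow> (\<forall>j<N. z j < y j) \<longrightarrow> f y = 0 \<longrightarrow> f = (\<lambda>_. 0)"
    using assms(1)
  proof (induction rule: polyfun_deriv_induct)
    case (step f)
    show ?case
    proof (intro allI impI)
      fix z y assume z: "nonneg_derivs f z" and less: "\<forall>j<N. z j < y j" and y: "f y = 0"
      define \<gamma> where "\<gamma> = (\<lambda>(t::real) j. z j + t * (y j - z j))"
      have zero: "f (\<gamma> t) = 0" if "0 < t" "t < 1" for t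
      proof -
        have zt: "z j \<le> \<gamma> t j" if "j < N" for j
          using less that \<open>0 < t\<close> by (simp add: \<gamma>_def less_imp_le)
        have ty: "\<gamma> t j \<le> y j" if "j < N" for j
        proof -
          have "t * (y j - z j) \<le> 1 * (y j - z j)"
            using less that \<open>t < 1\<close> by (intro mult_right_mono) auto
          then show ?thesis by (simp add: \<gamma>_def)
        qed
        have "0 \<le> f (\<gamma> t)"
          using nonneg_derivs_value nonneg_derivs_mono[OF step.hyps z zt] by blast
        moreover have "f (\<gamma> t) \<le> f y"
          by (rule nonneg_derivs_imp_le[OF step.hyps nonneg_derivs_mono[OF step.hyps z zt] ty])
        ultimately show ?thesis using y by simp
      qed
      have D: "((\<lambda>t. f (\<gamma> t)) has_real_derivative (\<Sum>j<N. (y j - z j) * pd j f (\<gamma> (1/2)))) (at (1/2))"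
        by (rule polyfun_chain_rule[OF step.hyps]) (auto simp: \<gamma>_def intro!: derivative_eq_intros)
      have nn: "nonneg_derivs f (\<gamma> (1/2))"
        by (rule nonneg_derivs_mono[OF step.hyps z]) (use less in \<open>auto simp: \<gamma>_def\<close>)
      have "(\<Sum>j<N. (y j - z j) * pd j f (\<gamma> (1/2))) = 0"
      proof (rule DERIV_local_const[OF D])
        show "\<forall>t. \<bar>1/2 - t\<bar> < 1/2 \<longrightarrow> f (\<gamma> (1/2)) = f (\<gamma> t)"
        proof (intro allI impI)
          fix t :: real assume "\<bar>1/2 - t\<bar> < 1/2"
          then have "0 < t" "t < 1" by linarith+
          then show "f (\<gamma> (1/2)) = f (\<gamma> t)" using zero[of t] zero[of "1/2"] by simp
        qed
      qed simp
      moreover have "\<forall>j<N. 0 \<le> (y j - z j) * pd j f (\<gamma> (1/2))"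
        using less nonneg_derivs_value[OF nonneg_derivs_pd[OF nn]] by (simp add: less_imp_le)
      ultimately have "\<forall>j<N. (y j - z j) * pd j f (\<gamma> (1/2)) = 0"
        by (subst (asm) sum_nonneg_eq_0_iff) auto
      then have dz: "pd j f (\<gamma> (1/2)) = 0" if "j < N" for j
        using less[rule_format, OF that] that by auto
      have "pd j f = (\<lambda>_. 0)" for j
      proof (cases "j < N")
        case True
        have "\<forall>l<N. z l < \<gamma> (1/2) l" using less by (auto simp: \<gamma>_def)
        then show ?thesis
          using step.IH[of j] nonneg_derivs_pd[OF z] dz True by blast
      qed (simp add: pd_outside[OF step.hyps])
      then have "f x = f y" for x
        using pd_all_zero_imp_const[OF step.hyps] by blast
      then show "f = (\<lambda>_. 0)" using y by auto
    qed
  qed simp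
  then show ?thesis using assms by blast
qed

section \<open>Lowerable polynomials\<close>

text \<open>Let \<open>D\<close> be the set of points where \<open>f\<close> is positive and has nonnegative derivatives. It is closed
  in the set where \<open>f\<close> is positive, and it is stable under adding nonnegative vectors. So a diagonal
  step down that stays in \<open>D\<close> puts a whole neighbourhood of the point into \<open>D\<close>, up to the
  positivity of \<open>f\<close>: the condition says that \<open>D\<close> is open.\<close>

definition lowerable :: "((nat \<Rightarrow> real) \<Rightarrow> real) \<Rightarrow> bool" where
  "lowerable f \<longleftrightarrow>
     (\<forall>x. 0 < f x \<longrightarrow> nonneg_derivs f x \<longrightarrow> (\<exists>e>0. nonneg_derivs f (\<lambda>j. x j - e)))"

lemma lowerable_zero: "lowerable (\<lambda>_. 0)"
  by (simp add: lowerable_def)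

text \<open>A derivative that vanishes at \<open>x\<close> vanishes above a point where its Taylor coefficients are
  nonnegative.\<close>

lemma lowerable_derivs:
  assumes "f \<in> polyfun N" "lowerable f" "0 < f x" "nonneg_derivs f x"
  shows "pds is f = (\<lambda>_. 0) \<or> 0 < pds is f x"
proof -
  obtain e where e: "e > 0" "nonneg_derivs f (\<lambda>j. x j - e)"
    using assms unfolding lowerable_def by blast
  have "0 \<le> pds is f x" using assms(4) by (simp add: nonneg_derivs_def)
  moreover have "pds is f = (\<lambda>_. 0)" if "pds is f x = 0"
    by (rule nonneg_derivs_zero_above[OF polyfun_pds[OF assms(1)] nonneg_derivs_pds[OF e(2)] _ that])
       (use e in auto)
  ultimately show ?thesis by (cases "pds is f x = 0") (simp_all add: less_le)
qed

lemma lowerable_pd_pos: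
  assumes "f \<in> polyfun N" "lowerable f" "0 < f x" "nonneg_derivs f x"
  shows "pd i f = (\<lambda>_. 0) \<or> 0 < pd i f x"
  using lowerable_derivs[OF assms, of "[i]"] by simp

text \<open>Only finitely many iterated derivatives are nonzero functions, and these stay positive near \<open>x\<close>.\<close>

lemma nonneg_derivs_lowerI:
  assumes "f \<in> polyfun N" "\<And>is. pds is f = (\<lambda>_. 0) \<or> 0 < pds is f x"
  shows "\<exists>e>0. nonneg_derivs f (\<lambda>j. x j - e)"
proof -
  have "(\<forall>is. pds is f = (\<lambda>_. 0) \<or> 0 < pds is f x) \<longrightarrow> (\<exists>e>0. nonneg_derivs f (\<lambda>j. x j - e))"
    using assms(1)
  proof (induction rule: polyfun_deriv_induct)
    case zero
    then show ?case by (auto intro: exI[of _ 1])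
  next
    case (step f)
    show ?case
    proof
      assume full: "\<forall>is. pds is f = (\<lambda>_. 0) \<or> 0 < pds is f x"
      have "\<forall>is. pds is (pd i f) = (\<lambda>_. 0) \<or> 0 < pds is (pd i f) x" for i
        using full by (metis pds.simps(2))
      with step.IH have "\<forall>i. \<exists>e>0. nonneg_derivs (pd i f) (\<lambda>j. x j - e)" by blast
      then obtain E where E: "\<And>i. 0 < E i" "\<And>i. nonneg_derivs (pd i f) (\<lambda>j. x j - E i)"
        by metis
      have "\<exists>d>0. \<forall>e. 0 < e \<longrightarrow> e < d \<longrightarrow> 0 \<le> f (\<lambda>j. x j - e)"
      proof (cases "f = (\<lambda>_. 0)")
        case True
        then show ?thesis by (auto intro: exI[of _ 1])
      next
        case False
        then have "0 < f x" using full by (metis pds.simps(1))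
        have "continuous_on UNIV (\<lambda>e. f (\<lambda>j. x j - e))"
          by (intro polyfun_continuous[OF step.hyps] continuous_intros)
        then have "((\<lambda>e. f (\<lambda>j. x j - e)) \<longlongrightarrow> f (\<lambda>j. x j - 0)) (at 0)"
          unfolding continuous_on_def by (metis UNIV_I)
        then have "eventually (\<lambda>e. 0 < f (\<lambda>j. x j - e)) (at 0)"
          using \<open>0 < f x\<close> by (intro order_tendstoD(1)[of _ "f (\<lambda>j. x j - 0)"]) auto
        then show ?thesis
          unfolding eventually_at by (auto simp: dist_real_def less_imp_le)
      qed
      then obtain d where d: "d > 0" "\<And>e. 0 < e \<Longrightarrow> e < d \<Longrightarrow> 0 \<le> f (\<lambda>j. x j - e)"
        by blast
      define e where "e = Min (insert (d/2) (E ` {..<N}))"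
      have e: "0 < e"
        unfolding e_def using d(1) E(1) by (subst Min_gr_iff) auto
      have e: "0 < e" "e \<le> d/2" "\<And>i. i < N \<Longrightarrow> e \<le> E i"
        using e unfolding e_def by (auto simp del: Min_insert divide_le_eq_numeral1 le_divide_eq_numeral1 intro: Min_le)
      have "nonneg_derivs (pd i f) (\<lambda>j. x j - e)" for i
      proof (cases "i < N")
        case True
        show ?thesis
          by (rule nonneg_derivs_mono[OF polyfun_pd[OF step.hyps] E(2)[of i]]) (use e(3)[OF True] in auto)
      qed (simp add: pd_outside[OF step.hyps])
      moreover have "0 \<le> f (\<lambda>j. x j - e)" using d e by simp
      ultimately have "nonneg_derivs f (\<lambda>j. x j - e)" by (blast intro: nonneg_derivsI)
      with e show "\<exists>e>0. nonneg_derivs f (\<lambda>j. x j - e)" by blast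
    qed
  qed
  then show ?thesis using assms by blast
qed

text \<open>The form in which lowerability is proved by induction over derivatives: only the first
  derivatives need an argument.\<close>

lemma lowerableI:
  assumes f: "f \<in> polyfun N" and low: "\<And>i. lowerable (pd i f)"
    and pos: "\<And>x i. 0 < f x \<Longrightarrow> nonneg_derivs f x \<Longrightarrow> pd i f = (\<lambda>_. 0) \<or> 0 < pd i f x"
  shows "lowerable f"
  unfolding lowerable_def
proof (intro allI impI)
  fix x assume x: "0 < f x" "nonneg_derivs f x"
  show "\<exists>e>0. nonneg_derivs f (\<lambda>j. x j - e)"
  proof (rule nonneg_derivs_lowerI[OF f])
    fix "is"
    show "pds is f = (\<lambda>_. 0) \<or> 0 < pds is f x"
    proof (cases "is")
      case Nil
      then show ?thesis using x by simp
    next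
      case (Cons i js)
      from pos[OF x, of i] show ?thesis
      proof
        assume "pd i f = (\<lambda>_. 0)"
        then show ?thesis using Cons by simp
      next
        assume "0 < pd i f x"
        from lowerable_derivs[OF polyfun_pd[OF f] low this nonneg_derivs_pd[OF x(2)], of js]
        show ?thesis using Cons by simp
      qed
    qed
  qed
qed

text \<open>Among the points where \<open>f\<close> is positive, those with nonnegative derivatives form a set that is
  open and closed. A segment of positivity that meets it lies in it.\<close>

lemma nonneg_derivs_segment:
  assumes f: "f \<in> polyfun N" "lowerable f" and y: "nonneg_derivs f y"
    and pos: "\<And>t. 0 \<le> t \<Longrightarrow> t \<le> 1 \<Longrightarrow> 0 < f (\<lambda>j. x j + t * (y j - x j))"
  shows "nonneg_derivs f x"
proof -
  define \<gamma> where "\<gamma> = (\<lambda>(t::real) j. x j + t * (y j - x j))"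
  define S where "S = {t\<in>{0..1}. nonneg_derivs f (\<gamma> t)}"
  have "closed {t. 0 \<le> pds is f (\<gamma> t)}" for "is"
  proof (rule closed_Collect_le)
    show "continuous_on UNIV (\<lambda>t. pds is f (\<gamma> t))"
      unfolding \<gamma>_def by (intro polyfun_continuous[OF polyfun_pds[OF f(1)]] continuous_intros)
  qed simp
  then have "closed {t. nonneg_derivs f (\<gamma> t)}"
    unfolding nonneg_derivs_def by (intro closed_Collect_all) auto
  then have "closedin (top_of_set {0..1}) S"
    unfolding S_def by (metis Collect_conj_eq Collect_mem_eq closedin_closed_Int)
  moreover have "openin (top_of_set {0..1}) S"
    unfolding openin_euclidean_subtopology_iff
  proof (intro conjI ballI)
    fix t assume "t \<in> S"
    then have t: "0 \<le> t" "t \<le> 1" "nonneg_derivs f (\<gamma> t)" by (auto simp: S_def)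
    with pos[of t] f obtain e where e: "e > 0" "nonneg_derivs f (\<lambda>j. \<gamma> t j - e)"
      unfolding lowerable_def \<gamma>_def by blast
    define B where "B = 1 + (\<Sum>j<N. \<bar>y j - x j\<bar>)"
    have B: "0 < B" "\<And>j. j < N \<Longrightarrow> \<bar>y j - x j\<bar> \<le> B"
    proof -
      show "0 < B" unfolding B_def by (smt (verit) sum_nonneg abs_ge_zero)
      show "\<And>j. j < N \<Longrightarrow> \<bar>y j - x j\<bar> \<le> B" unfolding B_def
        using member_le_sum[of _ "{..<N}" "\<lambda>j. \<bar>y j - x j\<bar>"] by fastforce
    qed
    show "\<exists>d>0. \<forall>t'\<in>{0..1}. dist t' t < d \<longrightarrow> t' \<in> S"
    proof (intro exI conjI ballI impI)
      show "0 < e / B" using e B by simp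
      fix t' :: real assume t': "t' \<in> {0..1}" "dist t' t < e / B"
      have "nonneg_derivs f (\<gamma> t')"
      proof (rule nonneg_derivs_mono[OF f(1) e(2)])
        fix j assume "j < N"
        have "\<bar>(t - t') * (y j - x j)\<bar> \<le> (e / B) * B"
          unfolding abs_mult using t' B(2)[OF \<open>j < N\<close>] e B(1)
          by (intro mult_mono) (auto simp: dist_real_def)
        then show "\<gamma> t j - e \<le> \<gamma> t' j" using B(1) by (simp add: \<gamma>_def algebra_simps)
      qed
      then show "t' \<in> S" using t' by (simp add: S_def)
    qed
  qed (auto simp: S_def)
  moreover have "1 \<in> S" using y by (simp add: S_def \<gamma>_def)
  moreover have "connected {0..1::real}" by simp
  ultimately have "S = {0..1}" unfolding connected_clopen by blast
  then have "0 \<in> S" by simp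
  then show ?thesis by (simp add: S_def \<gamma>_def)
qed

lemma nonneg_derivs_raise_le:
  assumes f: "f \<in> polyfun N" and n: "nonneg_derivs (pd i f) x" and "0 \<le> L"
  shows "f x + L * pd i f x \<le> f (x(i := x i + L))"
proof -
  have "f (x(i := x i)) - x i * pd i f x \<le> f (x(i := x i + L)) - (x i + L) * pd i f x"
  proof (rule DERIV_nonneg_imp_nondecreasing[of "x i" "x i + L" "\<lambda>t. f (x(i := t)) - t * pd i f x"])
    fix t assume "x i \<le> t"
    have "pd i f x \<le> pd i f (x(i := t))"
      by (rule nonneg_derivs_imp_le[OF polyfun_pd[OF f] n]) (use \<open>x i \<le> t\<close> in auto)
    then show "\<exists>D. ((\<lambda>t. f (x(i := t)) - t * pd i f x) has_real_derivative D) (at t) \<and> 0 \<le> D"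
      by (intro exI[of _ "pd i f (x(i := t)) - pd i f x"])
         (auto intro!: derivative_eq_intros pd_has_derivative[OF f])
  qed (use assms in simp)
  then show ?thesis by (simp add: algebra_simps)
qed

lemma exists_shift:
  fixes c x :: "nat \<Rightarrow> real"
  shows "\<exists>T>0. \<forall>j<N. c j < x j + T"
proof (induction N)
  case (Suc N)
  then obtain T where T: "0 < T" "\<forall>j<N. c j < x j + T" by blast
  define T' where "T' = max T (c N - x N + 1)"
  have "c j < x j + T'" if "j < Suc N" for j
    using that T by (cases "j = N") (auto simp: T'_def less_Suc_eq max_def)
  moreover have "0 < T'" using T(1) by (simp add: T'_def)
  ultimately show ?case by blast
qed (auto intro: exI[of _ 1])

text \<open>Consider the diagonal segment from \<open>x\<close> up to a point above the origin. Far enough in direction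
  \<open>i\<close> the term \<open>L * pd i f x\<close> exceeds \<open>\<bar>f\<bar>\<close> on all of it, so the raised segment consists of points of
  positivity, and its upper end has nonnegative derivatives.\<close>

lemma nonneg_derivs_raise:
  assumes f: "f \<in> polyfun N" "lowerable f" "nonneg_derivs f (\<lambda>_. 0)"
    and a: "nonneg_derivs (pd i f) x" "0 < pd i f x"
  shows "\<exists>L0\<ge>0. \<forall>L\<ge>L0. 0 < f (x(i := x i + L)) \<and> nonneg_derivs f (x(i := x i + L))"
proof -
  obtain T where "0 < T" "\<forall>j<N. 0 < x j + T" using exists_shift[of N "\<lambda>_. 0" x] by auto
  then have T: "0 \<le> T" "\<And>j. j < N \<Longrightarrow> 0 \<le> x j + T" by (auto intro: less_imp_le)
  define z where "z = (\<lambda>(t::real) j. x j + t)"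
  have "continuous_on {0..T} (\<lambda>t. f (z t))"
    unfolding z_def by (intro polyfun_continuous[OF f(1)] continuous_intros)
  then obtain s where s: "\<And>t. t \<in> {0..T} \<Longrightarrow> f (z s) \<le> f (z t)"
    using continuous_attains_inf[of "{0..T}"] T(1) by (metis atLeastAtMost_iff compact_Icc empty_iff order_refl)
  \<comment> \<open>The minimum of \<open>f\<close> on the diagonal segment is attained at parameter \<open>s\<close>.\<close>
  define L0 where "L0 = (\<bar>f (z s)\<bar> + 1) / pd i f x"
  have L0: "0 \<le> L0" using a by (simp add: L0_def)
  have ge: "0 < f ((z t)(i := z t i + L))" if t: "t \<in> {0..T}" and L: "L \<ge> L0" for t L
  proof -
    have nz: "nonneg_derivs (pd i f) (z t)"
      by (rule nonneg_derivs_mono[OF polyfun_pd[OF f(1)] a(1)]) (use t in \<open>auto simp: z_def\<close>)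
    have "pd i f x \<le> pd i f (z t)"
      by (rule nonneg_derivs_imp_le[OF polyfun_pd[OF f(1)] a(1)]) (use t in \<open>auto simp: z_def\<close>)
    then have "L * pd i f x \<le> L * pd i f (z t)" using L L0 by (intro mult_left_mono) auto
    moreover have "\<bar>f (z s)\<bar> + 1 \<le> L * pd i f x"
      using L a(2) by (simp add: L0_def pos_divide_le_eq)
    moreover have "f (z t) + L * pd i f (z t) \<le> f ((z t)(i := z t i + L))"
      by (rule nonneg_derivs_raise_le[OF f(1) nz]) (use L L0 in auto)
    ultimately show ?thesis using s[OF t] by linarith
  qed
  have "nonneg_derivs f (x(i := x i + L))" if L: "L \<ge> L0" for L
  proof (rule nonneg_derivs_segment[OF f(1,2)])
    show "nonneg_derivs f ((z T)(i := z T i + L))"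
      by (rule nonneg_derivs_mono[OF f(1) f(3)]) (use T L L0 in \<open>auto simp: z_def\<close>)
    fix t :: real assume t: "0 \<le> t" "t \<le> 1"
    have "(\<lambda>j. (x(i := x i + L)) j + t * (((z T)(i := z T i + L)) j - (x(i := x i + L)) j))
       = (z (t * T))(i := z (t * T) i + L)"
      by (auto simp: z_def)
    moreover have "t * T \<in> {0..T}" using t T mult_right_mono[of t 1 T] by auto
    ultimately show "0 < f (\<lambda>j. (x(i := x i + L)) j + t * (((z T)(i := z T i + L)) j - (x(i := x i + L)) j))"
      using ge[OF _ L] by metis
  qed
  moreover have "0 < f (x(i := x i + L))" if "L \<ge> L0" for L
    using ge[of 0 L] that T by (simp add: z_def)
  ultimately show ?thesis using L0 by blast
qed

text \<open>From \<open>x\<close> on, \<open>f\<close> increases in direction \<open>i\<close>, so the ray from \<open>x\<close> to the raised point of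
  \<open>nonneg_derivs_raise\<close> consists of points of positivity.\<close>

lemma nonneg_derivs_from_pd:
  assumes f: "f \<in> polyfun N" "lowerable f" "nonneg_derivs f (\<lambda>_. 0)"
    and a: "nonneg_derivs (pd i f) x" "0 < pd i f x" and pos: "0 < f x"
  shows "nonneg_derivs f x"
proof -
  obtain L where L: "L \<ge> 0" "nonneg_derivs f (x(i := x i + L))"
    using nonneg_derivs_raise[OF f a] by blast
  show ?thesis
  proof (rule nonneg_derivs_segment[OF f(1,2) L(2)])
    fix t :: real assume t: "0 \<le> t" "t \<le> 1"
    have "(\<lambda>j. x j + t * ((x(i := x i + L)) j - x j)) = x(i := x i + t * L)" by auto
    moreover have "f x + (t * L) * pd i f x \<le> f (x(i := x i + t * L))"
      by (rule nonneg_derivs_raise_le[OF f(1) a(1)]) (use t L in simp)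
    moreover have "0 \<le> (t * L) * pd i f x" using t L a by simp
    ultimately show "0 < f (\<lambda>j. x j + t * ((x(i := x i + L)) j - x j))" using pos by simp
  qed
qed

text \<open>As \<open>pd i f\<close> does not depend on coordinate \<open>i\<close>, what holds for it far up in direction \<open>i\<close> holds
  at the point itself.\<close>

lemma lowerable_pd:
  assumes f: "f \<in> polyfun N" "lowerable f" "nonneg_derivs f (\<lambda>_. 0)"
    and aff: "pd i (pd i f) = (\<lambda>_. 0)"
  shows "lowerable (pd i f)"
  unfolding lowerable_def
proof (intro allI impI)
  fix x assume x: "0 < pd i f x" "nonneg_derivs (pd i f) x"
  obtain L where L: "0 < f (x(i := x i + L))" "nonneg_derivs f (x(i := x i + L))"
    using nonneg_derivs_raise[OF f x(2,1)] by blast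
  then obtain e where e: "e > 0" "nonneg_derivs f (\<lambda>j. (x(i := x i + L)) j - e)"
    using f(2) unfolding lowerable_def by blast
  have eq: "(\<lambda>j. (x(i := x i + L)) j - e) = (\<lambda>j. x j - e)(i := x i + L - e)" by auto
  have "nonneg_derivs (pd i f) (\<lambda>j. x j - e)"
    using nonneg_derivs_pd[OF e(2), of i] unfolding eq nonneg_derivs_indep[OF polyfun_pd[OF f(1)] aff] .
  with e show "\<exists>e>0. nonneg_derivs (pd i f) (\<lambda>j. x j - e)" by blast
qed

section \<open>Garding functions\<close>

text \<open>Lowerability of a function does not pass to its derivatives: \<open>x\<^sup>3 + 3 x - 1\<close> is lowerable, but
  its derivative \<open>3 x\<^sup>2 + 3\<close> is not lowerable at the origin. For multi-affine functions it does pass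
  (\<open>multiaffine_garding_fun\<close>).\<close>

definition garding_fun :: "((nat \<Rightarrow> real) \<Rightarrow> real) \<Rightarrow> bool" where
  "garding_fun f \<longleftrightarrow> (\<forall>is. lowerable (pds is f))"

lemma garding_fun_lowerable: "garding_fun f \<Longrightarrow> lowerable f"
  unfolding garding_fun_def by (metis pds.simps(1))

lemma garding_fun_pd: "garding_fun f \<Longrightarrow> garding_fun (pd i f)"
  unfolding garding_fun_def by (metis pds.simps(2))

lemma garding_funI: "lowerable f \<Longrightarrow> (\<And>i. garding_fun (pd i f)) \<Longrightarrow> garding_fun f"
  unfolding garding_fun_def by (metis list.exhaust pds.simps)

lemma garding_fun_zero: "garding_fun (\<lambda>_. 0)"
  by (simp add: garding_fun_def lowerable_zero)

lemma multiaffine_garding_fun: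
  assumes f: "f \<in> polyfun N" "lowerable f" "nonneg_derivs f (\<lambda>_. 0)"
    and aff: "\<And>i. pd i (pd i f) = (\<lambda>_. 0)"
  shows "garding_fun f"
proof -
  have "lowerable f \<longrightarrow> nonneg_derivs f (\<lambda>_. 0) \<longrightarrow> (\<forall>i. pd i (pd i f) = (\<lambda>_. 0)) \<longrightarrow> garding_fun f"
    using f(1)
  proof (induction rule: polyfun_deriv_induct)
    case (step f)
    show ?case
    proof (intro impI, rule garding_funI)
      fix i
      assume h: "lowerable f" "nonneg_derivs f (\<lambda>_. 0)" "\<forall>i. pd i (pd i f) = (\<lambda>_. 0)"
      have "pd j (pd j (pd i f)) = (\<lambda>_. 0)" for j
        using h(3) pd_commute[OF step.hyps] pd_commute[OF polyfun_pd[OF step.hyps]] pd_const by metis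
      then show "garding_fun (pd i f)"
        using step.IH[of i] lowerable_pd[OF step.hyps h(1,2)] h nonneg_derivs_pd by blast
    qed
  qed (simp add: garding_fun_zero)
  then show ?thesis using assms by blast
qed


section \<open>Rayleigh and Laguerre inequalities\<close>

lemma polyfun_coord_continuous:
  assumes "f \<in> polyfun N"
  shows "continuous_on S (\<lambda>v. f (x(i := v)))"
proof (rule polyfun_continuous[OF assms])
  fix j
  show "continuous_on S (\<lambda>v. (x(i := v)) j)"
    by (cases "j = i") (auto intro: continuous_intros)
qed

lemma right_limit_le:
  fixes g :: "real \<Rightarrow> real"
  assumes "continuous_on UNIV g" "u < b" "\<And>v. u < v \<Longrightarrow> v \<le> b \<Longrightarrow> g v \<le> c"
  shows "g u \<le> c"
proof (rule tendsto_upperbound)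
  show "(g \<longlongrightarrow> g u) (at_right u)"
    using assms(1) unfolding continuous_on_def by (meson UNIV_I filterlim_at_split)
  show "eventually (\<lambda>v. g v \<le> c) (at_right u)"
    unfolding eventually_at_right_field using assms(2,3) by (auto intro!: exI[of _ b])
qed simp

text \<open>Points with \<open>a = 0\<close> are limits, from above, of points with \<open>a > 0\<close>.\<close>

lemma nonneg_from_strict:
  assumes a: "a \<in> polyfun N" "nonneg_derivs a x" "a \<noteq> (\<lambda>_. 0)"
    and h: "h \<in> polyfun N" and pos: "\<And>y. nonneg_derivs a y \<Longrightarrow> 0 < a y \<Longrightarrow> 0 \<le> h y"
  shows "0 \<le> h x"
proof -
  have "- h (\<lambda>j. x j + 0) \<le> 0"
  proof (rule right_limit_le[of "\<lambda>t. - h (\<lambda>j. x j + t)" 0 1])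
    show "continuous_on UNIV (\<lambda>t. - h (\<lambda>j. x j + t))"
      by (intro continuous_intros polyfun_continuous[OF h])
    fix t :: real assume t: "0 < t"
    have n: "nonneg_derivs a (\<lambda>j. x j + t)"
      by (rule nonneg_derivs_mono[OF a(1,2)]) (use t in simp)
    have "a (\<lambda>j. x j + t) \<noteq> 0"
      using nonneg_derivs_zero_above[OF a(1,2), of "\<lambda>j. x j + t"] a(3) t by auto
    then have "0 < a (\<lambda>j. x j + t)" using nonneg_derivs_value[OF n] by simp
    from pos[OF n this] show "- h (\<lambda>j. x j + t) \<le> 0" by simp
  qed simp
  then show ?thesis by simp
qed

text \<open>By induction \<open>pd i (pd i f)\<close> vanishes on the downward ray, so \<open>f\<close> is affine there; being
  nonnegative and nondecreasing on the whole ray, it is constant.\<close>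

lemma pd_zero_if_nonneg_on_ray:
  assumes "f \<in> polyfun N" "\<And>v. v \<le> x i \<Longrightarrow> nonneg_derivs f (x(i := v))"
  shows "pd i f x = 0"
proof -
  have "\<forall>x. (\<forall>v\<le>x i. nonneg_derivs f (x(i := v))) \<longrightarrow> pd i f x = 0"
    using assms(1)
  proof (induction rule: polyfun_deriv_induct)
    case (step f)
    show ?case
    proof (intro allI impI)
      fix x assume nn: "\<forall>v\<le>x i. nonneg_derivs f (x(i := v))"
      have z: "pd i (pd i f) (x(i := v)) = 0" if "v \<le> x i" for v
      proof -
        have "\<forall>w\<le>(x(i := v)) i. nonneg_derivs (pd i f) ((x(i := v))(i := w))"
          using nn that nonneg_derivs_pd by fastforce
        then show ?thesis using step.IH[of i] by blast
      qed
      have const: "pd i f (x(i := v)) = pd i f x" if "v < x i" for v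
      proof -
        have "pd i f (x(i := x i)) = pd i f (x(i := v))"
        proof (rule DERIV_isconst_end[OF that])
          show "continuous_on {v..x i} (\<lambda>v. pd i f (x(i := v)))"
            by (rule polyfun_coord_continuous[OF polyfun_pd[OF step.hyps]])
          fix w assume "v < w" "w < x i"
          then show "((\<lambda>v. pd i f (x(i := v))) has_real_derivative 0) (at w)"
            using pd_has_derivative[OF polyfun_pd[OF step.hyps], of i x i w] z[of w] by simp
        qed
        then show ?thesis by simp
      qed
      have "0 \<le> pd i f x"
        using nn[rule_format, of "x i"] nonneg_derivs_pd nonneg_derivs_value by fastforce
      moreover have False if "0 < pd i f x"
      proof -
        define t where "t = (\<bar>f x\<bar> + 1) / pd i f x"
        have t: "0 < t" "t * pd i f x = \<bar>f x\<bar> + 1" using that by (auto simp: t_def)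
        have n: "nonneg_derivs f (x(i := x i - t))" using nn t by simp
        have "f (x(i := x i - t)) + t * pd i f (x(i := x i - t)) \<le> f ((x(i := x i - t))(i := (x(i := x i - t)) i + t))"
          by (rule nonneg_derivs_raise_le[OF step.hyps nonneg_derivs_pd[OF n]]) (use t in simp)
        then have "f (x(i := x i - t)) + t * pd i f x \<le> f x"
          using const[of "x i - t"] t by simp
        with t nonneg_derivs_value[OF n] show False by simp
      qed
      ultimately show "pd i f x = 0" by fastforce
    qed
  qed simp
  then show ?thesis using assms by blast
qed

text \<open>The point \<open>u\<close> is the largest root of \<open>f\<close> below \<open>x\<close> on the line in direction \<open>i\<close>. Without a root,
  all derivatives would be nonnegative on the whole downward ray, which contradicts
  \<open>pd_zero_if_nonneg_on_ray\<close>.\<close>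

lemma root_below:
  assumes f: "f \<in> polyfun N" "lowerable f" and x: "nonneg_derivs f x" "0 < f x" and d: "0 < pd i f x"
  obtains u where "u < x i" "f (x(i := u)) \<le> 0"
    "\<And>v. u < v \<Longrightarrow> v \<le> x i \<Longrightarrow> 0 < f (x(i := v)) \<and> nonneg_derivs f (x(i := v))"
proof -
  have nn: "nonneg_derivs f (x(i := v))" if v: "v \<le> x i" "\<And>w. v \<le> w \<Longrightarrow> w \<le> x i \<Longrightarrow> 0 < f (x(i := w))" for v
  proof (rule nonneg_derivs_segment[OF f x(1)])
    fix t :: real assume t: "0 \<le> t" "t \<le> 1"
    have "(\<lambda>j. (x(i := v)) j + t * (x j - (x(i := v)) j)) = x(i := v + t * (x i - v))" by auto
    moreover have "t * (x i - v) \<le> x i - v" using t v mult_right_mono[of t 1 "x i - v"] by simp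
    moreover have "0 \<le> t * (x i - v)" using t v by simp
    ultimately show "0 < f (\<lambda>j. (x(i := v)) j + t * (x j - (x(i := v)) j))"
      using v(2)[of "v + t * (x i - v)"] by simp
  qed
  define S where "S = {v. v \<le> x i \<and> f (x(i := v)) \<le> 0}"
  have "S \<noteq> {}"
  proof
    assume "S = {}"
    then have "\<And>v. v \<le> x i \<Longrightarrow> 0 < f (x(i := v))" unfolding S_def by force
    then have "pd i f x = 0" using nn by (intro pd_zero_if_nonneg_on_ray[OF f(1)]) auto
    with d show False by simp
  qed
  moreover have "closed S"
    unfolding S_def by (intro closed_Collect_conj closed_Collect_le polyfun_coord_continuous[OF f(1)] continuous_intros)
  moreover have bdd: "bdd_above S" unfolding S_def by (auto intro: bdd_aboveI)
  ultimately have "Sup S \<in> S" by (intro closed_contains_Sup)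
  then have u: "Sup S \<le> x i" "f (x(i := Sup S)) \<le> 0"
    unfolding S_def[THEN eqset_imp_iff] by blast+
  have above: "0 < f (x(i := v))" if "Sup S < v" "v \<le> x i" for v
    using cSup_upper[OF _ bdd, of v] that unfolding S_def by force
  show thesis
  proof
    show "Sup S < x i" using u x(2) by (cases "Sup S = x i") auto
    show "f (x(i := Sup S)) \<le> 0" by (rule u)
    show "0 < f (x(i := v)) \<and> nonneg_derivs f (x(i := v))" if "Sup S < v" "v \<le> x i" for v
      using above nn[of v] that by simp
  qed
qed

text \<open>Write \<open>a\<close> for \<open>pd i f\<close> and move along the line in direction \<open>i\<close>. Where \<open>f\<close> is positive, start at its
  largest root: there \<open>a * pd j f / pd j a - f\<close> is nonnegative, and its derivative is nonnegative by
  the inequality for \<open>a\<close>. Where \<open>f\<close> is not positive, go up to the root instead: on the way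
  \<open>pd j f - f * pd j a / a\<close> decreases, again by the inequality for \<open>a\<close>, to the value of \<open>pd j f\<close> at
  the root, which is nonnegative.\<close>

lemma rayleigh:
  assumes "f \<in> polyfun N" "garding_fun f" "nonneg_derivs f (\<lambda>_. 0)" "nonneg_derivs (pd i f) x"
  shows "f x * pd j (pd i f) x \<le> pd i f x * pd j f x"
proof -
  have "garding_fun f \<longrightarrow> nonneg_derivs f (\<lambda>_. 0) \<longrightarrow>
    (\<forall>i j x. nonneg_derivs (pd i f) x \<longrightarrow> f x * pd j (pd i f) x \<le> pd i f x * pd j f x)"
    using assms(1)
  proof (induction rule: polyfun_deriv_induct)
    case (step f)
    show ?case
    proof (intro impI allI)
      fix i j x
      assume gf: "garding_fun f" and n0: "nonneg_derivs f (\<lambda>_. 0)" and nx: "nonneg_derivs (pd i f) x"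
      note f = step.hyps
      note lf = garding_fun_lowerable[OF gf]
      define a where "a = pd i f"
      have pa: "a \<in> polyfun N" unfolding a_def by (rule polyfun_pd[OF f])
      have comm: "pd i (pd j f) = pd j a" unfolding a_def by (rule pd_commute[OF f])
      have IH: "a y * pd i (pd j a) y \<le> pd i a y * pd j a y" if "nonneg_derivs (pd i a) y" for y
        using step.IH[of i] garding_fun_pd[OF gf] nonneg_derivs_pd[OF n0] that pd_commute[OF pa, of i j]
        unfolding a_def by metis
      note Df = pd_has_derivative[OF f, of _ i]
      note Da = pd_has_derivative[OF pa, of _ i]
      note Dfj = pd_has_derivative[OF polyfun_pd[OF f, of j], of _ i, unfolded comm]
      note Daj = pd_has_derivative[OF polyfun_pd[OF pa, of j], of _ i]
      have core: "0 \<le> a y * pd j f y - f y * pd j a y" if ny: "nonneg_derivs a y" and ay: "0 < a y" for y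
      proof (cases "0 < f y")
        case True
        have nf: "nonneg_derivs f y"
          using nonneg_derivs_from_pd[OF f lf n0 _ _ True] ny ay unfolding a_def by blast
        obtain u where u: "u < y i" "f (y(i := u)) \<le> 0"
          "\<And>v. u < v \<Longrightarrow> v \<le> y i \<Longrightarrow> 0 < f (y(i := v)) \<and> nonneg_derivs f (y(i := v))"
          using root_below[OF f lf nf True] ay unfolding a_def by blast
        show ?thesis
        proof (cases "pd j a = (\<lambda>_. 0)")
          case True
          then show ?thesis using ay nonneg_derivs_value[OF nonneg_derivs_pd[OF nf]] by simp
        next
          case False
          have pos: "0 < pd j a (y(i := v))" if "u < v" "v \<le> y i" for v
            using lowerable_derivs[OF f lf, of "y(i := v)" "[i,j]"] u(3)[OF that] False unfolding a_def by auto
          \<comment> \<open>This quotient increases along the line and is nonnegative at the root of \<open>f\<close>.\<close>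
          define E where "E = (\<lambda>v. a (y(i := v)) * pd j f (y(i := v)) / pd j a (y(i := v)) - f (y(i := v)))"
          have mono: "E v \<le> E (y i)" if "u < v" "v \<le> y i" for v
          proof (rule DERIV_nonneg_imp_nondecreasing[OF that(2)])
            fix w assume w: "v \<le> w" "w \<le> y i"
            let ?y = "y(i := w)"
            have p: "0 < pd j a ?y" and nw: "nonneg_derivs f ?y" using pos u(3) w that by auto
            have na: "nonneg_derivs (pd i a) ?y" unfolding a_def by (intro nonneg_derivs_pd nw)
            have "(E has_real_derivative
               ((pd i a ?y * pd j f ?y + pd j a ?y * a ?y) * pd j a ?y - a ?y * pd j f ?y * pd i (pd j a) ?y) / (pd j a ?y * pd j a ?y)
                - a ?y) (at w)"
              unfolding E_def
              by (intro DERIV_diff DERIV_divide DERIV_mult Df[folded a_def] Da Dfj Daj) (use p in auto)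
            moreover have "((pd i a ?y * pd j f ?y + pd j a ?y * a ?y) * pd j a ?y - a ?y * pd j f ?y * pd i (pd j a) ?y) / (pd j a ?y * pd j a ?y)
                - a ?y = pd j f ?y * (pd i a ?y * pd j a ?y - a ?y * pd i (pd j a) ?y) / (pd j a ?y * pd j a ?y)"
              using p by (simp add: field_simps)
            moreover have "0 \<le> pd j f ?y * (pd i a ?y * pd j a ?y - a ?y * pd i (pd j a) ?y) / (pd j a ?y * pd j a ?y)"
              using nonneg_derivs_value[OF nonneg_derivs_pd[OF nw]] IH[OF na] p
              by (intro divide_nonneg_pos mult_nonneg_nonneg) auto
            ultimately show "\<exists>D. (E has_real_derivative D) (at w) \<and> 0 \<le> D" by metis
          qed
          have "- f (y(i := u)) \<le> E (y i)"
          proof (rule right_limit_le[OF _ u(1), of "\<lambda>v. - f (y(i := v))"])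
            show "continuous_on UNIV (\<lambda>v. - f (y(i := v)))"
              by (intro continuous_intros polyfun_coord_continuous[OF f])
            fix v assume v: "u < v" "v \<le> y i"
            have nv: "nonneg_derivs f (y(i := v))" using u(3) v by blast
            have "0 \<le> a (y(i := v)) * pd j f (y(i := v)) / pd j a (y(i := v))"
              using pos[OF v] nonneg_derivs_value[OF nonneg_derivs_pd[OF nv]] unfolding a_def
              by (intro divide_nonneg_pos mult_nonneg_nonneg) auto
            then have "- f (y(i := v)) \<le> E v" unfolding E_def by simp
            with mono[OF v] show "- f (y(i := v)) \<le> E (y i)" by simp
          qed
          then have "f y \<le> a y * pd j f y / pd j a y" using u(2) unfolding E_def by simp
          then show ?thesis using pos[OF u(1)] by (simp add: pos_le_divide_eq)
        qed
      next
        case False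
        obtain L where L: "L \<ge> 0" "0 < f (y(i := y i + L))"
          using nonneg_derivs_raise[OF f lf n0] ny ay unfolding a_def by blast
        have "\<exists>w\<ge>y i. w \<le> y i + L \<and> f (y(i := w)) = 0"
          by (rule IVT') (use False L polyfun_coord_continuous[OF f] in auto)
        then obtain w where w: "y i \<le> w" "f (y(i := w)) = 0" by blast
        have na: "nonneg_derivs a (y(i := v))" if "y i \<le> v" for v
          by (rule nonneg_derivs_mono[OF pa ny]) (use that in auto)
        have av: "0 < a (y(i := v))" if "y i \<le> v" for v
        proof -
          have "a y \<le> a (y(i := v))" by (rule nonneg_derivs_imp_le[OF pa ny]) (use that in auto)
          then show ?thesis using ay by simp
        qed
        have step_le: "f (y(i := v)) + (v' - v) * a (y(i := v)) \<le> f (y(i := v'))" if "y i \<le> v" "v \<le> v'" for v v'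
          using nonneg_derivs_raise_le[OF f, of i "y(i := v)" "v' - v"] na[OF that(1)] that unfolding a_def by simp
        define J where "J = (\<lambda>v. pd j f (y(i := v)) - f (y(i := v)) * pd j a (y(i := v)) / a (y(i := v)))"
        have "J w \<le> J (y i)"
        proof (rule DERIV_nonpos_imp_nonincreasing[OF w(1)])
          fix v assume v: "y i \<le> v" "v \<le> w"
          let ?y = "y(i := v)"
          have p: "0 < a ?y" and nv: "nonneg_derivs a ?y" using av na v by auto
          have "0 \<le> (w - v) * a ?y" using p v by simp
          then have fv: "f ?y \<le> 0" using step_le[OF v] w(2) by linarith
          have "(J has_real_derivative
             pd j a ?y - ((a ?y * pd j a ?y + pd i (pd j a) ?y * f ?y) * a ?y - f ?y * pd j a ?y * pd i a ?y) / (a ?y * a ?y)) (at v)"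
            unfolding J_def
            by (intro DERIV_diff DERIV_divide DERIV_mult Df[folded a_def] Da Dfj Daj) (use p in auto)
          moreover have "pd j a ?y - ((a ?y * pd j a ?y + pd i (pd j a) ?y * f ?y) * a ?y - f ?y * pd j a ?y * pd i a ?y) / (a ?y * a ?y)
              = f ?y * (pd i a ?y * pd j a ?y - a ?y * pd i (pd j a) ?y) / (a ?y * a ?y)"
            using p by (simp add: field_simps)
          moreover have "f ?y * (pd i a ?y * pd j a ?y - a ?y * pd i (pd j a) ?y) / (a ?y * a ?y) \<le> 0"
            using fv IH[OF nonneg_derivs_pd[OF nv]] p
            by (intro divide_nonpos_pos mult_nonpos_nonneg) auto
          ultimately show "\<exists>D. (J has_real_derivative D) (at v) \<and> D \<le> 0" by metis
        qed
        moreover have "- pd j f (y(i := w)) \<le> 0"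
        proof (rule right_limit_le[of "\<lambda>v. - pd j f (y(i := v))" w "w + 1"])
          show "continuous_on UNIV (\<lambda>v. - pd j f (y(i := v)))"
            by (intro continuous_intros polyfun_coord_continuous[OF polyfun_pd[OF f]])
          fix v assume v: "w < v"
          have "0 < f (y(i := v))"

          proof -
            have "0 < (v - w) * a (y(i := w))" using v av[OF w(1)] by simp
            then show ?thesis using step_le[OF w(1), of v] w v by simp
          qed
          then have "nonneg_derivs f (y(i := v))"
            using nonneg_derivs_from_pd[OF f lf n0, of i] na[of v] av[of v] w v unfolding a_def by simp
          then show "- pd j f (y(i := v)) \<le> 0" using nonneg_derivs_value[OF nonneg_derivs_pd] by simp
        qed simp
        ultimately have "0 \<le> pd j f y - f y * pd j a y / a y" using w(2) unfolding J_def by simp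
        then show ?thesis using ay by (simp add: field_simps)
      qed
      show "f x * pd j (pd i f) x \<le> pd i f x * pd j f x"
      proof (cases "a = (\<lambda>_. 0)")
        case True
        then show ?thesis unfolding a_def by simp
      next
        case False
        have "0 \<le> a x * pd j f x - f x * pd j a x"
          by (rule nonneg_from_strict[where x = x and a = a and h = "\<lambda>y. a y * pd j f y - f y * pd j a y",
                OF pa _ False _ core])
             (use nx pa f in \<open>auto simp: a_def intro!: polyfun_diff polyfun.mult polyfun_pd\<close>)
        then show ?thesis unfolding a_def by simp
      qed
    qed
  qed simp
  then show ?thesis using assms by blast
qed

text \<open>As in \<open>rayleigh\<close> for \<open>j = i\<close>. With a bound \<open>k\<close> on the degree in variable \<open>i\<close>, the quantity that
  increases from the root of \<open>f\<close> on is \<open>(k - 1) * (pd i f)\<^sup>2 / pd i (pd i f) - k * f\<close>.\<close>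

lemma laguerre:
  assumes "f \<in> polyfun N" "garding_fun f" "nonneg_derivs f (\<lambda>_. 0)" "nonneg_derivs (pd i f) x"
    and "1 \<le> k" "(pd i ^^ Suc k) f = (\<lambda>_. 0)"
  shows "real k * f x * pd i (pd i f) x \<le> (real k - 1) * (pd i f x)\<^sup>2"
  using assms(5,1-4,6)
proof (induction k arbitrary: f x rule: nat_induct_at_least)
  case base
  then show ?case by simp
next
  case (Suc k)
  note f = Suc.prems(1) and gf = Suc.prems(2) and n0 = Suc.prems(3)
  note lf = garding_fun_lowerable[OF gf]
  define a where "a = pd i f"
  have pa: "a \<in> polyfun N" unfolding a_def by (rule polyfun_pd[OF f])
  have "(pd i ^^ Suc k) a = (\<lambda>_. 0)" using Suc.prems(5) unfolding a_def by (simp add: funpow_swap1)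
  then have IH: "real k * a y * pd i (pd i a) y \<le> (real k - 1) * (pd i a y)\<^sup>2" if "nonneg_derivs (pd i a) y" for y
    using Suc.IH[OF pa _ _ that] garding_fun_pd[OF gf] nonneg_derivs_pd[OF n0] unfolding a_def by blast
  note Df = pd_has_derivative[OF f, of _ i, folded a_def]
  note Da = pd_has_derivative[OF pa, of _ i]
  note Dai = pd_has_derivative[OF polyfun_pd[OF pa, of i], of _ i]
  have core: "0 \<le> real k * (a y)\<^sup>2 - real (Suc k) * f y * pd i a y" if ny: "nonneg_derivs a y" and ay: "0 < a y" for y
  proof (cases "0 < f y")
    case True
    have nf: "nonneg_derivs f y"
      using nonneg_derivs_from_pd[OF f lf n0 _ _ True] ny ay unfolding a_def by blast
    obtain u where u: "u < y i" "f (y(i := u)) \<le> 0"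
      "\<And>v. u < v \<Longrightarrow> v \<le> y i \<Longrightarrow> 0 < f (y(i := v)) \<and> nonneg_derivs f (y(i := v))"
      using root_below[OF f lf nf True] ay unfolding a_def by blast
    show ?thesis
    proof (cases "pd i a = (\<lambda>_. 0)")
      case True
      then show ?thesis by simp
    next
      case False
      have pos: "0 < pd i a (y(i := v))" if "u < v" "v \<le> y i" for v
        using lowerable_derivs[OF f lf conjunct1[OF u(3)[OF that]] conjunct2[OF u(3)[OF that]], of "[i,i]"] False
        unfolding a_def by simp
      define E where "E = (\<lambda>v. real k * (a (y(i := v)) * a (y(i := v))) / pd i a (y(i := v)) - real (Suc k) * f (y(i := v)))"
      have mono: "E v \<le> E (y i)" if "u < v" "v \<le> y i" for v
      proof (rule DERIV_nonneg_imp_nondecreasing[OF that(2)])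
        fix w assume w: "v \<le> w" "w \<le> y i"
        let ?y = "y(i := w)"
        have p: "0 < pd i a ?y" and nw: "nonneg_derivs f ?y" using pos u(3) w that by auto
        have na: "nonneg_derivs (pd i a) ?y" unfolding a_def by (intro nonneg_derivs_pd nw)
        have a0: "0 \<le> a ?y" unfolding a_def by (rule nonneg_derivs_value[OF nonneg_derivs_pd[OF nw]])
        have "(E has_real_derivative
           ((real k * (pd i a ?y * a ?y + pd i a ?y * a ?y)) * pd i a ?y - real k * (a ?y * a ?y) * pd i (pd i a) ?y) / (pd i a ?y * pd i a ?y)
            - real (Suc k) * a ?y) (at w)"
          unfolding E_def
          by (intro DERIV_diff DERIV_divide DERIV_mult DERIV_cmult Df Da Dai) (use p in auto)
        moreover have "((real k * (pd i a ?y * a ?y + pd i a ?y * a ?y)) * pd i a ?y - real k * (a ?y * a ?y) * pd i (pd i a) ?y) / (pd i a ?y * pd i a ?y)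
            - real (Suc k) * a ?y = a ?y * ((real k - 1) * (pd i a ?y)\<^sup>2 - real k * a ?y * pd i (pd i a) ?y) / (pd i a ?y * pd i a ?y)"
          using p by (simp add: field_simps power2_eq_square)
        moreover have "0 \<le> a ?y * ((real k - 1) * (pd i a ?y)\<^sup>2 - real k * a ?y * pd i (pd i a) ?y) / (pd i a ?y * pd i a ?y)"
          using a0 IH[OF na] p
          by (intro divide_nonneg_pos mult_nonneg_nonneg) auto
        ultimately show "\<exists>D. (E has_real_derivative D) (at w) \<and> 0 \<le> D" by metis
      qed
      have "real (Suc k) * - f (y(i := u)) \<le> E (y i)"
      proof (rule right_limit_le[OF _ u(1), of "\<lambda>v. real (Suc k) * - f (y(i := v))"])
        show "continuous_on UNIV (\<lambda>v. real (Suc k) * - f (y(i := v)))"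
          by (intro continuous_intros polyfun_coord_continuous[OF f])
        fix v assume v: "u < v" "v \<le> y i"
        have "0 \<le> real k * (a (y(i := v)) * a (y(i := v))) / pd i a (y(i := v))"
          using pos[OF v] by simp
        then have "real (Suc k) * - f (y(i := v)) \<le> E v" unfolding E_def by simp
        with mono[OF v] show "real (Suc k) * - f (y(i := v)) \<le> E (y i)" by simp
      qed
      moreover have "0 \<le> real (Suc k) * - f (y(i := u))"
        using u(2) by (intro mult_nonneg_nonneg) auto
      ultimately have "real (Suc k) * f y \<le> real k * (a y * a y) / pd i a y" unfolding E_def by simp
      then show ?thesis using pos[OF u(1)] by (simp add: pos_le_divide_eq power2_eq_square algebra_simps)
    qed
  next
    case False
    have "0 \<le> pd i a y" using ny nonneg_derivs_pd nonneg_derivs_value by blast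
    then have "real (Suc k) * f y * pd i a y \<le> 0"
      using False by (intro mult_nonpos_nonneg mult_nonneg_nonpos) auto
    moreover have "0 \<le> real k * (a y)\<^sup>2" by simp
    ultimately show ?thesis by linarith
  qed
  show ?case
  proof (cases "a = (\<lambda>_. 0)")
    case True
    then show ?thesis unfolding a_def by simp
  next
    case False
    have "0 \<le> real k * (a x)\<^sup>2 - real (Suc k) * f x * pd i a x"
      by (rule nonneg_from_strict[where x = x and a = a and h = "\<lambda>y. real k * (a y)\<^sup>2 - real (Suc k) * f y * pd i a y",
            OF pa _ False _ core])
         (use Suc.prems(4) pa f in \<open>auto simp: a_def intro!: polyfun_diff polyfun.mult polyfun_cmult polyfun_power polyfun_pd polyfun.const\<close>)
    then show ?thesis unfolding a_def by simp
  qed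
qed

text \<open>The inequalities say that \<open>a / F\<close> does not increase along the diagonal. It is zero at \<open>x\<close> and
  nonnegative above, so it stays zero.\<close>

lemma zero_by_ratio:
  assumes F: "F \<in> polyfun N" "nonneg_derivs F x" "0 < F x"
    and a: "a \<in> polyfun N" "nonneg_derivs a x" "a x = 0"
    and le: "\<And>t j. 0 \<le> t \<Longrightarrow> pd j a (\<lambda>l. x l + t) * F (\<lambda>l. x l + t) \<le> a (\<lambda>l. x l + t) * pd j F (\<lambda>l. x l + t)"
  shows "a = (\<lambda>_. 0)"
proof -
  let ?z = "\<lambda>t l. x l + t"
  have pos: "0 < F (?z t)" if "0 \<le> t" for t
  proof -
    have "F x \<le> F (?z t)" by (rule nonneg_derivs_imp_le[OF F(1,2)]) (use that in simp)
    then show ?thesis using F(3) by simp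
  qed
  define q where "q = (\<lambda>t. a (?z t) / F (?z t))"
  have "q 1 \<le> q 0"
  proof (rule DERIV_nonpos_imp_nonincreasing[of 0 1 q])
    fix t :: real assume t: "0 \<le> t"
    have D: "((\<lambda>t. h (?z t)) has_real_derivative (\<Sum>j<N. 1 * pd j h (?z t))) (at t)" if "h \<in> polyfun N" for h
      by (rule polyfun_chain_rule[OF that]) (auto intro!: derivative_eq_intros)
    have "(q has_real_derivative
       ((\<Sum>j<N. 1 * pd j a (?z t)) * F (?z t) - a (?z t) * (\<Sum>j<N. 1 * pd j F (?z t))) / (F (?z t) * F (?z t))) (at t)"
      unfolding q_def by (intro DERIV_divide D F a) (use pos[OF t] in auto)
    moreover have "((\<Sum>j<N. 1 * pd j a (?z t)) * F (?z t) - a (?z t) * (\<Sum>j<N. 1 * pd j F (?z t))) / (F (?z t) * F (?z t)) \<le> 0"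
    proof (rule divide_nonpos_pos)
      show "(\<Sum>j<N. 1 * pd j a (?z t)) * F (?z t) - a (?z t) * (\<Sum>j<N. 1 * pd j F (?z t)) \<le> 0"
        using le[OF t] by (simp add: sum_distrib_left sum_distrib_right sum_mono)
      show "0 < F (?z t) * F (?z t)" using pos[OF t] by simp
    qed
    ultimately show "\<exists>D. (q has_real_derivative D) (at t) \<and> D \<le> 0" by blast
  qed simp
  then have "a (?z 1) / F (?z 1) \<le> 0" using a(3) unfolding q_def by simp
  then have "a (?z 1) \<le> 0" using pos[of 1] by (simp add: divide_le_0_iff)
  moreover have "0 \<le> a (?z 1)"
    by (rule nonneg_derivs_value, rule nonneg_derivs_mono[OF a(1,2)]) simp
  ultimately show ?thesis
    by (intro nonneg_derivs_zero_above[OF a(1,2), of "?z 1"]) auto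
qed


section \<open>Partial polarization\<close>

text \<open>For \<open>f\<close> of degree at most \<open>k\<close> in variable \<open>i\<close> and without the variable \<open>s\<close>, this is the polar form
  that splits off one copy \<open>s\<close> of variable \<open>i\<close>: it is affine in \<open>s\<close>, its degree in \<open>i\<close> is at most
  \<open>k - 1\<close>, and setting \<open>s\<close> equal to \<open>i\<close> gives back \<open>f\<close>.\<close>

definition polar :: "nat \<Rightarrow> nat \<Rightarrow> nat \<Rightarrow> ((nat \<Rightarrow> real) \<Rightarrow> real) \<Rightarrow> (nat \<Rightarrow> real) \<Rightarrow> real" where
  "polar k i s f = (\<lambda>x. f x + (x s - x i) * (pd i f x / real k))"

lemma polyfun_polar: "f \<in> polyfun N \<Longrightarrow> i < N \<Longrightarrow> s < N \<Longrightarrow> polar k i s f \<in> polyfun N"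
  unfolding polar_def divide_inverse
  by (intro polyfun.intros polyfun_diff polyfun_pd)

lemma funpow_pd_zero [simp]: "(pd i ^^ k) (\<lambda>_. 0) = (\<lambda>_. 0)"
  by (induction k) auto

lemma polyfun_funpow: "f \<in> polyfun N \<Longrightarrow> (pd i ^^ k) f \<in> polyfun N"
  by (induction k) (auto intro: polyfun_pd)

lemma funpow_pd_commute: "f \<in> polyfun N \<Longrightarrow> (pd i ^^ k) (pd j f) = pd j ((pd i ^^ k) f)"
  by (induction k) (auto simp: polyfun_funpow pd_commute[of _ N i j])

lemma funpow_pd_cmult: "f \<in> polyfun N \<Longrightarrow> (pd i ^^ k) (\<lambda>x. c * f x) = (\<lambda>x. c * (pd i ^^ k) f x)"
  by (induction k) (auto simp: pd_cmult[OF polyfun_funpow])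

context
  fixes f N i s
  assumes f: "f \<in> polyfun N" and i: "i < N" and s: "s < N" and ne: "i \<noteq> s" and fs: "pd s f = (\<lambda>_. 0)"
begin

lemma pd_polar:
  "pd j (polar k i s f) = (\<lambda>x. pd j f x +
     (((if j = s then 1 else 0) - (if j = i then 1 else 0)) * (pd i f x / k)
       + (x s - x i) * (pd j (pd i f) x / k)))"
proof -
  have p: "(\<lambda>x. pd i f x / real k) \<in> polyfun N"
    unfolding divide_inverse by (intro polyfun.intros polyfun_pd f)
  have c: "pd j (\<lambda>x. pd i f x / real k) = (\<lambda>x. pd j (pd i f) x / real k)"
    using pd_cmult[OF polyfun_pd[OF f, of i], of j "1 / real k"] by simp
  have d: "(\<lambda>x. x s - x i) \<in> polyfun N"
    by (intro polyfun_diff polyfun.intros i s)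
  have e: "pd j (\<lambda>x. x s - x i) = (\<lambda>_. (if j = s then 1 else 0) - (if j = i then 1 else 0))"
    by (subst pd_diff[of _ N _ N]) (auto simp: pd_coord intro: polyfun.coord i s)
  show ?thesis
    unfolding polar_def
    by (subst pd_add[OF f polyfun.mult[OF d p]], subst pd_mult[OF d p], subst c, subst e) simp
qed

lemma pd_new_polar: "pd s (polar k i s f) = (\<lambda>x. (1 / real k) * pd i f x)"
  using pd_commute[OF f, of s i] fs ne by (simp add: pd_polar)

lemma pd_old_polar:
  assumes "1 \<le> k" "(pd i ^^ Suc k) f = (\<lambda>_. 0)"
  shows "pd i (polar k i s f) = (\<lambda>x. ((real k - 1) / real k) * polar (k - 1) i s (pd i f) x)"
proof (cases "k = 1")
  case True
  then show ?thesis using assms ne by (simp add: pd_polar)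
next
  case False
  then have "real k - 1 \<noteq> 0" "real k \<noteq> 0" "real (k - 1) = real k - 1" using assms(1) by auto
  then show ?thesis using ne by (intro ext trans[OF fun_cong[OF pd_polar]]) (simp add: polar_def field_simps)
qed

lemma pd_other_polar:
  assumes "j \<noteq> i" "j \<noteq> s"
  shows "pd j (polar k i s f) = polar k i s (pd j f)"
  using pd_commute[OF f, of j i] assms by (intro ext trans[OF fun_cong[OF pd_polar]]) (simp add: polar_def)

end

lemma garding_fun_cmult:
  assumes "f \<in> polyfun N" "garding_fun f" "0 \<le> c"
  shows "garding_fun (\<lambda>x. c * f x)"
proof (cases "c = 0")
  case False
  then have c: "0 < c" using assms(3) by simp
  have scale: "nonneg_derivs (\<lambda>x. c * g x) x \<longleftrightarrow> nonneg_derivs g x" if "g \<in> polyfun N" for g x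
    using c by (simp add: nonneg_derivs_def pds_cmult[OF that] zero_le_mult_iff)
  show ?thesis
    unfolding garding_fun_def
  proof
    fix js
    have p: "pds js f \<in> polyfun N" by (rule polyfun_pds[OF assms(1)])
    have "lowerable (pds js f)" using assms(2) by (simp add: garding_fun_def)
    then show "lowerable (pds js (\<lambda>x. c * f x))"
      using c by (simp add: pds_cmult[OF assms(1)] lowerable_def scale[OF p] zero_less_mult_iff)
  qed
qed (simp add: garding_fun_zero)

lemma nonneg_derivs_polar:
  assumes "f \<in> polyfun N" "i < N" "s < N" "i \<noteq> s" "pd s f = (\<lambda>_. 0)"
    and "1 \<le> k" "(pd i ^^ Suc k) f = (\<lambda>_. 0)" "nonneg_derivs f x" "x s = x i"
  shows "nonneg_derivs (polar k i s f) x"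
proof -
  have "\<forall>k\<ge>1. pd s f = (\<lambda>_. 0) \<longrightarrow> (pd i ^^ Suc k) f = (\<lambda>_. 0) \<longrightarrow> nonneg_derivs f x \<longrightarrow>
    nonneg_derivs (polar k i s f) x"
    using assms(1)
  proof (induction rule: polyfun_deriv_induct)
    case zero
    then show ?case by (simp add: polar_def)
  next
    case (step f)
    note f = step.hyps
    show ?case
    proof (intro allI impI)
      fix k :: nat
      assume k: "1 \<le> k" and fs: "pd s f = (\<lambda>_. 0)" and deg: "(pd i ^^ Suc k) f = (\<lambda>_. 0)" and nx: "nonneg_derivs f x"
      note base = f assms(2-4) fs
      have z: "pd s (pd j f) = (\<lambda>_. 0)" for j using pd_commute[OF f, of s j] fs by simp
      show "nonneg_derivs (polar k i s f) x"
      proof (rule nonneg_derivsI)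
        show "0 \<le> polar k i s f x"
          using assms(9) nonneg_derivs_value[OF nx] by (simp add: polar_def)
        fix j
        consider "j = s" | "j = i" "k = 1" | "j = i" "2 \<le> k" | "j \<noteq> s" "j \<noteq> i" using k by linarith
        then show "nonneg_derivs (pd j (polar k i s f)) x"
        proof cases
          case 1
          show ?thesis
            unfolding 1 pd_new_polar[OF base]
            by (intro nonneg_derivs_cmult[OF polyfun_pd[OF f]] nonneg_derivs_pd nx) simp
        next
          case 2
          then show ?thesis using pd_old_polar[OF base k deg] by simp
        next
          case 3
          have "(pd i ^^ Suc (k - 1)) (pd i f) = (\<lambda>_. 0)"
            using deg 3 by (simp add: funpow_swap1)
          then have "nonneg_derivs (polar (k - 1) i s (pd i f)) x"
            using step.IH[of i, rule_format, of "k - 1"] 3 z[of i] nonneg_derivs_pd[OF nx]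
            by (simp del: funpow.simps)
          then show ?thesis
            unfolding 3(1) pd_old_polar[OF base k deg]
            by (intro nonneg_derivs_cmult[OF polyfun_polar[OF polyfun_pd[OF f] assms(2,3)]]) (use k in auto)
        next
          case 4
          have "(pd i ^^ Suc k) (pd j f) = (\<lambda>_. 0)"
            unfolding funpow_pd_commute[OF f] deg by simp
          then show ?thesis
            unfolding pd_other_polar[OF base 4(2,1)] using step.IH[of j] k z nonneg_derivs_pd[OF nx] by blast
        qed
      qed
    qed
  qed
  then show ?thesis using assms by blast
qed

text \<open>The derivatives of the polar form \<open>F\<close> are multiples of \<open>pd i f\<close> and of polar forms of
  derivatives of \<open>f\<close>, so by induction only the lowerability of \<open>F\<close> is left. The inequalities
  \<open>rayleigh\<close> and \<open>laguerre\<close> for \<open>f\<close> amount to \<open>F\<^sub>s\<^sub>j F \<le> F\<^sub>s F\<^sub>j\<close> for all \<open>j\<close>. With \<open>zero_by_ratio\<close>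
  they make \<open>F\<^sub>s\<close> positive, and then the same inequalities make the other derivatives positive.\<close>

lemma garding_fun_polar:
  assumes "f \<in> polyfun N" "i < N" "s < N" "i \<noteq> s" "pd s f = (\<lambda>_. 0)"
    and "1 \<le> k" "(pd i ^^ Suc k) f = (\<lambda>_. 0)" "garding_fun f" "nonneg_derivs f (\<lambda>_. 0)"
  shows "garding_fun (polar k i s f)"
proof -
  have "\<forall>k\<ge>1. pd s f = (\<lambda>_. 0) \<longrightarrow> (pd i ^^ Suc k) f = (\<lambda>_. 0) \<longrightarrow> garding_fun f \<longrightarrow>
    nonneg_derivs f (\<lambda>_. 0) \<longrightarrow> garding_fun (polar k i s f)"
    using assms(1)
  proof (induction rule: polyfun_deriv_induct)
    case zero
    then show ?case by (simp add: polar_def garding_fun_zero)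
  next
    case (step f)
    note f = step.hyps
    show ?case
    proof (intro allI impI)
      fix k :: nat
      assume k: "1 \<le> k" and fs: "pd s f = (\<lambda>_. 0)" and deg: "(pd i ^^ Suc k) f = (\<lambda>_. 0)"
        and gf: "garding_fun f" and n0: "nonneg_derivs f (\<lambda>_. 0)"
      note base = f assms(2-4) fs
      have z: "pd s (pd j f) = (\<lambda>_. 0)" for j using pd_commute[OF f, of s j] fs by simp
      define F where "F = polar k i s f"
      define a where "a = pd i f"
      have pF: "F \<in> polyfun N" unfolding F_def by (rule polyfun_polar[OF f assms(2,3)])
      have pa: "a \<in> polyfun N" unfolding a_def by (rule polyfun_pd[OF f])
      have derivs: "garding_fun (pd j F)" for j
      proof -
        consider "j = s" | "j = i" "k = 1" | "j = i" "2 \<le> k" | "j \<noteq> s" "j \<noteq> i" using k by linarith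
        then show ?thesis
        proof cases
          case 1
          show ?thesis
            unfolding F_def 1 pd_new_polar[OF base]
            by (intro garding_fun_cmult[OF polyfun_pd[OF f]] garding_fun_pd gf) simp
        next
          case 2
          then show ?thesis using pd_old_polar[OF base k deg] by (simp add: F_def garding_fun_zero)
        next
          case 3
          have "(pd i ^^ Suc (k - 1)) (pd i f) = (\<lambda>_. 0)"
            using deg 3 by (simp add: funpow_swap1)
          then have "garding_fun (polar (k - 1) i s (pd i f))"
            using step.IH[of i, rule_format, of "k - 1"] 3 z[of i] nonneg_derivs_pd[OF n0] garding_fun_pd[OF gf]
            by (simp del: funpow.simps)
          then show ?thesis
            unfolding F_def 3(1) pd_old_polar[OF base k deg]
            by (intro garding_fun_cmult[OF polyfun_polar[OF polyfun_pd[OF f] assms(2,3)]]) (use k in auto)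
        next
          case 4
          have "(pd i ^^ Suc k) (pd j f) = (\<lambda>_. 0)"
            unfolding funpow_pd_commute[OF f] deg by simp
          then show ?thesis
            unfolding F_def pd_other_polar[OF base 4(2,1)]
            using step.IH[of j] k z nonneg_derivs_pd[OF n0] garding_fun_pd[OF gf] by blast
        qed
      qed
      have dF: "pd j F x = pd j f x +
          (((if j = s then 1 else 0) - (if j = i then 1 else 0)) * (a x / k) + (x s - x i) * (pd j a x / k))" for j x
        unfolding F_def pd_polar[OF base] a_def ..
      have Fx: "F x = f x + (x s - x i) * (a x / k)" for x
        unfolding F_def polar_def a_def ..
      have as: "pd s a = (\<lambda>_. 0)" unfolding a_def by (rule z)
      have key: "pd j a y * F y \<le> a y * pd j F y" if ny: "nonneg_derivs a y" for j y
      proof -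
        define c where "c = (a y * a y) / k"
        have "0 \<le> c" unfolding c_def by simp
        moreover have "a y * pd j F y - pd j a y * F y
            = a y * pd j f y - f y * pd j a y + ((if j = s then 1 else 0) - (if j = i then 1 else 0)) * c"
          unfolding dF Fx c_def by (simp add: algebra_simps)
        moreover have "0 \<le> a y * pd j f y - f y * pd j a y"
          using rayleigh[OF f gf n0, of i y j] ny unfolding a_def by simp
        moreover have "0 \<le> a y * pd i f y - f y * pd i a y - c"
          using laguerre[OF f gf n0 _ k deg, of y] ny k unfolding a_def c_def
          by (simp add: field_simps power2_eq_square)
        ultimately show ?thesis using assms(4) by (cases "j = i"; cases "j = s") auto
      qed
      have "lowerable F"
      proof (rule lowerableI[OF pF garding_fun_lowerable[OF derivs]])
        fix x j assume Fpos: "0 < F x" and nF: "nonneg_derivs F x"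
        show "pd j F = (\<lambda>_. 0) \<or> 0 < pd j F x"
        proof (cases "a = (\<lambda>_. 0)")
          case True
          then have "F = f" unfolding F_def polar_def a_def by simp
          then show ?thesis using lowerable_pd_pos[OF f garding_fun_lowerable[OF gf]] Fpos nF by simp
        next
          case False
          have "nonneg_derivs (\<lambda>x. real k * pd s F x) x"
            by (intro nonneg_derivs_cmult[OF polyfun_pd[OF pF]] nonneg_derivs_pd nF) simp
          moreover have "(\<lambda>x. real k * pd s F x) = a"
            using k unfolding F_def pd_new_polar[OF base] a_def by simp
          ultimately have na: "nonneg_derivs a x" by simp
          have "a x \<noteq> 0"
          proof
            assume "a x = 0"
            have "a = (\<lambda>_. 0)"
            proof (rule zero_by_ratio[OF pF nF Fpos pa na \<open>a x = 0\<close> key])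
              fix t :: real assume "0 \<le> t"
              then show "nonneg_derivs a (\<lambda>l. x l + t)"
                by (intro nonneg_derivs_mono[OF pa na]) simp
            qed
            with False show False by simp
          qed
          then have ax: "0 < a x" using nonneg_derivs_value[OF na] by simp
          have full: "pd j a = (\<lambda>_. 0) \<or> 0 < pd j a x"
            using lowerable_pd_pos[OF pa _ ax na] garding_fun_lowerable[OF garding_fun_pd[OF gf]] unfolding a_def by blast
          consider "j = s" | "0 < pd j a x" | "j = i" "pd i a = (\<lambda>_. 0)" | "j \<noteq> s" "j \<noteq> i" "pd j a = (\<lambda>_. 0)"
            using full by auto
          then show ?thesis
          proof cases
            case 1
            have "pd s F x = a x / k" unfolding F_def pd_new_polar[OF base] a_def by simp
            then show ?thesis using 1 ax k by simp
          next
            case 2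
            have "0 < pd j a x * F x" using 2 Fpos by simp
            also have "\<dots> \<le> a x * pd j F x" by (rule key[OF na])
            finally show ?thesis using ax by (simp add: zero_less_mult_iff)
          next
            case 3
            show ?thesis
            proof (cases "k = 1")
              case True
              then show ?thesis using pd_old_polar[OF base k deg] 3 by (simp add: F_def)
            next
              case False
              then have "a x / real k < a x" using ax k by (simp add: divide_less_eq)
              then have "0 < pd i F x" using assms(4) 3 by (simp add: dF, simp add: a_def)
              then show ?thesis using 3 by simp
            qed
          next
            case 4
            have eq: "pd j F = pd j f" by (rule ext) (use 4 in \<open>simp add: dF\<close>)
            obtain L where L: "0 < f (x(i := x i + L))" "nonneg_derivs f (x(i := x i + L))"
              using nonneg_derivs_raise[OF f garding_fun_lowerable[OF gf] n0] na ax unfolding a_def by blast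
            have "pd i (pd j f) = (\<lambda>_. 0)" using 4(3) pd_commute[OF f] unfolding a_def by metis
            then have "pd j f (x(i := x i + L)) = pd j f x"
              by (rule pd_zero_imp_indep[OF polyfun_pd[OF f]])
            then show ?thesis
              using lowerable_pd_pos[OF f garding_fun_lowerable[OF gf] L, of j] unfolding eq by simp
          qed
        qed
      qed
      then show "garding_fun (polar k i s f)"
        using garding_funI derivs unfolding F_def by blast
    qed
  qed
  then show ?thesis using assms by blast
qed

lemma funpow_pd_polar:
  assumes "f \<in> polyfun N" "i < N" "s < N" "i \<noteq> s" "pd s f = (\<lambda>_. 0)" "(pd i ^^ Suc k) f = (\<lambda>_. 0)" "1 \<le> k"
  shows "(pd i ^^ k) (polar k i s f) = (\<lambda>_. 0)"
  using assms(7,1-6)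
proof (induction k arbitrary: f rule: nat_induct_at_least)
  case base
  then show ?case using pd_old_polar[OF base.prems(1-5), of 1] by simp
next
  case (Suc k)
  have "(pd i ^^ Suc k) (pd i f) = (\<lambda>_. 0)" using Suc.prems(6) by (simp add: funpow_swap1)
  moreover have "pd s (pd i f) = (\<lambda>_. 0)" using pd_commute[OF Suc.prems(1), of s i] Suc.prems(5) by simp
  ultimately have "(pd i ^^ k) (polar k i s (pd i f)) = (\<lambda>_. 0)"
    using Suc.IH[OF polyfun_pd[OF Suc.prems(1)] Suc.prems(2-4)] by blast
  moreover have "(pd i ^^ Suc k) (polar (Suc k) i s f) = (pd i ^^ k) (pd i (polar (Suc k) i s f))"
    by (simp add: funpow_swap1)
  moreover have eq: "pd i (polar (Suc k) i s f) = (\<lambda>x. ((real (Suc k) - 1) / real (Suc k)) * polar k i s (pd i f) x)"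
    using pd_old_polar[OF Suc.prems(1-5) _ Suc.prems(6)] by simp
  ultimately show ?case
    by (simp only: funpow_pd_cmult[OF polyfun_polar[OF polyfun_pd[OF Suc.prems(1)] Suc.prems(2,3)]] mult_zero_right)
qed

lemma funpow_pd_other_polar:
  assumes "f \<in> polyfun N" "i < N" "s < N" "i \<noteq> s" "pd s f = (\<lambda>_. 0)" "j \<noteq> i" "j \<noteq> s"
  shows "(pd j ^^ l) (polar k i s f) = polar k i s ((pd j ^^ l) f)"
proof (induction l)
  case (Suc l)
  have "pd s ((pd j ^^ l) f) = (\<lambda>_. 0)"
    using funpow_pd_commute[OF assms(1), where i = j and k = l and j = s] assms(5) by simp
  then show ?case
    using Suc pd_other_polar[OF polyfun_funpow[OF assms(1)] assms(2-4) _ assms(6,7)] by simp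
qed simp


section \<open>Composition with positive affine maps\<close>

definition dir_deriv :: "nat \<Rightarrow> (nat \<Rightarrow> real) \<Rightarrow> ((nat \<Rightarrow> real) \<Rightarrow> real) \<Rightarrow> (nat \<Rightarrow> real) \<Rightarrow> real" where
  "dir_deriv M v g = (\<lambda>x. \<Sum>j<M. v j * pd j g x)"

lemma polyfun_dir_deriv: "g \<in> polyfun N \<Longrightarrow> dir_deriv M v g \<in> polyfun N"
  unfolding dir_deriv_def by (intro polyfun_sum polyfun_cmult polyfun_pd)

lemma nonneg_derivs_dir_deriv:
  "g \<in> polyfun N \<Longrightarrow> (\<And>j. j < M \<Longrightarrow> 0 \<le> v j) \<Longrightarrow> nonneg_derivs g x \<Longrightarrow> nonneg_derivs (dir_deriv M v g) x"
  unfolding dir_deriv_def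
  by (intro nonneg_derivs_sum[of _ _ N] nonneg_derivs_cmult[of _ N] polyfun_cmult polyfun_pd nonneg_derivs_pd) auto

lemma polyfun_affine_coord: "(\<lambda>x. affine_map N M A b x j) \<in> polyfun N"
  unfolding affine_map_def
  by (cases "j < M") (auto intro!: polyfun.add polyfun_sum polyfun_cmult polyfun.intros)

lemma polyfun_affine: "g \<in> polyfun M \<Longrightarrow> (\<lambda>x. g (affine_map N M A b x)) \<in> polyfun N"
  by (rule polyfun_compose[where M = M and f = g]) (auto intro: polyfun_affine_coord)

lemma pd_affine:
  assumes g: "g \<in> polyfun M" and i: "i < N"
  shows "pd i (\<lambda>x. g (affine_map N M A b x)) = (\<lambda>x. dir_deriv M (\<lambda>j. A j i) g (affine_map N M A b x))"
proof (rule pd_eqI)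
  fix x
  have "((\<lambda>t. affine_map N M A b (x(i := t)) j) has_real_derivative A j i) (at (x i))" if "j < M" for j
  proof -
    have "((\<lambda>t. (\<Sum>l<N. A j l * (x(i := t)) l) + b j) has_real_derivative
        (\<Sum>l<N. A j l * (if l = i then 1 else 0)) + 0) (at (x i))"
      by (intro DERIV_add DERIV_sum DERIV_cmult DERIV_const) (auto intro!: derivative_eq_intros)
    moreover have "(\<Sum>l<N. A j l * (if l = i then 1 else 0)) + 0 = A j i"
      using i by (simp add: if_distrib[of "\<lambda>z. _ * z"] sum.delta cong: if_cong)
    ultimately show ?thesis using that unfolding affine_map_def by simp
  qed
  then have "((\<lambda>t. g (affine_map N M A b (x(i := t)))) has_real_derivative
      (\<Sum>j<M. A j i * pd j g (affine_map N M A b (x(i := x i))))) (at (x i))"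
    by (intro polyfun_chain_rule[OF g])
  then show "((\<lambda>t. g (affine_map N M A b (x(i := t)))) has_real_derivative
      dir_deriv M (\<lambda>j. A j i) g (affine_map N M A b x)) (at (x i))"
    by (simp add: dir_deriv_def)
qed

lemma nonneg_derivs_affine:
  assumes "g \<in> polyfun M" "\<And>i j. i < N \<Longrightarrow> j < M \<Longrightarrow> 0 \<le> A j i"
    and "nonneg_derivs g (affine_map N M A b x)"
  shows "nonneg_derivs (\<lambda>x. g (affine_map N M A b x)) x"
proof -
  have "0 \<le> pds is (\<lambda>x. g (affine_map N M A b x)) x" for "is"
    using assms(1,3)
  proof (induction "is" arbitrary: g)
    case Nil
    then show ?case by (simp add: nonneg_derivs_value)
  next
    case (Cons i js)
    show ?case
    proof (cases "i < N")
      case True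
      then show ?thesis
        using Cons assms(2) polyfun_dir_deriv nonneg_derivs_dir_deriv by (simp add: pd_affine)
    next
      case False
      then show ?thesis using pd_outside[OF polyfun_affine[OF Cons.prems(1)]] by simp
    qed
  qed
  then show ?thesis by (simp add: nonneg_derivs_def)
qed

text \<open>The row sums are positive, so a diagonal step increases every coordinate of the image. Far enough
  on a diagonal ray the image lies above the origin, and a segment brings the nonnegativity back.\<close>

lemma lowerable_affine:
  assumes g: "g \<in> polyfun M" "lowerable g" "nonneg_derivs g (\<lambda>_. 0)"
    and A: "\<And>i j. i < N \<Longrightarrow> j < M \<Longrightarrow> 0 \<le> A j i" "\<And>j. j < M \<Longrightarrow> 0 < (\<Sum>i<N. A j i)"
  shows "lowerable (\<lambda>x. g (affine_map N M A b x))"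
  unfolding lowerable_def
proof (intro allI impI)
  let ?m = "affine_map N M A b"
  fix x assume x: "0 < g (?m x)" "nonneg_derivs (\<lambda>x. g (?m x)) x"
  define \<sigma> where "\<sigma> j = (\<Sum>i<N. A j i)" for j
  have shift: "?m (\<lambda>i. x i + t) j = ?m x j + t * \<sigma> j" if "j < M" for t j
    using that by (simp add: affine_map_def \<sigma>_def algebra_simps sum.distrib sum_distrib_left)
  define T where "T = (\<Sum>j<M. \<bar>?m x j\<bar> / \<sigma> j)"
  have T0: "0 \<le> T" unfolding T_def \<sigma>_def using A(2) by (intro sum_nonneg) (simp add: less_imp_le)
  have T: "0 \<le> ?m x j + T * \<sigma> j" if j: "j < M" for j
  proof -
    have p: "0 < \<sigma> j" unfolding \<sigma>_def by (rule A(2)[OF j])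
    have "\<bar>?m x j\<bar> / \<sigma> j \<le> T"
      unfolding T_def using j A(2) by (intro member_le_sum) (auto simp: \<sigma>_def less_imp_le)
    then show ?thesis using p by (simp add: pos_divide_le_eq)
  qed
  define y where "y = ?m (\<lambda>i. x i + T)"
  have "nonneg_derivs g (?m x)"
  proof (rule nonneg_derivs_segment[OF g(1,2)])
    show "nonneg_derivs g y"
      by (rule nonneg_derivs_mono[OF g(1,3)]) (use T shift in \<open>auto simp: y_def\<close>)
    fix t :: real assume t: "0 \<le> t" "t \<le> 1"
    have "g (?m x) \<le> g (?m (\<lambda>i. x i + t * T))"
      using nonneg_derivs_imp_le[OF polyfun_affine[OF g(1)] x(2), of "\<lambda>i. x i + t * T"] t T0 by simp
    also have "\<dots> = g (\<lambda>j. ?m x j + t * (y j - ?m x j))"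
    proof (rule polyfun_cong[OF g(1)])
      fix j assume j: "j < M"
      show "?m (\<lambda>i. x i + t * T) j = ?m x j + t * (y j - ?m x j)"
        unfolding y_def shift[OF j] by simp
    qed
    finally show "0 < g (\<lambda>j. ?m x j + t * (y j - ?m x j))" using x(1) by simp
  qed
  then obtain e where e: "0 < e" "nonneg_derivs g (\<lambda>j. ?m x j - e)"
    using g(2) x(1) unfolding lowerable_def by blast
  define B where "B = 1 + (\<Sum>j<M. \<sigma> j)"
  have s0: "\<And>j. j < M \<Longrightarrow> 0 \<le> \<sigma> j" using A(2) by (simp add: \<sigma>_def less_imp_le)
  have B: "0 < B" "\<And>j. j < M \<Longrightarrow> \<sigma> j \<le> B"
  proof -
    show "0 < B" unfolding B_def using sum_nonneg[of "{..<M}" \<sigma>] s0 by auto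
    show "\<And>j. j < M \<Longrightarrow> \<sigma> j \<le> B" unfolding B_def
      using member_le_sum[of _ "{..<M}" \<sigma>] s0 by fastforce
  qed
  have "nonneg_derivs g (?m (\<lambda>i. x i + - (e / B)))"
  proof (rule nonneg_derivs_mono[OF g(1) e(2)])
    fix j assume j: "j < M"
    have "(e / B) * \<sigma> j \<le> (e / B) * B" using B j e by (intro mult_left_mono) auto
    then show "?m x j - e \<le> ?m (\<lambda>i. x i + - (e / B)) j"
      unfolding shift[OF j] using B(1) by simp
  qed
  then have "nonneg_derivs (\<lambda>x. g (?m x)) (\<lambda>i. x i - e / B)"
    using nonneg_derivs_affine[OF g(1) A(1)] by simp
  then show "\<exists>e>0. nonneg_derivs (\<lambda>x. g (?m x)) (\<lambda>j. x j - e)"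
    using e B(1) by (intro exI[of _ "e / B"]) auto
qed

lemma nonneg_derivs_coord: "0 \<le> x t \<Longrightarrow> nonneg_derivs (\<lambda>x. x t) x"
  by (rule nonneg_derivsI) (auto simp: pd_coord)

text \<open>As \<open>f\<close> is affine in variable \<open>s\<close>, this function is \<open>f\<close> after the positive substitution of
  \<open>x s + c * x t\<close> for variable \<open>s\<close>.\<close>

lemma lowerable_shear:
  assumes f: "f \<in> polyfun N" "lowerable f" "nonneg_derivs f (\<lambda>_. 0)"
    and st: "s < N" "t < N" "s \<noteq> t" "0 \<le> c" and aff: "pd s (pd s f) = (\<lambda>_. 0)"
  shows "lowerable (\<lambda>x. f x + x t * (c * pd s f x))"
proof -
  define A where "A = (\<lambda>j i. (if i = j then 1 else 0) + (if j = s \<and> i = t then c else 0))"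
  have row: "(\<Sum>i<N. A j i * x i) = x j + (if j = s then c * x t else 0)" if "j < N" for j x
    using that st by (simp add: A_def distrib_right sum.distrib if_distrib[of "\<lambda>z. z * _"] sum.delta cong: if_cong)
  have "f (affine_map N N A (\<lambda>_. 0) x) = f x + x t * (c * pd s f x)" for x
  proof -
    have "f (affine_map N N A (\<lambda>_. 0) x) = f (x(s := x s + c * x t))"
      by (rule polyfun_cong[OF f(1)]) (simp add: affine_map_def row)
    then show ?thesis by (simp add: affine_in_coord[OF f(1) aff])
  qed
  moreover have "lowerable (\<lambda>x. f (affine_map N N A (\<lambda>_. 0) x))"
  proof (rule lowerable_affine[OF f])
    show "\<And>i j. 0 \<le> A j i" using st(4) by (simp add: A_def)
    show "0 < (\<Sum>i<N. A j i)" if "j < N" for j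
      using row[OF that, of "\<lambda>_. 1"] st(4) by (auto simp: add_pos_nonneg)
  qed
  ultimately show ?thesis by simp
qed

lemma nonneg_derivs_shear:
  assumes "f \<in> polyfun N" "nonneg_derivs f (\<lambda>_. 0)" "t < N" "0 \<le> c"
  shows "nonneg_derivs (\<lambda>x. f x + x t * (c * pd s f x)) (\<lambda>_. 0)"
  using assms
  by (intro nonneg_derivs_add[of _ N] nonneg_derivs_mult[of _ N] nonneg_derivs_cmult[of _ N] nonneg_derivs_coord
      polyfun.mult polyfun.coord polyfun_cmult polyfun_pd nonneg_derivs_pd) auto

section \<open>Products\<close>

text \<open>Far up on the diagonal ray \<open>f\<close> is positive, and it does not change sign on the way down.\<close>

lemma positive_factor:
  assumes f: "f \<in> polyfun N" "lowerable f" "nonneg_derivs f (\<lambda>_. 0)" "f \<noteq> (\<lambda>_. 0)"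
    and nz: "\<And>t. 0 \<le> t \<Longrightarrow> f (\<lambda>j. x j + t) \<noteq> 0"
  shows "0 < f x \<and> nonneg_derivs f x"
proof -
  obtain T where "0 < T" "\<forall>j<N. 0 < x j + T" using exists_shift[of N "\<lambda>_. 0" x] by auto
  then have T: "0 \<le> T" "\<And>j. j < N \<Longrightarrow> 0 < x j + T" by auto
  let ?g = "\<lambda>t. f (\<lambda>j. x j + t)"
  have cont: "continuous_on {a..b} ?g" for a b
    by (intro polyfun_continuous[OF f(1)] continuous_intros)
  have nT: "nonneg_derivs f (\<lambda>j. x j + T)"
    by (rule nonneg_derivs_mono[OF f(1,3)]) (use T in \<open>simp add: less_imp_le\<close>)
  then have gT: "0 < ?g T" using nonneg_derivs_value[OF nT] nz[OF T(1)] by simp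
  have pos: "0 < ?g t" if t: "0 \<le> t" "t \<le> T" for t
  proof (rule ccontr)
    assume "\<not> 0 < ?g t"
    then have "\<exists>w\<ge>t. w \<le> T \<and> ?g w = 0"
      by (intro IVT') (use gT t cont in auto)
    with nz t show False by force
  qed
  have "nonneg_derivs f x"
  proof (rule nonneg_derivs_segment[OF f(1,2) nT])
    fix t :: real assume t: "0 \<le> t" "t \<le> 1"
    have "0 < ?g (t * T)"
      using t T(1) mult_right_mono[of t 1 T] by (intro pos) auto
    then show "0 < f (\<lambda>j. x j + t * (x j + T - x j))" by simp
  qed
  then show ?thesis using pos[of 0] T by simp
qed

text \<open>A product that is positive and has nonnegative derivatives at a point stays positive on the
  diagonal ray, so \<open>positive_factor\<close> applies to both factors.\<close>

lemma lowerable_mult: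
  assumes f: "f \<in> polyfun N" "lowerable f" "nonneg_derivs f (\<lambda>_. 0)"
    and g: "g \<in> polyfun N" "lowerable g" "nonneg_derivs g (\<lambda>_. 0)"
  shows "lowerable (\<lambda>x. f x * g x)"
  unfolding lowerable_def
proof (intro allI impI)
  fix x assume x: "0 < f x * g x" "nonneg_derivs (\<lambda>x. f x * g x) x"
  have prod: "0 < f (\<lambda>j. x j + t) * g (\<lambda>j. x j + t)" if "0 \<le> t" for t
    using nonneg_derivs_imp_le[OF polyfun.mult[OF f(1) g(1)] x(2), of "\<lambda>j. x j + t"] x(1) that by simp
  have nz: "f \<noteq> (\<lambda>_. 0)" "g \<noteq> (\<lambda>_. 0)" using x(1) by auto
  have fx: "0 < f x \<and> nonneg_derivs f x"
    by (rule positive_factor[OF f nz(1)]) (use prod in fastforce)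
  have gx: "0 < g x \<and> nonneg_derivs g x"
    by (rule positive_factor[OF g nz(2)]) (use prod in fastforce)
  obtain d e where d: "0 < d" "nonneg_derivs f (\<lambda>j. x j - d)" and e: "0 < e" "nonneg_derivs g (\<lambda>j. x j - e)"
    using f(2) g(2) fx gx unfolding lowerable_def by blast
  have "nonneg_derivs (\<lambda>x. f x * g x) (\<lambda>j. x j - min d e)"
    by (intro nonneg_derivs_mult[OF f(1) g(1)] nonneg_derivs_mono[OF f(1) d(2)] nonneg_derivs_mono[OF g(1) e(2)]) auto
  then show "\<exists>e>0. nonneg_derivs (\<lambda>x. f x * g x) (\<lambda>j. x j - e)"
    using d e by (intro exI[of _ "min d e"]) auto
qed

lemma garding_fun_mult:
  assumes "f \<in> polyfun N" "garding_fun f" "nonneg_derivs f (\<lambda>_. 0)"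
    and "g \<in> polyfun N" "garding_fun g" "nonneg_derivs g (\<lambda>_. 0)"
    and "\<And>i. pd i f = (\<lambda>_. 0) \<or> pd i g = (\<lambda>_. 0)"
  shows "garding_fun (\<lambda>x. f x * g x)"
  unfolding garding_fun_def
proof
  fix "is"
  show "lowerable (pds is (\<lambda>x. f x * g x))"
    using assms
  proof (induction "is" arbitrary: f g)
    case Nil
    then show ?case using lowerable_mult[of f N g] by (simp add: garding_fun_lowerable)
  next
    case (Cons i js)
    note f = Cons.prems(1) and g = Cons.prems(4)
    from Cons.prems(7)[of i] show ?case
    proof
      assume z: "pd i f = (\<lambda>_. 0)"
      have "pd j f = (\<lambda>_. 0) \<or> pd j (pd i g) = (\<lambda>_. 0)" for j
        using Cons.prems(7)[of j] pd_commute[OF g, of j i] by auto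
      then have "lowerable (pds js (\<lambda>x. f x * pd i g x))"
        by (intro Cons.IH) (use Cons.prems polyfun_pd garding_fun_pd nonneg_derivs_pd in auto)
      then show ?thesis by (simp add: pd_mult[OF f g] z)
    next
      assume z: "pd i g = (\<lambda>_. 0)"
      have "pd j (pd i f) = (\<lambda>_. 0) \<or> pd j g = (\<lambda>_. 0)" for j
        using Cons.prems(7)[of j] pd_commute[OF f, of j i] by auto
      then have "lowerable (pds js (\<lambda>x. pd i f x * g x))"
        by (intro Cons.IH) (use Cons.prems polyfun_pd garding_fun_pd nonneg_derivs_pd in auto)
      then show ?thesis by (simp add: pd_mult[OF f g] z)
    qed
  qed
qed

section \<open>The sum of two partial derivatives\<close>

text \<open>Let \<open>d\<close> be the mixed derivative and \<open>h\<close> the sum. Since \<open>H\<^sub>s\<close> is affine in \<open>t\<close> and \<open>H\<^sub>t\<close> is affine in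
  \<open>s\<close>, both with slope \<open>d\<close>, moving the argument of \<open>H\<^sub>s\<close> by \<open>\<tau>\<close> in direction \<open>t\<close> and that of \<open>H\<^sub>t\<close> by
  \<open>- \<tau>\<close> in direction \<open>s\<close> does not change \<open>h\<close>. If \<open>d\<close> is positive at \<open>x\<close>, some \<open>\<tau>\<close> makes the two
  summands equal at \<open>x\<close>, so that both are positive there, and each can be lowered.\<close>

lemma lowerable_pd_sum:
  assumes H: "H \<in> polyfun N" "garding_fun H" "nonneg_derivs H (\<lambda>_. 0)"
    and st: "s < N" "t < N" "s \<noteq> t"
    and aff: "pd s (pd s H) = (\<lambda>_. 0)" "pd t (pd t H) = (\<lambda>_. 0)"
  shows "lowerable (\<lambda>x. pd s H x + pd t H x)"
proof -
  define d where "d = pd t (pd s H)"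
  define h where "h = (\<lambda>x. pd s H x + pd t H x)"
  have pH: "pd s H \<in> polyfun N" "pd t H \<in> polyfun N" by (auto intro: polyfun_pd H)
  have pd: "d \<in> polyfun N" unfolding d_def by (intro polyfun_pd pH)
  have ph: "h \<in> polyfun N" unfolding h_def by (intro polyfun.add pH)
  have comm: "pd s (pd t H) = d" unfolding d_def by (rule pd_commute[OF H(1)])
  have dh: "pd j h = (\<lambda>x. pd j (pd s H) x + pd j (pd t H) x)" for j
    unfolding h_def by (rule pd_add[OF pH])
  have hd: "pd s h = d" "pd t h = d" unfolding dh using aff comm d_def by auto
  have ds: "pd s d = (\<lambda>_. 0)" "pd t d = (\<lambda>_. 0)"
  proof -
    show "pd s d = (\<lambda>_. 0)" unfolding d_def using pd_commute[OF pH(1), of s t] aff by simp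
    show "pd t d = (\<lambda>_. 0)" unfolding comm[symmetric] using pd_commute[OF pH(2), of t s] aff by simp
  qed
  have g: "garding_fun (pd s H)" "garding_fun (pd t H)" using garding_fun_pd[OF H(2)] by auto
  have n: "nonneg_derivs (pd s H) (\<lambda>_. 0)" "nonneg_derivs (pd t H) (\<lambda>_. 0)"
    using nonneg_derivs_pd[OF H(3)] by auto
  have "lowerable h"
  proof (cases "d = (\<lambda>_. 0)")
    case True
    \<comment> \<open>Here the substitution of \<open>x s + x t\<close> for variable \<open>s\<close> keeps \<open>H\<close> affine in \<open>t\<close>, with slope \<open>h\<close>.\<close>
    let ?K = "\<lambda>x. H x + x t * (1 * pd s H x)"
    have "pd t ?K = (\<lambda>x. pd t H x + (1 * (1 * pd s H x) + x t * (1 * d x)))"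
      unfolding d_def
      by (rule pd_eqI)
         (rule derivative_eq_intros pd_has_derivative'[OF H(1)] pd_has_derivative'[OF pH(1)] refl | simp)+
    then have K: "pd t ?K = h" using True by (auto simp: h_def)
    have "lowerable (pd t ?K)"
    proof (rule lowerable_pd[where N = N])
      show "?K \<in> polyfun N"
        by (intro polyfun.add polyfun.mult polyfun.coord polyfun_cmult H st pH)
      show "lowerable ?K"
        by (rule lowerable_shear[OF H(1) garding_fun_lowerable[OF H(2)] H(3) st _ aff(1)]) simp
      show "nonneg_derivs ?K (\<lambda>_. 0)"
        by (rule nonneg_derivs_shear[OF H(1,3) st(2)]) simp
      show "pd t (pd t ?K) = (\<lambda>_. 0)" unfolding K hd True ..
    qed
    then show ?thesis unfolding K .
  next
    case False
    show ?thesis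
      unfolding lowerable_def
    proof (intro allI impI)
      fix x assume hx: "0 < h x" and nh: "nonneg_derivs h x"
      have nd: "nonneg_derivs d x" using nonneg_derivs_pd[OF nh, of s] hd by simp
      have key: "pd j d y * h y \<le> d y * pd j h y" if ny: "nonneg_derivs d y" for j y
      proof -
        have "pd s H y * pd j (pd t (pd s H)) y \<le> pd t (pd s H) y * pd j (pd s H) y"
          by (rule rayleigh[OF pH(1) g(1) n(1)]) (use ny d_def in simp)
        moreover have "pd t H y * pd j (pd s (pd t H)) y \<le> pd s (pd t H) y * pd j (pd t H) y"
          by (rule rayleigh[OF pH(2) g(2) n(2)]) (use ny comm in simp)
        ultimately show ?thesis
          unfolding dh comm d_def[symmetric] by (simp add: h_def algebra_simps)
      qed
      have "d x \<noteq> 0"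
      proof
        assume "d x = 0"
        have "d = (\<lambda>_. 0)"
        proof (rule zero_by_ratio[OF ph nh hx pd nd \<open>d x = 0\<close> key])
          fix t :: real assume "0 \<le> t"
          then show "nonneg_derivs d (\<lambda>l. x l + t)"
            by (intro nonneg_derivs_mono[OF pd nd]) simp
        qed
        with False show False by simp
      qed
      then have dx: "0 < d x" using nonneg_derivs_value[OF nd] by simp
      define \<tau> where "\<tau> = (h x / 2 - pd s H x) / d x"
      have \<tau>: "\<tau> * d x = h x / 2 - pd s H x" using dx by (simp add: \<tau>_def)
      have aff': "pd t (pd t (pd s H)) = (\<lambda>_. 0)" "pd s (pd s (pd t H)) = (\<lambda>_. 0)"
        using ds unfolding comm d_def[symmetric] by auto
      have "pd s H (x(t := x t + \<tau>)) = h x / 2"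
        using \<tau> by (simp add: affine_in_coord[OF pH(1) aff'(1)] d_def)
      moreover have "nonneg_derivs (pd s H) (x(t := x t + \<tau>))"
      proof (rule nonneg_derivs_from_pd[OF pH(1) garding_fun_lowerable[OF g(1)] n(1), where i = t])
        show "nonneg_derivs (pd t (pd s H)) (x(t := x t + \<tau>))"
          using nd nonneg_derivs_indep[OF pd ds(2)] unfolding d_def by blast
        show "0 < pd t (pd s H) (x(t := x t + \<tau>))"
          using dx pd_zero_imp_indep[OF pd ds(2)] unfolding d_def by simp
        show "0 < pd s H (x(t := x t + \<tau>))" using calculation hx by simp
      qed
      ultimately obtain e1 where e1: "0 < e1" "nonneg_derivs (pd s H) (\<lambda>j. (x(t := x t + \<tau>)) j - e1)"
        using garding_fun_lowerable[OF g(1)] hx unfolding lowerable_def by (metis half_gt_zero)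
      have "pd t H (x(s := x s - \<tau>)) = h x / 2"
        using \<tau> by (simp add: affine_in_coord[OF pH(2) aff'(2)] comm) (simp add: h_def field_simps)
      moreover have "nonneg_derivs (pd t H) (x(s := x s - \<tau>))"
      proof (rule nonneg_derivs_from_pd[OF pH(2) garding_fun_lowerable[OF g(2)] n(2), where i = s])
        show "nonneg_derivs (pd s (pd t H)) (x(s := x s - \<tau>))"
          using nd nonneg_derivs_indep[OF pd ds(1)] unfolding comm by blast
        show "0 < pd s (pd t H) (x(s := x s - \<tau>))"
          using dx pd_zero_imp_indep[OF pd ds(1)] unfolding comm by simp
        show "0 < pd t H (x(s := x s - \<tau>))" using calculation hx by simp
      qed
      ultimately obtain e2 where e2: "0 < e2" "nonneg_derivs (pd t H) (\<lambda>j. (x(s := x s - \<tau>)) j - e2)"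
        using garding_fun_lowerable[OF g(2)] hx unfolding lowerable_def by (metis half_gt_zero)
      define e where "e = min e1 e2"
      define z where "z = (\<lambda>j. x j - e)"
      have n1: "nonneg_derivs (pd s H) (z(t := z t + \<tau>))"
        by (rule nonneg_derivs_mono[OF pH(1) e1(2)]) (auto simp: z_def e_def)
      have n2: "nonneg_derivs (pd t H) (z(s := z s + - \<tau>))"
        by (rule nonneg_derivs_mono[OF pH(2) e2(2)]) (auto simp: z_def e_def)
      have "nonneg_derivs h z"
        unfolding nonneg_derivs_def
      proof
        fix "is"
        have c: "pd t (pds is (pd s H)) = pds is d" "pd s (pds is (pd t H)) = pds is d"
          using pd_pds_commute[OF pH(1)] pd_pds_commute[OF pH(2)] comm d_def by auto
        have a: "pd t (pd t (pds is (pd s H))) = (\<lambda>_. 0)" "pd s (pd s (pds is (pd t H))) = (\<lambda>_. 0)"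
          unfolding c using pd_pds_commute[OF pd] ds by auto
        have "0 \<le> pds is (pd s H) (z(t := z t + \<tau>)) + pds is (pd t H) (z(s := z s + - \<tau>))"
          using n1 n2 by (simp add: nonneg_derivs_def)
        also have "\<dots> = pds is (pd s H) z + pds is (pd t H) z"
          unfolding affine_in_coord[OF polyfun_pds[OF pH(1)] a(1)] affine_in_coord[OF polyfun_pds[OF pH(2)] a(2)] c
          by simp
        also have "\<dots> = pds is h z" unfolding h_def pds_add[OF pH] ..
        finally show "0 \<le> pds is h z" .
      qed
      then show "\<exists>e>0. nonneg_derivs h (\<lambda>j. x j - e)"
        using e1 e2 unfolding z_def e_def by (intro exI[of _ "min e1 e2"]) auto
    qed
  qed
  then show ?thesis unfolding h_def .
qed

lemma garding_fun_pd_sum: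
  assumes "H \<in> polyfun N" "garding_fun H" "nonneg_derivs H (\<lambda>_. 0)"
    and st: "s < N" "t < N" "s \<noteq> t"
    and "pd s (pd s H) = (\<lambda>_. 0)" "pd t (pd t H) = (\<lambda>_. 0)"
  shows "garding_fun (\<lambda>x. pd s H x + pd t H x)"
  unfolding garding_fun_def
proof
  fix "is"
  note H = assms(1)
  have c: "pds is (\<lambda>x. pd s H x + pd t H x) = (\<lambda>x. pd s (pds is H) x + pd t (pds is H) x)"
    by (simp add: pds_add[OF polyfun_pd[OF H] polyfun_pd[OF H]] pd_pds_commute[OF H])
  have a: "pd j (pd j (pds is H)) = pds is (pd j (pd j H))" for j
    by (simp add: pd_pds_commute[OF H] pd_pds_commute[OF polyfun_pd[OF H]])
  show "lowerable (pds is (\<lambda>x. pd s H x + pd t H x))"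
    unfolding c
  proof (rule lowerable_pd_sum[OF polyfun_pds[OF H] _ _ st])
    show "garding_fun (pds is H)"
      using assms(2) unfolding garding_fun_def by (metis pds_append)
  qed (use assms nonneg_derivs_pds a in auto)
qed

section \<open>Setting a variable to zero\<close>

definition restrict0 :: "nat \<Rightarrow> ((nat \<Rightarrow> real) \<Rightarrow> real) \<Rightarrow> (nat \<Rightarrow> real) \<Rightarrow> real" where
  "restrict0 s f = (\<lambda>x. f (x(s := 0)))"

lemma polyfun_restrict0:
  assumes "f \<in> polyfun N"
  shows "restrict0 s f \<in> polyfun N"
  unfolding restrict0_def
proof (rule polyfun_compose[OF assms])
  fix j assume "j < N"
  then show "(\<lambda>x. (x(s := 0)) j) \<in> polyfun N" by (cases "j = s") (auto intro: polyfun.intros)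
qed

lemma pd_restrict0:
  assumes "f \<in> polyfun N"
  shows "pd i (restrict0 s f) = (if i = s then (\<lambda>_. 0) else restrict0 s (pd i f))"
proof (cases "i = s")
  case True
  then show ?thesis using indep_imp_pd_zero[of "restrict0 s f" s] by (simp add: restrict0_def)
next
  case False
  have "pd i (restrict0 s f) = restrict0 s (pd i f)"
  proof (rule pd_eqI)
    fix x :: "nat \<Rightarrow> real"
    show "((\<lambda>t. restrict0 s f (x(i := t))) has_real_derivative restrict0 s (pd i f) x) (at (x i))"
      using pd_has_derivative[OF assms, of "x(s := 0)" i "x i"] False
      by (simp add: restrict0_def fun_upd_twist fun_upd_idem)
  qed
  then show ?thesis using False by simp
qed

lemma restrict0_zero [simp]: "restrict0 s (\<lambda>_. c) = (\<lambda>_. c)"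
  by (simp add: restrict0_def)

lemma nonneg_derivs_restrict0:
  assumes "f \<in> polyfun N" "nonneg_derivs f (x(s := 0))"
  shows "nonneg_derivs (restrict0 s f) x"
proof -
  have "0 \<le> pds is (restrict0 s f) x" for "is"
    using assms
  proof (induction "is" arbitrary: f)
    case Nil
    show ?case using nonneg_derivs_value[OF Nil(2)] unfolding restrict0_def pds.simps .
  next
    case (Cons i js)
    then show ?case by (simp add: pd_restrict0 polyfun_pd nonneg_derivs_pd)
  qed
  then show ?thesis by (simp add: nonneg_derivs_def)
qed

text \<open>The diagonal ray is projected to the hyperplane; its upper end still lies above the origin.\<close>

lemma lowerable_restrict0:
  assumes f: "f \<in> polyfun N" "lowerable f" "nonneg_derivs f (\<lambda>_. 0)"
  shows "lowerable (restrict0 s f)"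
  unfolding lowerable_def
proof (intro allI impI)
  fix x assume x: "0 < restrict0 s f x" "nonneg_derivs (restrict0 s f) x"
  obtain T where "0 < T" "\<forall>j<N. 0 < x j + T" using exists_shift[of N "\<lambda>_. 0" x] by auto
  then have T: "0 \<le> T" "\<And>j. j < N \<Longrightarrow> 0 \<le> x j + T" by (auto intro: less_imp_le)
  let ?y = "(\<lambda>j. x j + T)(s := 0)"
  have "nonneg_derivs f (x(s := 0))"
  proof (rule nonneg_derivs_segment[OF f(1,2)])
    show "nonneg_derivs f ?y" by (rule nonneg_derivs_mono[OF f(1,3)]) (use T in auto)
    fix t :: real assume t: "0 \<le> t" "t \<le> 1"
    have "restrict0 s f x \<le> restrict0 s f (\<lambda>j. x j + t * T)"
      by (rule nonneg_derivs_imp_le[OF polyfun_restrict0[OF f(1)] x(2)]) (use t T in simp)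
    moreover have "restrict0 s f (\<lambda>j. x j + t * T) = f (\<lambda>j. (x(s := 0)) j + t * (?y j - (x(s := 0)) j))"
      unfolding restrict0_def by (rule arg_cong[of _ _ f]) auto
    ultimately show "0 < f (\<lambda>j. (x(s := 0)) j + t * (?y j - (x(s := 0)) j))" using x(1) by simp
  qed
  then obtain e where e: "0 < e" "nonneg_derivs f (\<lambda>j. (x(s := 0)) j - e)"
    using f(2) x(1) unfolding lowerable_def restrict0_def by blast
  have "nonneg_derivs f ((\<lambda>j. x j - e)(s := 0))"
    by (rule nonneg_derivs_mono[OF f(1) e(2)]) (use e in auto)
  then show "\<exists>e>0. nonneg_derivs (restrict0 s f) (\<lambda>j. x j - e)"
    using e nonneg_derivs_restrict0[OF f(1)] by blast
qed

lemma garding_fun_restrict0: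
  assumes "f \<in> polyfun N" "garding_fun f" "nonneg_derivs f (\<lambda>_. 0)"
  shows "garding_fun (restrict0 s f)"
  unfolding garding_fun_def
proof
  fix "is"
  show "lowerable (pds is (restrict0 s f))"
    using assms
    by (induction "is" arbitrary: f)
       (auto simp: pd_restrict0 polyfun_pd nonneg_derivs_pd garding_fun_pd lowerable_zero
         intro: lowerable_restrict0 garding_fun_lowerable)
qed

lemma funpow_pd_restrict0:
  "f \<in> polyfun N \<Longrightarrow> i \<noteq> s \<Longrightarrow> (pd i ^^ l) (restrict0 s f) = restrict0 s ((pd i ^^ l) f)"
  by (induction l) (auto simp: pd_restrict0[OF polyfun_funpow])

section \<open>Contracting a pair of variables\<close>

text \<open>For \<open>H = a + x\<^sub>s b + x\<^sub>t c + x\<^sub>s x\<^sub>t d\<close> the result is \<open>b + c\<close>.\<close>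

definition contract :: "nat \<Rightarrow> nat \<Rightarrow> ((nat \<Rightarrow> real) \<Rightarrow> real) \<Rightarrow> (nat \<Rightarrow> real) \<Rightarrow> real" where
  "contract s t H = restrict0 s (restrict0 t (\<lambda>x. pd s H x + pd t H x))"

lemma contract_garding:
  assumes H: "H \<in> polyfun N" "garding_fun H" "nonneg_derivs H (\<lambda>_. 0)"
    and st: "s < N" "t < N" "s \<noteq> t"
    and aff: "pd s (pd s H) = (\<lambda>_. 0)" "pd t (pd t H) = (\<lambda>_. 0)"
  shows "garding_fun (contract s t H)" "nonneg_derivs (contract s t H) (\<lambda>_. 0)" "contract s t H \<in> polyfun N"
proof -
  let ?h = "\<lambda>x. pd s H x + pd t H x"
  have p: "?h \<in> polyfun N" by (intro polyfun.add polyfun_pd H)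
  have n: "nonneg_derivs ?h (\<lambda>_. 0)"
    by (intro nonneg_derivs_add[of _ N] polyfun_pd nonneg_derivs_pd H)
  have z: "(\<lambda>_. 0 :: real)(j := 0) = (\<lambda>_. 0)" for j :: nat by auto
  note 1 = polyfun_restrict0[OF p, of t]
    garding_fun_restrict0[OF p garding_fun_pd_sum[OF H st aff] n, of t]
    nonneg_derivs_restrict0[OF p, of "\<lambda>_. 0" t, unfolded z, OF n]
  show "garding_fun (contract s t H)" unfolding contract_def by (rule garding_fun_restrict0[OF 1])
  show "nonneg_derivs (contract s t H) (\<lambda>_. 0)"
    unfolding contract_def by (rule nonneg_derivs_restrict0[OF 1(1)]) (use 1(3) z in simp)
  show "contract s t H \<in> polyfun N" unfolding contract_def by (rule polyfun_restrict0[OF 1(1)])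
qed

lemma bilinear_in_pair:
  assumes H: "\<And>x. H x = a x + x s * b x + x t * c x + x s * x t * d x"
    and st: "s \<noteq> t"
    and ind: "\<And>h x v. h \<in> {a, b, c, d} \<Longrightarrow> h (x(s := v)) = h x \<and> h (x(t := v)) = h x"
  shows "pd s (pd s H) = (\<lambda>_. 0)" "pd t (pd t H) = (\<lambda>_. 0)" "contract s t H = (\<lambda>x. b x + c x)"
proof -
  have i: "a (x(s := v)) = a x" "b (x(s := v)) = b x" "c (x(s := v)) = c x" "d (x(s := v)) = d x"
    "a (x(t := v)) = a x" "b (x(t := v)) = b x" "c (x(t := v)) = c x" "d (x(t := v)) = d x" for x v
    using ind by auto
  have s: "pd s H = (\<lambda>x. b x + x t * d x)"
    by (rule pd_eqI) (use st in \<open>auto simp: H i intro!: derivative_eq_intros\<close>)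
  have t: "pd t H = (\<lambda>x. c x + x s * d x)"
    by (rule pd_eqI) (use st in \<open>auto simp: H i intro!: derivative_eq_intros\<close>)
  show "pd s (pd s H) = (\<lambda>_. 0)" unfolding s
    by (rule indep_imp_pd_zero) (use st in \<open>simp add: i\<close>)
  show "pd t (pd t H) = (\<lambda>_. 0)" unfolding t
    by (rule indep_imp_pd_zero) (use st in \<open>simp add: i\<close>)
  show "contract s t H = (\<lambda>x. b x + c x)"
    unfolding contract_def restrict0_def s t using st by (simp add: i)
qed


section \<open>Directional derivatives of multi-affine polynomials\<close>

definition multiaffine :: "((nat \<Rightarrow> real) \<Rightarrow> real) \<Rightarrow> bool" where
  "multiaffine f \<longleftrightarrow> (\<forall>i. pd i (pd i f) = (\<lambda>_. 0))"

lemma multiaffineD: "multiaffine f \<Longrightarrow> pd i (pd i f) = (\<lambda>_. 0)"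
  by (simp add: multiaffine_def)

lemma multiaffine_add:
  "f \<in> polyfun N \<Longrightarrow> g \<in> polyfun N \<Longrightarrow> multiaffine f \<Longrightarrow> multiaffine g \<Longrightarrow> multiaffine (\<lambda>x. f x + g x)"
  unfolding multiaffine_def by (simp add: pd_add[of _ N _ N] polyfun_pd)

lemma multiaffine_cmult:
  "f \<in> polyfun N \<Longrightarrow> multiaffine f \<Longrightarrow> multiaffine (\<lambda>x. c * f x)"
  unfolding multiaffine_def by (simp add: pd_cmult[of _ N] polyfun_pd)

lemma multiaffine_coord: "multiaffine (\<lambda>x. x i)"
  unfolding multiaffine_def by (simp add: pd_coord)

lemma multiaffine_pd: "f \<in> polyfun N \<Longrightarrow> multiaffine f \<Longrightarrow> multiaffine (pd i f)"
  unfolding multiaffine_def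
  by (metis pd_commute polyfun_pd pd_const)

lemma multiaffine_sum:
  assumes "\<And>a. a \<in> A \<Longrightarrow> f a \<in> polyfun N" "\<And>a. a \<in> A \<Longrightarrow> multiaffine (f a)"
  shows "multiaffine (\<lambda>x. \<Sum>a\<in>A. f a x)"
  using assms
proof (induction A rule: infinite_finite_induct)
  case (insert a A)
  then show ?case by (simp, intro multiaffine_add[of _ N]) (auto intro: polyfun_sum)
qed (simp_all add: multiaffine_def)

lemma multiaffine_mult:
  assumes f: "f \<in> polyfun N" "multiaffine f" and g: "g \<in> polyfun N" "multiaffine g"
    and disj: "\<And>i. pd i f = (\<lambda>_. 0) \<or> pd i g = (\<lambda>_. 0)"
  shows "multiaffine (\<lambda>x. f x * g x)"
  unfolding multiaffine_def
proof
  fix i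
  from disj[of i] show "pd i (pd i (\<lambda>x. f x * g x)) = (\<lambda>_. 0)"
    by (elim disjE)
       (simp_all add: pd_mult[OF f(1) g(1)] pd_mult[OF polyfun_pd[OF f(1)] g(1)] pd_mult[OF f(1) polyfun_pd[OF g(1)]]
         multiaffineD[OF f(2)] multiaffineD[OF g(2)])
qed

lemma multiaffine_coord_mult:
  assumes "f \<in> polyfun N" "multiaffine f" "i < N" "pd i f = (\<lambda>_. 0)"
  shows "multiaffine (\<lambda>x. x i * f x)"
  using assms by (intro multiaffine_mult[of _ N] polyfun.coord multiaffine_coord) (auto simp: pd_coord)

text \<open>Induction on the number \<open>m\<close> of directions. Let \<open>D\<close> be the derivative in the first \<open>m\<close> directions
  and \<open>c\<close> the next component of \<open>v\<close>. In \<open>g + x\<^sub>s D\<close> substitute \<open>x\<^sub>m + c x\<^sub>t\<close> for \<open>x\<^sub>m\<close>, multiply by the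
  elementary symmetric polynomial \<open>x\<^sub>p x\<^sub>q + x\<^sub>r (x\<^sub>p + x\<^sub>q)\<close> and contract the pairs \<open>s, p\<close> and
  \<open>t, q\<close>. This keeps the terms without \<open>x\<^sub>s x\<^sub>t\<close> and turns both \<open>x\<^sub>s\<close> and \<open>x\<^sub>t\<close> into \<open>x\<^sub>r\<close>.\<close>

lemma lowerable_first_order_part:
  assumes g: "g \<in> polyfun M" "multiaffine g" "lowerable g" "nonneg_derivs g (\<lambda>_. 0)"
    and v: "\<And>j. j < M \<Longrightarrow> 0 \<le> v j" and m: "m \<le> M" and r: "M \<le> r"
  shows "lowerable (\<lambda>x. g x + x r * dir_deriv m v g x)"
  using m r
proof (induction m arbitrary: r)
  case 0
  then show ?case using g by (simp add: dir_deriv_def)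
next
  case (Suc m)
  define s where "s = r + 1"
  define t where "t = r + 2"
  define p where "p = r + 3"
  define q where "q = r + 4"
  define N where "N = r + 5"
  note idx = s_def t_def p_def q_def N_def
  have MN: "M \<le> N" "m < M" "m < N" "r < N" "s < N" "t < N" "p < N" "q < N" using Suc.prems by (auto simp: idx)
  have gN: "g \<in> polyfun N" by (rule polyfun_mono[OF g(1) MN(1)])
  define D where "D = dir_deriv m v g"
  define c where "c = v m"
  have c: "0 \<le> c" unfolding c_def using v MN by simp
  have D: "D \<in> polyfun M" unfolding D_def by (rule polyfun_dir_deriv[OF g(1)])
  have DN: "D \<in> polyfun N" by (rule polyfun_mono[OF D MN(1)])
  have maD: "multiaffine D"
    unfolding D_def dir_deriv_def
    by (intro multiaffine_sum[of _ _ N] multiaffine_cmult[of _ N] polyfun_cmult polyfun_pd gN multiaffine_pd[OF gN] g)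
  have nD: "nonneg_derivs D (\<lambda>_. 0)"
    unfolding D_def using v MN by (intro nonneg_derivs_dir_deriv[OF g(1)] g) auto
  have out: "pd i h = (\<lambda>_. 0)" if "h \<in> polyfun M" "M \<le> i" for h i
    using pd_outside that by blast
  \<comment> \<open>The induction hypothesis for the variable \<open>s\<close>, and the shift of variable \<open>m\<close> by \<open>c\<close> times
    the variable \<open>t\<close>.\<close>
  define K where "K = (\<lambda>x. g x + x s * D x)"
  have K: "K \<in> polyfun N" unfolding K_def by (intro polyfun.intros gN DN MN)
  have lK: "lowerable K"
    unfolding K_def D_def using Suc.IH[of s] Suc.prems by (simp add: idx)
  have nK: "nonneg_derivs K (\<lambda>_. 0)"
    unfolding K_def
    by (intro nonneg_derivs_add[of _ N] nonneg_derivs_mult[of _ N] nonneg_derivs_coord polyfun.mult polyfun.coord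
        gN DN MN nD g) simp
  have pdK: "pd i K = (\<lambda>x. pd i g x + ((if i = s then 1 else 0) * D x + x s * pd i D x))" for i
    unfolding K_def
    by (subst pd_add[OF gN polyfun.mult[OF polyfun.coord[OF MN(5)] DN]],
        subst pd_mult[OF polyfun.coord[OF MN(5)] DN]) (simp add: pd_coord)
  have maK: "multiaffine K"
    unfolding K_def
    by (intro multiaffine_add[of _ N] multiaffine_coord_mult[of _ N] polyfun.mult polyfun.coord gN DN MN maD g out[OF D])
       (use Suc.prems in \<open>simp add: idx\<close>)
  define gm where "gm = pd m g"
  define Dm where "Dm = pd m D"
  have gm: "gm \<in> polyfun M" "Dm \<in> polyfun M" unfolding gm_def Dm_def by (intro polyfun_pd g D)+
  have Km: "pd m K = (\<lambda>x. gm x + x s * Dm x)"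
    unfolding pdK gm_def Dm_def using MN Suc.prems by (auto simp: idx)
  define Q where "Q = (\<lambda>x. K x + x t * (c * pd m K x))"
  have Q: "Q \<in> polyfun N" unfolding Q_def by (intro polyfun.intros polyfun_cmult polyfun_pd K MN)
  have lQ: "lowerable Q"
    unfolding Q_def
    by (rule lowerable_shear[OF K lK nK MN(3,6) _ c multiaffineD[OF maK]]) (use MN Suc.prems in \<open>simp add: idx\<close>)
  have nQ: "nonneg_derivs Q (\<lambda>_. 0)"
    unfolding Q_def by (rule nonneg_derivs_shear[OF K nK MN(6) c])
  have maQ: "multiaffine Q"
    unfolding Q_def
  proof (intro multiaffine_add[OF K _ maK] polyfun.mult[OF polyfun.coord] polyfun_cmult polyfun_pd K MN
      multiaffine_coord_mult[of _ N] multiaffine_cmult[of _ N] multiaffine_pd[OF K maK])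
    have "pd t (pd m K) = pd m (pd t K)" by (rule pd_commute[OF K])
    also have "pd t K = (\<lambda>_. 0)"
      unfolding pdK out[OF g(1), of t, unfolded t_def, simplified] using Suc.prems
      by (simp add: out[OF g(1)] out[OF D] idx)
    finally show "pd t (\<lambda>x. c * pd m K x) = (\<lambda>_. 0)"
      by (simp add: pd_cmult[OF polyfun_pd[OF K]])
  qed
  define S where "S = (\<lambda>x::nat \<Rightarrow> real. x p * x q + x r * (x p + x q))"
  have dS: "pd i S = (\<lambda>x. (if i = p then x q + x r else 0) + (if i = q then x p + x r else 0) + (if i = r then x p + x q else 0))" for i
    unfolding S_def
    by (rule pd_eqI) (auto simp: idx intro!: derivative_eq_intros)
  have S: "S \<in> polyfun N" unfolding S_def by (intro polyfun.intros MN)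
  have nS: "nonneg_derivs S (\<lambda>_. 0)"
    unfolding S_def
    by (intro nonneg_derivs_add[of _ N] nonneg_derivs_mult[of _ N] nonneg_derivs_coord polyfun.intros MN) simp_all
  have two: "pd j (\<lambda>x. x a + x b) = (\<lambda>_. (if j = a then 1 else 0) + (if j = b then 1 else 0))" for a b j
    by (simp add: pd_add[OF polyfun.coord[of a "Suc a"] polyfun.coord[of b "Suc b"]] pd_coord)
  have ddS: "pd j (pd i S) = (\<lambda>_. 0) \<or> pd j (pd i S) = (\<lambda>_. 1)" for i j
  proof -
    consider "i = p" | "i = q" | "i = r" | "i \<notin> {p, q, r}" by blast
    then show ?thesis by cases (auto simp: dS two idx)
  qed
  have lS: "lowerable S"
  proof (rule lowerableI[OF S])
    show "lowerable (pd i S)" for i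
    proof (rule lowerableI[OF polyfun_pd[OF S]])
      show "lowerable (pd j (pd i S))" for j
        using ddS[of j i] by (auto simp: lowerable_def intro: exI[of _ 1])
      show "pd j (pd i S) = (\<lambda>_. 0) \<or> 0 < pd j (pd i S) x" for x j
        using ddS[of j i] by auto
    qed
    fix x i
    assume x: "0 < S x" "nonneg_derivs S x"
    have "0 \<le> pd i S x" for i using x nonneg_derivs_pd nonneg_derivs_value by blast
    from this[of p] this[of q] this[of r]
    have n: "0 \<le> x q + x r" "0 \<le> x p + x r" "0 \<le> x p + x q"
      unfolding dS by (auto simp: idx)
    \<comment> \<open>If two of the variables add up to zero, the value of \<open>S\<close> is minus a square.\<close>
    have "x q + x r \<noteq> 0"
    proof
      assume "x q + x r = 0"
      then have e: "x r = - x q" by linarith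
      have "S x = - (x q * x q)" unfolding S_def e by (simp add: algebra_simps)
      with x(1) zero_le_square[of "x q"] show False by linarith
    qed
    moreover have "x p + x r \<noteq> 0"
    proof
      assume "x p + x r = 0"
      then have e: "x r = - x p" by linarith
      have "S x = - (x p * x p)" unfolding S_def e by (simp add: algebra_simps)
      with x(1) zero_le_square[of "x p"] show False by linarith
    qed
    moreover have "x p + x q \<noteq> 0"
    proof
      assume "x p + x q = 0"
      then have e: "x q = - x p" by linarith
      have "S x = - (x p * x p)" unfolding S_def e by (simp add: algebra_simps)
      with x(1) zero_le_square[of "x p"] show False by linarith
    qed
    ultimately have "0 < x q + x r" "0 < x p + x r" "0 < x p + x q" using n by linarith+
    then show "pd i S = (\<lambda>_. 0) \<or> 0 < pd i S x"
      unfolding dS by (cases "i = p"; cases "i = q"; cases "i = r") (simp_all add: idx)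
  qed
  have maS: "multiaffine S"
    unfolding multiaffine_def dS by (auto intro!: indep_imp_pd_zero simp: idx)
  define F where "F = (\<lambda>x. Q x * S x)"
  have F: "F \<in> polyfun N" unfolding F_def by (intro polyfun.mult Q S)
  have nF: "nonneg_derivs F (\<lambda>_. 0)" unfolding F_def by (intro nonneg_derivs_mult[of _ N] Q S nQ nS)
  have dQ: "pd i Q = (\<lambda>_. 0)" if "i \<in> {p, q, r}" for i
  proof -
    have iM: "M \<le> i" "i \<noteq> s" "i \<noteq> t" using that Suc.prems by (auto simp: idx)
    have dK: "pd i K = (\<lambda>_. 0)" unfolding pdK out[OF g(1) iM(1)] out[OF D iM(1)] using iM by simp
    have "pd i (pd m K) = (\<lambda>_. 0)" using pd_commute[OF K, of i m] dK by simp
    then show ?thesis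
      unfolding Q_def
      by (subst pd_add[OF K polyfun.mult[OF polyfun.coord[OF MN(6)] polyfun_cmult[OF polyfun_pd[OF K]]]],
          subst pd_mult[OF polyfun.coord[OF MN(6)] polyfun_cmult[OF polyfun_pd[OF K]]])
         (use iM dK in \<open>simp add: pd_cmult[OF polyfun_pd[OF K]]\<close>)
  qed
  have "multiaffine F"
    unfolding F_def
  proof (rule multiaffine_mult[OF Q maQ S maS])
    show "pd i Q = (\<lambda>_. 0) \<or> pd i S = (\<lambda>_. 0)" for i
      using dQ[of i] by (cases "i \<in> {p, q, r}") (auto simp: dS)
  qed
  then have gF: "garding_fun F"
    using lowerable_mult[OF Q lQ nQ S lS nS] nF multiaffine_garding_fun[OF F] multiaffineD unfolding F_def by blast
  have ind: "h (x(i := w)) = h x" if "h \<in> polyfun M" "M \<le> i" for h x i w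
    by (rule polyfun_cong[OF that(1)]) (use that in auto)
  have big: "M \<le> s" "M \<le> t" "M \<le> p" "M \<le> q" "M \<le> r" using Suc.prems by (auto simp: idx)
  note inds = ind[OF g(1)] ind[OF D] ind[OF gm(1)] ind[OF gm(2)]
  define A where "A = (\<lambda>x. g x + x t * (c * gm x))"
  define B where "B = (\<lambda>x. D x + x t * (c * Dm x))"
  have F_eq: "F x = A x * (x r * x q) + x s * (B x * (x r * x q)) + x p * (A x * (x q + x r))
      + x s * x p * (B x * (x q + x r))" for x
  proof -
    have "Q x = K x + x t * (c * (gm x + x s * Dm x))" unfolding Q_def Km ..
    then show ?thesis
      unfolding F_def K_def S_def A_def B_def by (simp add: algebra_simps)
  qed
  have ne: "s \<noteq> t" "s \<noteq> p" "s \<noteq> q" "s \<noteq> r" "t \<noteq> p" "t \<noteq> q" "t \<noteq> r" "p \<noteq> q" "p \<noteq> r" "q \<noteq> r"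
    by (simp_all add: idx)
  note ne = ne ne[symmetric]
  have AB: "A (x(i := w)) = A x" "B (x(i := w)) = B x" if "M \<le> i" "i \<noteq> t" for x i w
    using that by (simp_all add: A_def B_def inds)
  have ind1: "h (x(s := w)) = h x \<and> h (x(p := w)) = h x"
    if "h \<in> {\<lambda>x. A x * (x r * x q), \<lambda>x. B x * (x r * x q), \<lambda>x. A x * (x q + x r), \<lambda>x. B x * (x q + x r)}" for h x w
    using that by (elim insertE emptyE) (simp_all add: AB big ne)
  note F1 = bilinear_in_pair[of F "\<lambda>x. A x * (x r * x q)" s "\<lambda>x. B x * (x r * x q)" p "\<lambda>x. A x * (x q + x r)"
      "\<lambda>x. B x * (x q + x r)", OF F_eq ne(2) ind1]
  define F' where "F' = contract s p F"
  note gF' = contract_garding[OF F gF nF MN(5,7) ne(2) F1(1,2), folded F'_def]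
  have F'_eq: "F' x = g x * x r + x t * (c * gm x * x r) + x q * (D x * x r + g x)
      + x t * x q * (c * Dm x * x r + c * gm x)" for x
  proof -
    have "F' x = B x * (x r * x q) + A x * (x q + x r)"
      unfolding F'_def by (rule fun_cong[OF F1(3)])
    then show ?thesis by (simp add: A_def B_def algebra_simps)
  qed
  have ind2: "h (x(t := w)) = h x \<and> h (x(q := w)) = h x"
    if "h \<in> {\<lambda>x. g x * x r, \<lambda>x. c * gm x * x r, \<lambda>x. D x * x r + g x, \<lambda>x. c * Dm x * x r + c * gm x}" for h x w
    using that by (elim insertE emptyE) (simp_all add: inds big ne)
  note F2 = bilinear_in_pair[of F' "\<lambda>x. g x * x r" t "\<lambda>x. c * gm x * x r" q "\<lambda>x. D x * x r + g x"
      "\<lambda>x. c * Dm x * x r + c * gm x", OF F'_eq ne(6) ind2]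
  have "lowerable (contract t q F')"
    using contract_garding(1)[OF gF'(3,1,2) MN(6,8) ne(6) F2(1,2)] garding_fun_lowerable by blast
  moreover have "contract t q F' = (\<lambda>x. g x + x r * dir_deriv (Suc m) v g x)"
  proof
    fix x
    have "contract t q F' x = c * gm x * x r + (D x * x r + g x)"
      by (rule fun_cong[OF F2(3)])
    then show "contract t q F' x = g x + x r * dir_deriv (Suc m) v g x"
      by (simp add: D_def gm_def c_def dir_deriv_def algebra_simps)
  qed
  ultimately show ?case by simp
qed

lemma dir_deriv_multiaffine:
  assumes g: "g \<in> polyfun M" "multiaffine g" "lowerable g" "nonneg_derivs g (\<lambda>_. 0)"
    and v: "\<And>j. j < M \<Longrightarrow> 0 \<le> v j"
  shows "multiaffine (dir_deriv M v g)" "lowerable (dir_deriv M v g)" "nonneg_derivs (dir_deriv M v g) (\<lambda>_. 0)"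
proof -
  let ?D = "dir_deriv M v g"
  show "multiaffine ?D"
    unfolding dir_deriv_def
    by (intro multiaffine_sum[of _ _ M] multiaffine_cmult[of _ M] polyfun_cmult polyfun_pd g multiaffine_pd[OF g(1)])
  show nD: "nonneg_derivs ?D (\<lambda>_. 0)"
    by (rule nonneg_derivs_dir_deriv[OF g(1) v g(4)])
  define K where "K = (\<lambda>x. g x + x M * ?D x)"
  have D: "?D \<in> polyfun (Suc M)" and gS: "g \<in> polyfun (Suc M)"
    using polyfun_mono[OF polyfun_dir_deriv[OF g(1)], of M M v] polyfun_mono[OF g(1)] polyfun_mono
    by (auto intro: polyfun_dir_deriv)
  have DM: "?D \<in> polyfun M" by (rule polyfun_dir_deriv[OF g(1)])
  have K: "K \<in> polyfun (Suc M)" unfolding K_def by (intro polyfun.intros gS D) simp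
  have dK: "pd M K = ?D"
  proof (rule pd_eqI)
    fix x
    have "g (x(M := t)) = g x" "?D (x(M := t)) = ?D x" for t
      by (auto intro!: polyfun_cong[OF g(1)] polyfun_cong[OF DM])
    then show "((\<lambda>t. K (x(M := t))) has_real_derivative ?D x) (at (x M))"
      unfolding K_def by (auto intro!: derivative_eq_intros)
  qed
  have "lowerable (pd M K)"
  proof (rule lowerable_pd[OF K])
    show "lowerable K" unfolding K_def by (rule lowerable_first_order_part[OF g v order_refl order_refl])
    show "nonneg_derivs K (\<lambda>_. 0)"
      unfolding K_def
      by (intro nonneg_derivs_add[of _ "Suc M"] nonneg_derivs_mult[of _ "Suc M"] nonneg_derivs_coord
          polyfun.mult polyfun.coord gS D nD g) simp_all
    show "pd M (pd M K) = (\<lambda>_. 0)" unfolding dK by (rule pd_outside[OF DM order_refl])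
  qed
  then show "lowerable ?D" unfolding dK .
qed

text \<open>Every derivative of the composition is the composition of a directional derivative of \<open>g\<close> with
  the same affine map.\<close>

lemma garding_fun_affine:
  assumes g: "g \<in> polyfun M" "multiaffine g" "lowerable g" "nonneg_derivs g (\<lambda>_. 0)"
    and A: "\<And>i j. i < N \<Longrightarrow> j < M \<Longrightarrow> 0 \<le> A j i" "\<And>j. j < M \<Longrightarrow> 0 < (\<Sum>i<N. A j i)"
  shows "garding_fun (\<lambda>x. g (affine_map N M A b x))"
  unfolding garding_fun_def
proof
  fix "is"
  show "lowerable (pds is (\<lambda>x. g (affine_map N M A b x)))"
    using g
  proof (induction "is" arbitrary: g)
    case Nil
    then show ?case using lowerable_affine[of g M N A b] A by simp
  next
    case (Cons i js)
    show ?case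
    proof (cases "i < N")
      case True
      have v: "\<And>j. j < M \<Longrightarrow> 0 \<le> A j i" using A(1) True by blast
      have "lowerable (pds js (\<lambda>x. dir_deriv M (\<lambda>j. A j i) g (affine_map N M A b x)))"
        by (rule Cons.IH[OF polyfun_dir_deriv[OF Cons.prems(1)] dir_deriv_multiaffine[OF Cons.prems v]])
      then show ?thesis using True by (simp add: pd_affine[OF Cons.prems(1)])
    next
      case False
      then show ?thesis using pd_outside[OF polyfun_affine[OF Cons.prems(1)]] by (simp add: lowerable_zero)
    qed
  qed
qed


section \<open>Full polarization\<close>

lemma funpow_pd_mono: "(pd i ^^ k) f = (\<lambda>_. 0) \<Longrightarrow> k \<le> l \<Longrightarrow> (pd i ^^ l) f = (\<lambda>_. 0)"
proof -
  assume "(pd i ^^ k) f = (\<lambda>_. 0)" "k \<le> l"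
  then have "(pd i ^^ (l - k + k)) f = (\<lambda>_. 0)" unfolding funpow_add by simp
  then show ?thesis using \<open>k \<le> l\<close> by simp
qed

text \<open>While some variable has degree at least 2, split off one copy of it by a polar form. The map
  \<open>\<rho>\<close> records of which variable an index is a copy.\<close>

lemma polarization_exists:
  assumes "f \<in> polyfun N" "garding_fun f" "nonneg_derivs f (\<lambda>_. 0)"
    and "\<And>i. i < N \<Longrightarrow> (pd i ^^ Suc (\<delta> i)) f = (\<lambda>_. 0)"
  shows "\<exists>M g \<rho>. g \<in> polyfun M \<and> multiaffine g \<and> lowerable g \<and> nonneg_derivs g (\<lambda>_. 0) \<and>
    (\<forall>j<M. \<rho> j < N) \<and> (\<forall>x. f x = g (\<lambda>j. x (\<rho> j)))"
  using assms
proof (induction "\<Sum>i<N. \<delta> i - 1" arbitrary: f N \<delta> rule: less_induct)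
  case less
  note f = less.prems(1)
  show ?case
  proof (cases "\<forall>i<N. \<delta> i \<le> 1")
    case True
    have "pd i (pd i f) = (\<lambda>_. 0)" for i
    proof (cases "i < N")
      case i: True
      then have "(pd i ^^ 2) f = (\<lambda>_. 0)"
        using True by (intro funpow_pd_mono[OF less.prems(4)[OF i]]) auto
      then show ?thesis by (simp add: numeral_2_eq_2)
    qed (simp add: pd_outside[OF f])
    then have "multiaffine f" by (simp add: multiaffine_def)
    then show ?thesis
      using less.prems(1-3) garding_fun_lowerable by (intro exI[of _ N] exI[of _ f] exI[of _ "\<lambda>j. j"]) auto
  next
    case False
    then obtain i where i: "i < N" "2 \<le> \<delta> i" by force
    define k where "k = \<delta> i"
    have k: "1 \<le> k" "2 \<le> k" using i by (auto simp: k_def)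
    define F where "F = polar k i N f"
    define \<delta>' where "\<delta>' = (\<lambda>j. if j = N then 1 else if j = i then k - 1 else \<delta> j)"
    have fS: "f \<in> polyfun (Suc N)" by (rule polyfun_mono[OF f]) simp
    have iS: "i < Suc N" "N < Suc N" "i \<noteq> N" using i by auto
    have fN: "pd N f = (\<lambda>_. 0)" by (rule pd_outside[OF f order_refl])
    have deg: "(pd i ^^ Suc k) f = (\<lambda>_. 0)" unfolding k_def by (rule less.prems(4)[OF i(1)])
    note base = fS iS fN
    have "(\<Sum>j<Suc N. \<delta>' j - 1) = (\<Sum>j<N. \<delta>' j - 1)" by (simp add: \<delta>'_def)
    also have "\<dots> < (\<Sum>j<N. \<delta> j - 1)"
      by (rule sum_strict_mono_ex1) (use i k in \<open>auto simp: \<delta>'_def k_def intro!: bexI[of _ i]\<close>)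
    finally have "(\<Sum>j<Suc N. \<delta>' j - 1) < (\<Sum>j<N. \<delta> j - 1)" .
    moreover have "F \<in> polyfun (Suc N)" unfolding F_def by (rule polyfun_polar[OF fS iS(1,2)])
    moreover have "garding_fun F"
      unfolding F_def by (rule garding_fun_polar[OF base k(1) deg less.prems(2,3)])
    moreover have "nonneg_derivs F (\<lambda>_. 0)"
      unfolding F_def by (rule nonneg_derivs_polar[OF base k(1) deg less.prems(3)]) simp
    moreover have "(pd j ^^ Suc (\<delta>' j)) F = (\<lambda>_. 0)" if j: "j < Suc N" for j
    proof -
      consider "j = N" | "j = i" | "j \<noteq> N" "j \<noteq> i" by blast
      then show ?thesis
      proof cases
        case 1
        have "pd N (pd N F) = (\<lambda>_. 0)"
          unfolding F_def pd_new_polar[OF base] pd_cmult[OF polyfun_pd[OF fS]]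
          using pd_commute[OF fS, of N i] fN by simp
        then show ?thesis using 1 by (simp add: \<delta>'_def)
      next
        case 2
        then show ?thesis
          unfolding F_def using funpow_pd_polar[OF base deg k(1)] i k by (simp add: \<delta>'_def)
      next
        case 3
        then have "(pd j ^^ Suc (\<delta> j)) f = (\<lambda>_. 0)" using less.prems(4) j by simp
        then show ?thesis
          unfolding F_def using funpow_pd_other_polar[OF base 3(2,1), of "Suc (\<delta> j)" k] 3
          by (simp add: \<delta>'_def polar_def)
      qed
    qed
    ultimately obtain M g \<rho> where g: "g \<in> polyfun M" "multiaffine g" "lowerable g" "nonneg_derivs g (\<lambda>_. 0)"
      and \<rho>: "\<forall>j<M. \<rho> j < Suc N" "\<forall>x. F x = g (\<lambda>j. x (\<rho> j))"
      using less.hyps[of \<delta>' "Suc N" F] by blast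
    define \<rho>' where "\<rho>' = (\<lambda>j. if \<rho> j = N then i else \<rho> j)"
    have "\<forall>j<M. \<rho>' j < N" using \<rho>(1) i by (auto simp: \<rho>'_def less_Suc_eq)
    moreover have "f x = g (\<lambda>j. x (\<rho>' j))" for x
    proof -
      have "f x = f (x(N := x i))" by (rule polyfun_cong[OF f]) auto
      also have "\<dots> = F (x(N := x i))" using i by (simp add: F_def polar_def)
      also have "\<dots> = g (\<lambda>j. (x(N := x i)) (\<rho> j))" using \<rho>(2) by blast
      also have "(\<lambda>j. (x(N := x i)) (\<rho> j)) = (\<lambda>j. x (\<rho>' j))" by (auto simp: \<rho>'_def)
      finally show ?thesis .
    qed
    ultimately show ?thesis using g by blast
  qed
qed

section \<open>The apolar pairing of two variables\<close>

text \<open>This is what remains of \<open>h\<close> after splitting off a copy \<open>s\<close> of \<open>p\<close> and a copy \<open>t\<close> of \<open>q\<close> by polar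
  forms for the degree bound \<open>k\<close>, and contracting \<open>s\<close> with \<open>t\<close>.\<close>

definition apolar_step :: "nat \<Rightarrow> nat \<Rightarrow> nat \<Rightarrow> ((nat \<Rightarrow> real) \<Rightarrow> real) \<Rightarrow> (nat \<Rightarrow> real) \<Rightarrow> real" where
  "apolar_step k p q h = (\<lambda>x. (pd p h x + pd q h x) / k - (x p + x q) * pd p (pd q h) x / k\<^sup>2)"

lemma apolar_step:
  assumes h: "h \<in> polyfun N" "garding_fun h" "nonneg_derivs h (\<lambda>_. 0)"
    and pq: "p < N" "q < N" "p \<noteq> q" and k: "1 \<le> k"
    and deg: "(pd p ^^ Suc k) h = (\<lambda>_. 0)" "(pd q ^^ Suc k) h = (\<lambda>_. 0)"
  shows "apolar_step k p q h \<in> polyfun N" "garding_fun (apolar_step k p q h)"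
    "nonneg_derivs (apolar_step k p q h) (\<lambda>_. 0)"
    "(pd p ^^ k) (apolar_step k p q h) = (\<lambda>_. 0)" "(pd q ^^ k) (apolar_step k p q h) = (\<lambda>_. 0)"
    "\<And>j l. j \<noteq> p \<Longrightarrow> j \<noteq> q \<Longrightarrow> (pd j ^^ l) h = (\<lambda>_. 0) \<Longrightarrow> (pd j ^^ l) (apolar_step k p q h) = (\<lambda>_. 0)"
proof -
  define s where "s = N"
  define t where "t = Suc N"
  define K where "K = Suc (Suc N)"
  note idx = s_def t_def K_def
  have hK: "h \<in> polyfun K" by (rule polyfun_mono[OF h(1)]) (simp add: idx)
  have lt: "p < K" "q < K" "s < K" "t < K" "p \<noteq> s" "q \<noteq> t" "s \<noteq> t" "p \<noteq> t" "q \<noteq> s" using pq by (auto simp: idx)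
  have hs: "pd s h = (\<lambda>_. 0)" "pd t h = (\<lambda>_. 0)" by (auto intro!: pd_outside[OF h(1)] simp: idx)
  define G where "G = polar k p s h"
  note bG = hK lt(1,3,5) hs(1)
  have G: "G \<in> polyfun K" unfolding G_def by (rule polyfun_polar[OF hK lt(1,3)])
  have gG: "garding_fun G" unfolding G_def by (rule garding_fun_polar[OF bG k deg(1) h(2,3)])
  have nG: "nonneg_derivs G (\<lambda>_. 0)" unfolding G_def by (rule nonneg_derivs_polar[OF bG k deg(1) h(3)]) simp
  have otherG: "(pd j ^^ l) G = (\<lambda>_. 0)" if "(pd j ^^ l) h = (\<lambda>_. 0)" "j \<noteq> p" "j \<noteq> s" for j l
    unfolding G_def funpow_pd_other_polar[OF bG that(2,3)] that(1) by (simp add: polar_def)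
  have Gt: "pd t G = (\<lambda>_. 0)" using otherG[where j = t and l = 1] hs lt by simp
  have Gq: "(pd q ^^ Suc k) G = (\<lambda>_. 0)" by (rule otherG[OF deg(2)]) (use pq lt in auto)
  have Gp: "(pd p ^^ k) G = (\<lambda>_. 0)" unfolding G_def by (rule funpow_pd_polar[OF bG deg(1) k])
  note bF = G lt(2,4,6) Gt
  define F where "F = polar k q t G"
  have F: "F \<in> polyfun K" unfolding F_def by (rule polyfun_polar[OF G lt(2,4)])
  have gF: "garding_fun F" unfolding F_def by (rule garding_fun_polar[OF bF k Gq gG nG])
  have nF: "nonneg_derivs F (\<lambda>_. 0)" unfolding F_def by (rule nonneg_derivs_polar[OF bF k Gq nG]) simp
  have otherF: "(pd j ^^ l) F = (\<lambda>_. 0)" if "(pd j ^^ l) G = (\<lambda>_. 0)" "j \<noteq> q" "j \<noteq> t" for j l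
    unfolding F_def funpow_pd_other_polar[OF bF that(2,3)] that(1) by (simp add: polar_def)
  have Fp: "(pd p ^^ k) F = (\<lambda>_. 0)" by (rule otherF[OF Gp]) (use pq lt in auto)
  have Fq: "(pd q ^^ k) F = (\<lambda>_. 0)" unfolding F_def by (rule funpow_pd_polar[OF bF Gq k])
  have comm: "pd q (pd p h) = pd p (pd q h)" by (rule pd_commute[OF hK])
  have dGq: "pd q G = (\<lambda>x. pd q h x + (x s - x p) * (pd p (pd q h) x / k))"
    unfolding G_def pd_other_polar[OF bG pq(3)[symmetric] lt(9)] by (simp add: polar_def)
  define a where "a = (\<lambda>x. h x - x p * (pd p h x / k) - x q / k * (pd q h x - x p * (pd p (pd q h) x / k)))"
  define b where "b = (\<lambda>x. pd p h x / k - x q * pd p (pd q h) x / k\<^sup>2)"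
  define c where "c = (\<lambda>x. pd q h x / k - x p * pd p (pd q h) x / k\<^sup>2)"
  define d where "d = (\<lambda>x. pd p (pd q h) x / k\<^sup>2)"
  have F_eq: "F x = a x + x s * b x + x t * c x + x s * x t * d x" for x
    unfolding F_def polar_def[of k q t] dGq unfolding G_def polar_def a_def b_def c_def d_def
    using k by (simp add: field_simps power2_eq_square)
  have ind: "u (x(i := v)) = u x" if "u \<in> polyfun N" "N \<le> i" for u x i v
    by (rule polyfun_cong[OF that(1)]) (use that in auto)
  have ps: "pd p h \<in> polyfun N" "pd q h \<in> polyfun N" "pd p (pd q h) \<in> polyfun N"
    by (intro polyfun_pd h)+
  have inds: "u (x(s := v)) = u x \<and> u (x(t := v)) = u x" if "u \<in> {a, b, c, d}" for u x v
  proof -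
    have big: "N \<le> s" "N \<le> t" by (auto simp: idx)
    note inds = ind[OF h(1)] ind[OF ps(1)] ind[OF ps(2)] ind[OF ps(3)]
    show ?thesis
      using that lt by (auto simp: a_def b_def c_def d_def inds big)
  qed
  note F2 = bilinear_in_pair[OF F_eq lt(7) inds]
  have eq: "apolar_step k p q h = contract s t F"
  proof
    fix x
    have "contract s t F x = b x + c x" by (rule fun_cong[OF F2(3)])
    then show "apolar_step k p q h x = contract s t F x"
      unfolding b_def c_def apolar_step_def by (simp add: add_divide_distrib distrib_right)
  qed
  note C = contract_garding[OF F gF nF lt(3,4,7) F2(1,2)]
  show "garding_fun (apolar_step k p q h)" unfolding eq by (rule C(1))
  show "nonneg_derivs (apolar_step k p q h) (\<lambda>_. 0)" unfolding eq by (rule C(2))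
  show "apolar_step k p q h \<in> polyfun N"
    unfolding apolar_step_def divide_inverse
    by (intro polyfun_diff polyfun.mult polyfun.add polyfun.coord polyfun.const ps pq)
  have van: "(pd j ^^ l) (contract s t F) = (\<lambda>_. 0)" if z: "(pd j ^^ l) F = (\<lambda>_. 0)" and j: "j \<noteq> s" "j \<noteq> t" for j l
  proof -
    have pp: "(\<lambda>x. pd s F x + pd t F x) \<in> polyfun K" by (intro polyfun.add polyfun_pd F)
    have "(pd j ^^ l) (\<lambda>x. pd s F x + pd t F x) = (\<lambda>x. (pd j ^^ l) (pd s F) x + (pd j ^^ l) (pd t F) x)"
      by (induction l) (auto simp: pd_add[OF polyfun_funpow[OF polyfun_pd[OF F]] polyfun_funpow[OF polyfun_pd[OF F]]])
    also have "\<dots> = (\<lambda>_. 0)" unfolding funpow_pd_commute[OF F] z by simp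
    finally show ?thesis
      unfolding contract_def funpow_pd_restrict0[OF polyfun_restrict0[OF pp] j(1)] funpow_pd_restrict0[OF pp j(2)]
      by simp
  qed
  show "(pd p ^^ k) (apolar_step k p q h) = (\<lambda>_. 0)" unfolding eq by (rule van[OF Fp lt(5,8)])
  show "(pd q ^^ k) (apolar_step k p q h) = (\<lambda>_. 0)" unfolding eq by (rule van[OF Fq lt(9,6)])
  show "(pd j ^^ l) (apolar_step k p q h) = (\<lambda>_. 0)" if "j \<noteq> p" "j \<noteq> q" "(pd j ^^ l) h = (\<lambda>_. 0)" for j l
  proof (cases "j < N")
    case True
    then have "j \<noteq> s" "j \<noteq> t" by (auto simp: idx)
    then show ?thesis unfolding eq by (intro van otherF otherG that)
  next
    case False
    have "l \<noteq> 0 \<or> h = (\<lambda>_. 0)" using that by (cases l) auto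
    then show ?thesis
    proof
      assume "l \<noteq> 0"
      then obtain m where "l = Suc m" using not0_implies_Suc by blast
      moreover have "pd j (apolar_step k p q h) = (\<lambda>_. 0)"
        using False by (intro pd_outside[OF \<open>apolar_step k p q h \<in> polyfun N\<close>]) simp
      ultimately show ?thesis by (simp add: funpow_swap1 del: funpow.simps) (simp add: funpow_Suc_right del: funpow.simps)
    next
      assume "h = (\<lambda>_. 0)"
      then show ?thesis by (simp add: apolar_step_def)
    qed
  qed
qed

fun apolar :: "nat \<Rightarrow> nat \<Rightarrow> nat \<Rightarrow> ((nat \<Rightarrow> real) \<Rightarrow> real) \<Rightarrow> (nat \<Rightarrow> real) \<Rightarrow> real" where
  "apolar 0 p q h = h"
| "apolar (Suc k) p q h = apolar k p q (apolar_step (Suc k) p q h)"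

lemma apolar_garding:
  assumes "h \<in> polyfun N" "garding_fun h" "nonneg_derivs h (\<lambda>_. 0)"
    and pq: "p < N" "q < N" "p \<noteq> q"
    and "(pd p ^^ Suc k) h = (\<lambda>_. 0)" "(pd q ^^ Suc k) h = (\<lambda>_. 0)"
  shows "apolar k p q h \<in> polyfun N \<and> garding_fun (apolar k p q h) \<and> nonneg_derivs (apolar k p q h) (\<lambda>_. 0) \<and>
    (\<forall>j l. j \<noteq> p \<longrightarrow> j \<noteq> q \<longrightarrow> (pd j ^^ l) h = (\<lambda>_. 0) \<longrightarrow> (pd j ^^ l) (apolar k p q h) = (\<lambda>_. 0))"
  using assms(1-3,7,8)
proof (induction k arbitrary: h)
  case (Suc k)
  note A = apolar_step[OF Suc.prems(1-3) pq _ Suc.prems(4,5), simplified]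
  show ?case using Suc.IH[OF A(1-3)] A(4-6) by simp
qed simp

lemma apolar_step_sum:
  assumes "\<And>a. a \<in> A \<Longrightarrow> h a \<in> polyfun N"
  shows "apolar_step k p q (\<lambda>x. \<Sum>a\<in>A. h a x) = (\<lambda>x. \<Sum>a\<in>A. apolar_step k p q (h a) x)"
  using assms
  unfolding apolar_step_def
  by (simp add: pd_sum[of _ _ N] polyfun_pd sum.distrib sum_subtractf sum_divide_distrib sum_distrib_left add_divide_distrib)

lemma polyfun_apolar_step:
  "h \<in> polyfun N \<Longrightarrow> p < N \<Longrightarrow> q < N \<Longrightarrow> apolar_step k p q h \<in> polyfun N"
  unfolding apolar_step_def divide_inverse
  by (intro polyfun_diff polyfun.mult polyfun.add polyfun.coord polyfun.const polyfun_pd)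

lemma apolar_sum:
  assumes "\<And>a. a \<in> A \<Longrightarrow> h a \<in> polyfun N" "p < N" "q < N"
  shows "apolar k p q (\<lambda>x. \<Sum>a\<in>A. h a x) = (\<lambda>x. \<Sum>a\<in>A. apolar k p q (h a) x)"
  using assms(1)
proof (induction k arbitrary: h)
  case (Suc k)
  show ?case
    using Suc.IH[of "\<lambda>a. apolar_step (Suc k) p q (h a)"] Suc.prems
    by (simp add: apolar_step_sum[of _ _ N] polyfun_apolar_step assms)
qed simp

lemma pd_monomial:
  assumes "\<And>x v. C (x(p := v)) = C x"
  shows "pd p (\<lambda>x. C x * x p ^ a) = (\<lambda>x. real a * (C x * x p ^ (a - 1)))"
  by (rule pd_eqI) (auto simp: assms intro!: derivative_eq_intros)

lemma apolar_step_monomial: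
  assumes C: "\<And>x v. C (x(p := v)) = C x" "\<And>x v. C (x(q := v)) = C x" and pq: "p \<noteq> q"
  shows "apolar_step k p q (\<lambda>x. C x * (x p ^ a * x q ^ b)) = (\<lambda>x.
    (real a / k * (1 - real b / k)) * (C x * (x p ^ (a - 1) * x q ^ b)) +
    (real b / k * (1 - real a / k)) * (C x * (x p ^ a * x q ^ (b - 1))))"
proof -
  have 1: "pd p (\<lambda>x. C x * (x p ^ a * x q ^ b)) = (\<lambda>x. real a * (C x * (x p ^ (a - 1) * x q ^ b)))" for b
    using pd_monomial[of "\<lambda>x. C x * x q ^ b" p a] C pq by (simp add: mult_ac)
  have 2: "pd q (\<lambda>x. C x * (x p ^ a * x q ^ b)) = (\<lambda>x. real b * (C x * (x p ^ a * x q ^ (b - 1))))"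
    using pd_monomial[of "\<lambda>x. C x * x p ^ a" q b] C pq by (simp add: mult_ac)
  have 3: "pd p (\<lambda>x. real b * (C x * (x p ^ a * x q ^ (b - 1)))) = (\<lambda>x. real b * (real a * (C x * (x p ^ (a - 1) * x q ^ (b - 1)))))"
    using pd_monomial[of "\<lambda>x. real b * C x * x q ^ (b - 1)" p a] C pq by (simp add: mult_ac)
  have 4: "real a * (x p * (x p ^ (a - 1) * r)) = real a * (x p ^ a * r)" for x :: "nat \<Rightarrow> real" and r
    by (cases a) auto
  have 5: "real b * (x q * (x q ^ (b - 1) * r)) = real b * (x q ^ b * r)" for x :: "nat \<Rightarrow> real" and r
    by (cases b) auto
  show ?thesis
  proof
    fix x :: "nat \<Rightarrow> real"
    have "(x p + x q) * (real b * (real a * (C x * (x p ^ (a - 1) * x q ^ (b - 1)))))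
        = real b * (C x * x q ^ (b - 1)) * (real a * (x p * (x p ^ (a - 1) * 1)))
        + real a * (C x * x p ^ (a - 1)) * (real b * (x q * (x q ^ (b - 1) * 1)))"
      by (simp add: algebra_simps)
    also have "\<dots> = real b * (C x * x q ^ (b - 1)) * (real a * (x p ^ a * 1))
        + real a * (C x * x p ^ (a - 1)) * (real b * (x q ^ b * 1))"
      unfolding 4 5 ..
    finally have e: "(x p + x q) * (real b * (real a * (C x * (x p ^ (a - 1) * x q ^ (b - 1)))))
      = real b * (C x * x q ^ (b - 1)) * (real a * (x p ^ a * 1))
        + real a * (C x * x p ^ (a - 1)) * (real b * (x q ^ b * 1))" .
    show "apolar_step k p q (\<lambda>x. C x * (x p ^ a * x q ^ b)) x =
      (real a / k * (1 - real b / k)) * (C x * (x p ^ (a - 1) * x q ^ b)) +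
      (real b / k * (1 - real a / k)) * (C x * (x p ^ a * x q ^ (b - 1)))"
      unfolding apolar_step_def 2 1 3 e
      by (cases "k = 0") (simp_all add: field_simps power2_eq_square)
  qed
qed

lemma apolar_step_add_cmult:
  assumes "g \<in> polyfun N" "h \<in> polyfun N"
  shows "apolar_step k p q (\<lambda>x. c * g x + d * h x) = (\<lambda>x. c * apolar_step k p q g x + d * apolar_step k p q h x)"
proof -
  note ps = polyfun_pd[OF assms(1)] polyfun_pd[OF assms(2)]
  have 1: "pd i (\<lambda>x. c * g x + d * h x) = (\<lambda>x. c * pd i g x + d * pd i h x)" for i
    by (simp add: pd_add[OF polyfun_cmult[OF assms(1)] polyfun_cmult[OF assms(2)]] pd_cmult[OF assms(1)] pd_cmult[OF assms(2)])
  have 2: "pd i (\<lambda>x. c * pd j g x + d * pd j h x) = (\<lambda>x. c * pd i (pd j g) x + d * pd i (pd j h) x)" for i j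
    by (simp add: pd_add[OF polyfun_cmult[OF ps(1)] polyfun_cmult[OF ps(2)]] pd_cmult[OF ps(1)] pd_cmult[OF ps(2)])
  show ?thesis
    unfolding apolar_step_def 1 2 by (intro ext) (simp add: algebra_simps add_divide_distrib diff_divide_distrib)
qed

lemma apolar_add_cmult:
  assumes "g \<in> polyfun N" "h \<in> polyfun N" "p < N" "q < N"
  shows "apolar k p q (\<lambda>x. c * g x + d * h x) = (\<lambda>x. c * apolar k p q g x + d * apolar k p q h x)"
  using assms(1,2)
proof (induction k arbitrary: g h)
  case (Suc k)
  show ?case
    using Suc.IH[OF polyfun_apolar_step[OF Suc.prems(1) assms(3,4)] polyfun_apolar_step[OF Suc.prems(2) assms(3,4)]]
    by (simp only: apolar.simps apolar_step_add_cmult[OF Suc.prems])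
qed simp

text \<open>The weights of the two monomials in \<open>apolar_step_monomial\<close>, for complementary exponents. By the
  absorption identities the two terms are the fractions \<open>a / Suc k\<close> and \<open>b / Suc k\<close> of the
  right-hand side.\<close>

lemma binomial_pairing_rec:
  assumes "a + b = Suc k"
  shows "(real a / Suc k)\<^sup>2 * inverse (k choose (a - 1)) * of_bool (0 < a) +
     (real b / Suc k)\<^sup>2 * inverse (k choose a) * of_bool (0 < b) = inverse (real (Suc k choose a))"
proof -
  have aux: "(u / n)\<^sup>2 * inverse B' = (u / n) * inverse B"
    if "n * B' = u * B" "0 < n" "0 < B'" "0 < B" for u n B B' :: real
  proof -
    have "B' = u * B / n" "u \<noteq> 0" using that by (auto simp: field_simps)
    then show ?thesis using that by (simp add: field_simps power2_eq_square)
  qed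
  have r: "real (Suc k) = real a + real b" using assms by (metis of_nat_add)
  consider "a = 0" | "b = 0" | a' b' where "a = Suc a'" "b = Suc b'" by (meson not0_implies_Suc)
  then show ?thesis
  proof cases
    case 3
    have k: "k = a' + b" "a' \<le> k" "Suc a' \<le> k" using assms 3 by auto
    have 1: "real (Suc k) * real (k choose a') = real a * real (Suc k choose a)"
      using Suc_times_binomial[of a' k] 3 by (metis of_nat_mult)
    have 2: "real (Suc k) * real (k choose a) = real b * real (Suc k choose a)"
      using binomial_absorb_comp[of "Suc k" a] assms by (metis add_diff_cancel_left' diff_Suc_1 of_nat_mult)
    have pos: "0 < real (k choose a')" "0 < real (k choose a)" "0 < real (Suc k choose a)"
      using k 3 by (simp_all add: zero_less_binomial_iff del: binomial_Suc_Suc)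
    have "(real a / Suc k)\<^sup>2 * inverse (k choose a') = (real a / Suc k) * inverse (Suc k choose a)"
      by (rule aux[OF 1 _ pos(1,3)]) simp
    moreover have "(real b / Suc k)\<^sup>2 * inverse (k choose a) = (real b / Suc k) * inverse (Suc k choose a)"
      by (rule aux[OF 2 _ pos(2,3)]) simp
    moreover have "real a / Suc k + real b / Suc k = 1"
      unfolding add_divide_distrib[symmetric] r[symmetric] by simp
    ultimately have "(real a / Suc k)\<^sup>2 * inverse (k choose a') + (real b / Suc k)\<^sup>2 * inverse (k choose a)
        = 1 * inverse (real (Suc k choose a))"
      by (simp only: flip: distrib_right)
    then show ?thesis using 3 by (simp del: binomial_Suc_Suc)
  qed (use assms in auto)
qed

text \<open>Each step lowers the bound \<open>k\<close> and the sum of the exponents by one. If the exponents add up to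
  more than \<open>k\<close>, a coefficient \<open>1 - a / k\<close> or \<open>1 - b / k\<close> vanishes before \<open>k\<close> is zero; if they add up
  to less, both exponents reach zero too early.\<close>

lemma apolar_monomial:
  assumes "C \<in> polyfun N" "\<And>x v. C (x(p := v)) = C x" "\<And>x v. C (x(q := v)) = C x"
    and "p < N" "q < N" "p \<noteq> q" "a \<le> k" "b \<le> k"
  shows "apolar k p q (\<lambda>x. C x * (x p ^ a * x q ^ b)) =
    (\<lambda>x. (if a + b = k then inverse (real (k choose a)) else 0) * C x)"
  using assms(7,8)
proof (induction k arbitrary: a b)
  case 0
  then show ?case by simp
next
  case (Suc k)
  let ?c = "real a / Suc k * (1 - real b / Suc k)" and ?d = "real b / Suc k * (1 - real a / Suc k)"
  let ?m = "\<lambda>a b x. C x * (x p ^ a * x q ^ b)"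
  have pm: "?m a b \<in> polyfun N" for a b
    by (intro polyfun.mult polyfun_power polyfun.coord assms)
  have cd: "?c = (real a / Suc k)\<^sup>2" "?d = (real b / Suc k)\<^sup>2" if "a + b = Suc k"
  proof -
    have r: "real (Suc k) = real a + real b" using that by (metis of_nat_add)
    have "real a / Suc k + real b / Suc k = 1"
      unfolding add_divide_distrib[symmetric] r[symmetric] by simp
    then have c: "1 - real b / Suc k = real a / Suc k" and d: "1 - real a / Suc k = real b / Suc k" by linarith+
    show "?c = (real a / Suc k)\<^sup>2" unfolding c power2_eq_square ..
    show "?d = (real b / Suc k)\<^sup>2" unfolding d power2_eq_square ..
  qed
  have e0: "apolar (Suc k) p q (?m a b) = (\<lambda>x. ?c * apolar k p q (?m (a - 1) b) x + ?d * apolar k p q (?m a (b - 1)) x)"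
    unfolding apolar.simps apolar_step_monomial[OF assms(2,3,6)]
    by (rule apolar_add_cmult[OF pm pm assms(4,5)])
  have e1: "?c * apolar k p q (?m (a - 1) b) x
      = (real a / Suc k)\<^sup>2 * inverse (k choose (a - 1)) * of_bool (0 < a) * of_bool (a + b = Suc k) * C x" for x
  proof (cases "a = 0 \<or> b = Suc k")
    case False
    then have ab: "a - 1 \<le> k" "b \<le> k" "0 < a" using Suc.prems by auto
    then have "a - 1 + b = k \<longleftrightarrow> a + b = Suc k" by auto
    then show ?thesis unfolding Suc.IH[OF ab(1,2)] using ab cd by (cases "a + b = Suc k") simp_all
  next
    case True
    then show ?thesis by auto
  qed
  have e2: "?d * apolar k p q (?m a (b - 1)) x
      = (real b / Suc k)\<^sup>2 * inverse (k choose a) * of_bool (0 < b) * of_bool (a + b = Suc k) * C x" for x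
  proof (cases "b = 0 \<or> a = Suc k")
    case False
    then have ab: "a \<le> k" "b - 1 \<le> k" "0 < b" using Suc.prems by auto
    then have "a + (b - 1) = k \<longleftrightarrow> a + b = Suc k" by auto
    then show ?thesis unfolding Suc.IH[OF ab(1,2)] using ab cd by (cases "a + b = Suc k") simp_all
  next
    case True
    then show ?thesis by auto
  qed
  show ?case
  proof (cases "a + b = Suc k")
    case True
    show ?thesis
    proof
      fix x
      have "apolar (Suc k) p q (?m a b) x = ((real a / Suc k)\<^sup>2 * inverse (k choose (a - 1)) * of_bool (0 < a)
          + (real b / Suc k)\<^sup>2 * inverse (k choose a) * of_bool (0 < b)) * C x"
        unfolding e0 e1 e2 using True by (simp only: of_bool_eq distrib_right mult_1_right simp_thms)
      then show "apolar (Suc k) p q (?m a b) x =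
          (if a + b = Suc k then inverse (real (Suc k choose a)) else 0) * C x"
        unfolding binomial_pairing_rec[OF True] using True by simp
    qed
  next
    case False
    then show ?thesis unfolding e0 e1 e2 by simp
  qed
qed


section \<open>Evaluation of formal polynomials\<close>

definition monom_val :: "(nat \<Rightarrow>\<^sub>0 nat) \<Rightarrow> (nat \<Rightarrow> real) \<Rightarrow> real" where
  "monom_val \<alpha> x = (\<Prod>i\<in>Poly_Mapping.keys \<alpha>. x i ^ Poly_Mapping.lookup \<alpha> i)"

lemma monom_val_superset:
  "finite I \<Longrightarrow> Poly_Mapping.keys \<alpha> \<subseteq> I \<Longrightarrow> monom_val \<alpha> x = (\<Prod>i\<in>I. x i ^ Poly_Mapping.lookup \<alpha> i)"
  unfolding monom_val_def by (rule prod.mono_neutral_left) (auto simp: in_keys_iff)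

lemma monom_val_add: "monom_val (\<alpha> + \<beta>) x = monom_val \<alpha> x * monom_val \<beta> x"
proof -
  let ?I = "Poly_Mapping.keys \<alpha> \<union> Poly_Mapping.keys \<beta>"
  have "finite ?I" by simp
  moreover have "Poly_Mapping.keys (\<alpha> + \<beta>) \<subseteq> ?I" by (rule keys_add)
  ultimately show ?thesis
    by (simp add: monom_val_superset[of ?I] lookup_add power_add prod.distrib)
qed

lemma poly_eval_superset:
  assumes "finite A" "Poly_Mapping.keys f \<subseteq> A"
  shows "poly_eval f x = (\<Sum>\<alpha>\<in>A. Poly_Mapping.lookup f \<alpha> * monom_val \<alpha> x)"
  unfolding poly_eval_def monom_val_def[symmetric]
  by (rule sum.mono_neutral_left) (use assms in \<open>auto simp: in_keys_iff\<close>)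

lemma poly_eval_add: "poly_eval (f + g) x = poly_eval f x + poly_eval g x"
proof -
  let ?A = "Poly_Mapping.keys f \<union> Poly_Mapping.keys g"
  have "finite ?A" by simp
  moreover have "Poly_Mapping.keys (f + g) \<subseteq> ?A" by (rule keys_add)
  ultimately show ?thesis
    by (simp add: poly_eval_superset[of ?A] lookup_add distrib_right sum.distrib)
qed

lemma poly_eval_zero [simp]: "poly_eval 0 x = 0"
  by (simp add: poly_eval_def)

lemma poly_eval_sum: "poly_eval (\<Sum>a\<in>A. f a) x = (\<Sum>a\<in>A. poly_eval (f a) x)"
  by (induction A rule: infinite_finite_induct) (auto simp: poly_eval_add)

lemma poly_eval_single: "poly_eval (Poly_Mapping.single \<alpha> c) x = c * monom_val \<alpha> x"
  by (subst poly_eval_superset[of "{\<alpha>}"]) auto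

lemma poly_mapping_sum_single:
  assumes "finite A" "Poly_Mapping.keys f \<subseteq> A"
  shows "f = (\<Sum>\<alpha>\<in>A. Poly_Mapping.single \<alpha> (Poly_Mapping.lookup f \<alpha>))"
proof (rule poly_mapping_eqI)
  fix \<beta>
  have "Poly_Mapping.lookup (\<Sum>\<alpha>\<in>A. Poly_Mapping.single \<alpha> (Poly_Mapping.lookup f \<alpha>)) \<beta>
      = (\<Sum>\<alpha>\<in>A. if \<alpha> = \<beta> then Poly_Mapping.lookup f \<alpha> else 0)"
    by (simp add: lookup_sum lookup_single when_def)
  also have "\<dots> = Poly_Mapping.lookup f \<beta>"
    using assms by (simp add: sum.delta) (auto simp: in_keys_iff)
  finally show "Poly_Mapping.lookup f \<beta> =
      Poly_Mapping.lookup (\<Sum>\<alpha>\<in>A. Poly_Mapping.single \<alpha> (Poly_Mapping.lookup f \<alpha>)) \<beta>" ..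
qed

lemma poly_eval_mult: "poly_eval (f * g) x = poly_eval f x * poly_eval g x"
proof -
  have "f * g = (\<Sum>\<alpha>\<in>Poly_Mapping.keys f. \<Sum>\<beta>\<in>Poly_Mapping.keys g.
      Poly_Mapping.single (\<alpha> + \<beta>) (Poly_Mapping.lookup f \<alpha> * Poly_Mapping.lookup g \<beta>))"
  proof -
    have "f * g = (\<Sum>\<alpha>\<in>Poly_Mapping.keys f. Poly_Mapping.single \<alpha> (Poly_Mapping.lookup f \<alpha>)) *
        (\<Sum>\<alpha>\<in>Poly_Mapping.keys g. Poly_Mapping.single \<alpha> (Poly_Mapping.lookup g \<alpha>))"
      by (rule arg_cong2[of _ _ _ _ "(*)"]) (rule poly_mapping_sum_single; simp)+
    then show ?thesis by (simp add: sum_product mult_single)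
  qed
  then show ?thesis
    by (simp add: poly_eval_sum poly_eval_single monom_val_add)
       (simp add: poly_eval_superset[of "Poly_Mapping.keys f" f] poly_eval_superset[of "Poly_Mapping.keys g" g]
         sum_product algebra_simps)
qed

lemma poly_eval_Const [simp]: "poly_eval (Const c) x = c"
  by (simp add: Const_def poly_eval_single monom_val_def)

lemma poly_eval_Var [simp]: "poly_eval (Var i) x = x i"
  by (simp add: Var_def Monom_def poly_eval_single monom_val_def)

lemma polyfun_monom_val: "Poly_Mapping.keys \<alpha> \<subseteq> {..<n} \<Longrightarrow> monom_val \<alpha> \<in> polyfun n"
  unfolding monom_val_def[abs_def] by (intro polyfun_prod polyfun_power polyfun.coord) auto

lemma polyfun_poly_eval:
  assumes "f \<in> polys_in n"
  shows "poly_eval f \<in> polyfun n"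
proof -
  have "poly_eval f = (\<lambda>x. \<Sum>\<alpha>\<in>Poly_Mapping.keys f. Poly_Mapping.lookup f \<alpha> * monom_val \<alpha> x)"
    by (rule ext) (simp add: poly_eval_superset[of "Poly_Mapping.keys f"])
  then show ?thesis
    using assms by (auto simp: polys_in_def intro!: polyfun_sum polyfun_cmult polyfun_monom_val)
qed

lemma nonneg_derivs_power:
  "f \<in> polyfun N \<Longrightarrow> nonneg_derivs f x \<Longrightarrow> nonneg_derivs (\<lambda>x. f x ^ k) x"
  by (induction k) (auto intro: nonneg_derivs_mult polyfun_power)

lemma nonneg_derivs_prod:
  assumes "\<And>a. a \<in> A \<Longrightarrow> f a \<in> polyfun N" "\<And>a. a \<in> A \<Longrightarrow> nonneg_derivs (f a) x"
  shows "nonneg_derivs (\<lambda>x. \<Prod>a\<in>A. f a x) x"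
  using assms
  by (induction A rule: infinite_finite_induct) (auto intro!: nonneg_derivs_mult polyfun_prod)

lemma nonneg_derivs_poly_eval:
  assumes "f \<in> polys_in n" "nonneg_coeffs f"
  shows "nonneg_derivs (poly_eval f) (\<lambda>_. 0)"
proof -
  have "poly_eval f = (\<lambda>x. \<Sum>\<alpha>\<in>Poly_Mapping.keys f. Poly_Mapping.lookup f \<alpha> * monom_val \<alpha> x)"
    by (rule ext) (simp add: poly_eval_superset[of "Poly_Mapping.keys f"])
  moreover have "nonneg_derivs (monom_val \<alpha>) (\<lambda>_. 0)" if "Poly_Mapping.keys \<alpha> \<subseteq> {..<n}" for \<alpha>
    unfolding monom_val_def[abs_def] using that
    by (intro nonneg_derivs_prod[of _ _ n] nonneg_derivs_power[of _ n] polyfun_power nonneg_derivs_coord polyfun.coord) auto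
  ultimately show ?thesis
    using assms by (auto simp: polys_in_def nonneg_coeffs_def
      intro!: nonneg_derivs_sum[of _ _ n] nonneg_derivs_cmult[of _ n] polyfun_cmult polyfun_monom_val)
qed

lemma funpow_pd_sum:
  assumes "\<And>a. a \<in> A \<Longrightarrow> f a \<in> polyfun N" "\<And>a. a \<in> A \<Longrightarrow> (pd i ^^ k) (f a) = (\<lambda>_. 0)"
  shows "(pd i ^^ k) (\<lambda>x. \<Sum>a\<in>A. f a x) = (\<lambda>_. 0)"
proof -
  have "(pd i ^^ k) (\<lambda>x. \<Sum>a\<in>A. f a x) = (\<lambda>x. \<Sum>a\<in>A. (pd i ^^ k) (f a) x)"
  proof (induction k)
    case (Suc k)
    show ?case
      using pd_sum[of A "\<lambda>a. (pd i ^^ k) (f a)" N i] polyfun_funpow assms(1) by (simp add: Suc)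
  qed simp
  then show ?thesis using assms(2) by simp
qed

lemma funpow_pd_monomial:
  assumes "C \<in> polyfun N" "i < N" "\<And>x v. C (x(i := v)) = C x" "a < k"
  shows "(pd i ^^ k) (\<lambda>x. C x * x i ^ a) = (\<lambda>_. 0)"
  using assms(4)
proof (induction k arbitrary: a)
  case (Suc k)
  have p: "(\<lambda>x. C x * x i ^ b) \<in> polyfun N" for b
    by (intro polyfun.mult assms polyfun_power polyfun.coord)
  have "(pd i ^^ Suc k) (\<lambda>x. C x * x i ^ a) = (\<lambda>x. real a * (pd i ^^ k) (\<lambda>x. C x * x i ^ (a - 1)) x)"
    unfolding funpow_Suc_right comp_def pd_monomial[OF assms(3)] by (rule funpow_pd_cmult[OF p])
  also have "\<dots> = (\<lambda>_. 0)"
  proof (cases "a = 0")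
    case False
    then have "a - 1 < k" using Suc.prems by simp
    then show ?thesis using Suc.IH by simp
  qed simp
  finally show ?case .
qed simp

lemma funpow_pd_poly_eval:
  assumes "f \<in> polys_bounded n \<kappa>" "i < n"
  shows "(pd i ^^ Suc (\<kappa> i)) (poly_eval f) = (\<lambda>_. 0)"
proof -
  have in_n: "\<And>\<alpha>. \<alpha> \<in> Poly_Mapping.keys f \<Longrightarrow> Poly_Mapping.keys \<alpha> \<subseteq> {..<n}"
    and bd: "\<And>\<alpha>. \<alpha> \<in> Poly_Mapping.keys f \<Longrightarrow> Poly_Mapping.lookup \<alpha> i \<le> \<kappa> i"
    using assms by (auto simp: polys_bounded_def polys_in_def)
  have "poly_eval f = (\<lambda>x. \<Sum>\<alpha>\<in>Poly_Mapping.keys f. Poly_Mapping.lookup f \<alpha> * monom_val \<alpha> x)"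
    by (rule ext) (simp add: poly_eval_superset[of "Poly_Mapping.keys f"])
  moreover have "(pd i ^^ Suc (\<kappa> i)) (\<lambda>x. Poly_Mapping.lookup f \<alpha> * monom_val \<alpha> x) = (\<lambda>_. 0)"
    if \<alpha>: "\<alpha> \<in> Poly_Mapping.keys f" for \<alpha>
  proof -
    define C where "C = (\<lambda>x. Poly_Mapping.lookup f \<alpha> * (\<Prod>j\<in>{..<n} - {i}. x j ^ Poly_Mapping.lookup \<alpha> j))"
    have "(\<lambda>x. Poly_Mapping.lookup f \<alpha> * monom_val \<alpha> x) = (\<lambda>x. C x * x i ^ Poly_Mapping.lookup \<alpha> i)"
      using assms(2) by (simp add: monom_val_superset[OF _ in_n[OF \<alpha>]] C_def prod.remove[of "{..<n}" i] mult_ac)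
    moreover have "(pd i ^^ Suc (\<kappa> i)) (\<lambda>x. C x * x i ^ Poly_Mapping.lookup \<alpha> i) = (\<lambda>_. 0)"
    proof (rule funpow_pd_monomial[OF _ assms(2)])
      show "C \<in> polyfun n" unfolding C_def by (intro polyfun_cmult polyfun_prod polyfun_power polyfun.coord) auto
      show "Poly_Mapping.lookup \<alpha> i < Suc (\<kappa> i)" using bd[OF \<alpha>] by simp
      show "C (x(i := v)) = C x" for x v unfolding C_def by (intro arg_cong2[of _ _ _ _ "(*)"] prod.cong) auto
    qed
    ultimately show ?thesis by simp
  qed
  ultimately show ?thesis
    using in_n funpow_pd_sum[of "Poly_Mapping.keys f" "\<lambda>\<alpha> x. Poly_Mapping.lookup f \<alpha> * monom_val \<alpha> x" n]
    by (simp add: polyfun_cmult polyfun_monom_val del: funpow.simps)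
qed

lemma multiaffine_poly_eval:
  assumes "g \<in> polys_bounded n (\<lambda>_. 1)"
  shows "multiaffine (poly_eval g)"
  unfolding multiaffine_def
proof
  fix i
  have "g \<in> polys_in n" using assms by (simp add: polys_bounded_def)
  then show "pd i (pd i (poly_eval g)) = (\<lambda>_. 0)"
    using funpow_pd_poly_eval[OF assms, of i] pd_outside[OF polyfun_poly_eval, of g n i]
    by (cases "i < n") auto
qed

text \<open>Split \<open>F\<close> as an affine function of its last variable.\<close>

lemma multiaffine_imp_poly_eval:
  "F \<in> polyfun N \<Longrightarrow> multiaffine F \<Longrightarrow> \<exists>g\<in>polys_bounded N (\<lambda>_. 1). \<forall>x. poly_eval g x = F x"
proof (induction N arbitrary: F)
  case 0
  have "F (\<lambda>_. 0) = F x" for x by (rule polyfun_cong[OF 0(1)]) simp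
  then have "\<forall>x. poly_eval (Const (F (\<lambda>_. 0))) x = F x" unfolding poly_eval_Const by blast
  moreover have "Const (F (\<lambda>_. 0)) \<in> polys_bounded 0 (\<lambda>_. 1)"
    by (auto simp: polys_bounded_def polys_in_def Const_def split: if_splits)
  ultimately show ?case by blast
next
  case (Suc N)
  have restr: "restrict0 N f \<in> polyfun N" if "f \<in> polyfun (Suc N)" for f
    unfolding restrict0_def
  proof (rule polyfun_compose[OF that])
    fix j assume "j < Suc N"
    then show "(\<lambda>x. (x(N := 0)) j) \<in> polyfun N" by (cases "j = N") (auto intro: polyfun.intros)
  qed
  have ma: "multiaffine (restrict0 N f)" if "f \<in> polyfun (Suc N)" "multiaffine f" for f
    using that unfolding multiaffine_def by (auto simp: pd_restrict0[OF that(1)] pd_restrict0[OF polyfun_pd[OF that(1)]])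
  have dF: "pd N F \<in> polyfun (Suc N)" by (rule polyfun_pd[OF Suc.prems(1)])
  have "restrict0 N (pd N F) = pd N F"
    unfolding restrict0_def
    using pd_zero_imp_indep[OF dF multiaffineD[OF Suc.prems(2)]] by auto
  then have d: "pd N F \<in> polyfun N" "multiaffine (pd N F)"
    using restr[OF dF] multiaffine_pd[OF Suc.prems] by auto
  obtain g0 g1 where g0: "g0 \<in> polys_bounded N (\<lambda>_. 1)" "\<And>x. poly_eval g0 x = restrict0 N F x"
    and g1: "g1 \<in> polys_bounded N (\<lambda>_. 1)" "\<And>x. poly_eval g1 x = pd N F x"
    using Suc.IH[OF restr[OF Suc.prems(1)] ma[OF Suc.prems]] Suc.IH[OF d] by blast
  have "poly_eval (g0 + Var N * g1) x = F x" for x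
  proof -
    have 1: "F (x(N := 0)) = F x + (0 - x N) * pd N F x"
      by (rule affine_in_coord[OF Suc.prems(1) multiaffineD[OF Suc.prems(2)]])
    have 2: "poly_eval (g0 + Var N * g1) x = F (x(N := 0)) + x N * pd N F x"
      unfolding poly_eval_add poly_eval_mult poly_eval_Var g0(2) g1(2) unfolding restrict0_def ..
    have 3: "(a + (0 - b) * c) + b * c = a" for a b c :: real by (simp add: algebra_simps)
    have "poly_eval (g0 + Var N * g1) x = (F x + (0 - x N) * pd N F x) + x N * pd N F x"
      using 2 1 by argo
    also have "\<dots> = F x" by (rule 3)
    finally show ?thesis .
  qed
  moreover have "g0 + Var N * g1 \<in> polys_bounded (Suc N) (\<lambda>_. 1)"
  proof -
    have "Poly_Mapping.keys \<alpha> \<subseteq> {..<Suc N} \<and> (\<forall>i<Suc N. Poly_Mapping.lookup \<alpha> i \<le> 1)"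
      if "\<alpha> \<in> Poly_Mapping.keys (g0 + Var N * g1)" for \<alpha>
    proof -
      have kV: "Poly_Mapping.keys (Var N :: real mpoly) = {Poly_Mapping.single N 1}"
        by (simp add: Var_def Monom_def)
      have "\<alpha> \<in> Poly_Mapping.keys g0 \<or> \<alpha> \<in> Poly_Mapping.keys (Var N * g1)"
        using that keys_add[of g0 "Var N * g1"] by blast
      moreover have "\<exists>\<beta>\<in>Poly_Mapping.keys g1. \<alpha> = Poly_Mapping.single N 1 + \<beta>"
        if "\<alpha> \<in> Poly_Mapping.keys (Var N * g1)"
        using subsetD[OF keys_mult that] unfolding kV by blast
      ultimately consider "\<alpha> \<in> Poly_Mapping.keys g0"
        | \<beta> where "\<beta> \<in> Poly_Mapping.keys g1" "\<alpha> = Poly_Mapping.single N 1 + \<beta>"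
        by blast
      then show ?thesis
      proof cases
        case 1
        then have k: "Poly_Mapping.keys \<alpha> \<subseteq> {..<N}" "\<forall>i<N. Poly_Mapping.lookup \<alpha> i \<le> 1"
          using g0(1) by (auto simp: polys_bounded_def polys_in_def)
        moreover have "Poly_Mapping.lookup \<alpha> N = 0" using k(1) by (auto simp: in_keys_iff subset_iff)
        ultimately show ?thesis by (auto simp: less_Suc_eq subset_iff)
      next
        case 2
        then have k: "Poly_Mapping.keys \<beta> \<subseteq> {..<N}" "\<forall>i<N. Poly_Mapping.lookup \<beta> i \<le> 1"
          using g1(1) by (auto simp: polys_bounded_def polys_in_def)
        moreover have "Poly_Mapping.lookup \<beta> N = 0" using k(1) by (auto simp: in_keys_iff subset_iff)
        moreover have "Poly_Mapping.keys \<alpha> \<subseteq> {N} \<union> Poly_Mapping.keys \<beta>"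
          unfolding 2(2) using keys_add[of "Poly_Mapping.single N 1" \<beta>] by auto
        ultimately show ?thesis
          by (auto simp: less_Suc_eq 2(2) lookup_add lookup_single when_def)
      qed
    qed
    then show ?thesis by (auto simp: polys_bounded_def polys_in_def)
  qed
  ultimately show ?case by blast
qed

section \<open>The symbol\<close>

text \<open>The exponents \<open>a 0, \<dots>, a (n - 1)\<close> placed at the variables from \<open>m\<close> on.\<close>

definition exps :: "nat \<Rightarrow> nat \<Rightarrow> (nat \<Rightarrow> nat) \<Rightarrow> (nat \<Rightarrow>\<^sub>0 nat)" where
  "exps m n a = (\<Sum>i<n. Poly_Mapping.single (m + i) (a i))"

lemma lookup_exps: "Poly_Mapping.lookup (exps m n a) j = (if m \<le> j \<and> j < m + n then a (j - m) else 0)"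
proof -
  have "Poly_Mapping.lookup (exps m n a) j = (\<Sum>i<n. if m + i = j then a i else 0)"
    by (simp add: exps_def lookup_sum lookup_single when_def)
  also have "\<dots> = (\<Sum>i<n. if i = j - m then (if m \<le> j then a i else 0) else 0)"
    by (rule sum.cong) auto
  finally show ?thesis by (auto simp: sum.delta)
qed

lemma monom_val_exps: "monom_val (exps m n a) x = (\<Prod>i<n. x (m + i) ^ a i)"
proof -
  have "monom_val (exps m n a) x = (\<Prod>j\<in>(+) m ` {..<n}. x j ^ Poly_Mapping.lookup (exps m n a) j)"
  proof (rule monom_val_superset)
    show "Poly_Mapping.keys (exps m n a) \<subseteq> (+) m ` {..<n}"
    proof
      fix j assume "j \<in> Poly_Mapping.keys (exps m n a)"
      then have "m \<le> j" "j < m + n" by (auto simp: in_keys_iff lookup_exps split: if_splits)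
      then show "j \<in> (+) m ` {..<n}" by (intro image_eqI[of _ _ "j - m"]) auto
    qed
  qed simp
  also have "\<dots> = (\<Prod>i<n. x (m + i) ^ a i)"
    by (subst prod.reindex) (auto simp: lookup_exps inj_on_def)
  finally show ?thesis .
qed

lemma Monom_mult: "Monom \<alpha> * Monom \<beta> = Monom (\<alpha> + \<beta>)"
  by (simp add: Monom_def mult_single)

lemma Monom_prod: "finite A \<Longrightarrow> (\<Prod>i\<in>A. Monom (h i)) = Monom (\<Sum>i\<in>A. h i)"
  by (induction A rule: finite_induct) (simp_all add: Monom_mult, simp add: Monom_def)

lemma Var_power: "Var i ^ k = Monom (Poly_Mapping.single i k)"
proof (induction k)
  case 0
  show ?case by (simp add: Monom_def)
next
  case (Suc k)
  then show ?case by (simp add: Var_def Monom_mult flip: single_add)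
qed

lemma Const_mult: "Const a * Const b = Const (a * b)"
  by (simp add: Const_def mult_single)

lemma Const_one: "Const 1 = 1"
  by (simp add: Const_def)

lemma Const_power: "Const a ^ k = Const (a ^ k)"
  by (induction k) (simp_all add: Const_mult Const_one)

lemma Const_prod: "finite A \<Longrightarrow> (\<Prod>i\<in>A. Const (h i)) = Const (\<Prod>i\<in>A. h i)"
  by (induction A rule: finite_induct) (simp_all add: Const_mult Const_one)

lemma Const_of_nat: "of_nat k = Const (of_nat k)"
  by (simp add: Const_def single_of_nat)

lemma Const_mult_Monom: "Const c * Monom \<alpha> = Poly_Mapping.single \<alpha> c"
  by (simp add: Const_def Monom_def mult_single)

definition binom_prod :: "nat \<Rightarrow> (nat \<Rightarrow> nat) \<Rightarrow> (nat \<Rightarrow> nat) \<Rightarrow> real" where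
  "binom_prod n \<kappa> a = (\<Prod>i<n. real (\<kappa> i choose a i))"

lemma symbol_kernel_expand:
  "symbol_kernel n \<kappa> m = (\<Sum>a\<in>(\<Pi>\<^sub>E i\<in>{..<n}. {..\<kappa> i}).
     Poly_Mapping.single (exps 0 n a) (Poly_Mapping.single (exps m n (\<lambda>i. \<kappa> i - a i)) (binom_prod n \<kappa> a)))"
proof -
  have "symbol_kernel n \<kappa> m = (\<Prod>i<n. \<Sum>j\<le>\<kappa> i.
      Const (of_nat (\<kappa> i choose j) * Var (m + i) ^ (\<kappa> i - j)) * Monom (Poly_Mapping.single i j))"
    unfolding symbol_kernel_def binomial_ring
    by (intro prod.cong sum.cong refl)
       (simp add: Const_power Const_mult[symmetric] Var_power Const_of_nat[symmetric] mult_ac)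
  also have "\<dots> = (\<Sum>a\<in>(\<Pi>\<^sub>E i\<in>{..<n}. {..\<kappa> i}). \<Prod>i<n.
      Const (of_nat (\<kappa> i choose a i) * Var (m + i) ^ (\<kappa> i - a i)) * Monom (Poly_Mapping.single i (a i)))"
    by (rule prod_sum_PiE) auto
  also have "\<dots> = (\<Sum>a\<in>(\<Pi>\<^sub>E i\<in>{..<n}. {..\<kappa> i}).
     Poly_Mapping.single (exps 0 n a) (Poly_Mapping.single (exps m n (\<lambda>i. \<kappa> i - a i)) (binom_prod n \<kappa> a)))"
  proof (rule sum.cong[OF refl])
    fix a
    have "(\<Prod>i<n. of_nat (\<kappa> i choose a i) * Var (m + i) ^ (\<kappa> i - a i) :: real mpoly)
        = Const (binom_prod n \<kappa> a) * Monom (exps m n (\<lambda>i. \<kappa> i - a i))"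
      by (simp add: prod.distrib Var_power Monom_prod Const_of_nat Const_prod exps_def binom_prod_def)
    moreover have "(\<Prod>i<n. Const (c i) * Monom (e i)) = Const (\<Prod>i<n. c i) * Monom (\<Sum>i<n. e i)"
      for c :: "nat \<Rightarrow> real mpoly" and e
      by (simp only: prod.distrib Const_prod[OF finite_lessThan] Monom_prod[OF finite_lessThan])
    ultimately show "(\<Prod>i<n. Const (of_nat (\<kappa> i choose a i) * Var (m + i) ^ (\<kappa> i - a i)) * Monom (Poly_Mapping.single i (a i)))
      = Poly_Mapping.single (exps 0 n a) (Poly_Mapping.single (exps m n (\<lambda>i. \<kappa> i - a i)) (binom_prod n \<kappa> a))"
      by (simp add: Const_mult_Monom exps_def)
  qed
  finally show ?thesis .
qed

lemma extend_coeffs_superset: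
  assumes "finite A" "Poly_Mapping.keys P \<subseteq> A"
  shows "extend_coeffs T P = (\<Sum>\<alpha>\<in>A. Poly_Mapping.lookup P \<alpha> * T (Monom \<alpha>))"
  unfolding extend_coeffs_def
  by (rule sum.mono_neutral_left) (use assms in \<open>auto simp: in_keys_iff\<close>)

lemma extend_coeffs_add: "extend_coeffs T (P + Q) = extend_coeffs T P + extend_coeffs T Q"
proof -
  let ?A = "Poly_Mapping.keys P \<union> Poly_Mapping.keys Q"
  have "finite ?A" by simp
  moreover have "Poly_Mapping.keys (P + Q) \<subseteq> ?A" by (rule keys_add)
  ultimately show ?thesis
    by (simp add: extend_coeffs_superset[of ?A] lookup_add distrib_right sum.distrib)
qed

lemma extend_coeffs_single: "extend_coeffs T (Poly_Mapping.single \<alpha> c) = c * T (Monom \<alpha>)"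
  by (subst extend_coeffs_superset[of "{\<alpha>}"]) auto

lemma extend_coeffs_sum: "extend_coeffs T (\<Sum>a\<in>A. P a) = (\<Sum>a\<in>A. extend_coeffs T (P a))"
  by (induction A rule: infinite_finite_induct) (auto simp: extend_coeffs_add, auto simp: extend_coeffs_def)

lemma symb_expand:
  "symb n \<kappa> m T = (\<Sum>a\<in>(\<Pi>\<^sub>E i\<in>{..<n}. {..\<kappa> i}).
     Poly_Mapping.single (exps m n (\<lambda>i. \<kappa> i - a i)) (binom_prod n \<kappa> a) * T (Monom (exps 0 n a)))"
  unfolding symb_def symbol_kernel_expand extend_coeffs_sum extend_coeffs_single ..

lemma lookup_single_mult:
  fixes P :: "real mpoly"
  shows "Poly_Mapping.lookup (Poly_Mapping.single \<delta> c * P) \<theta>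
    = (\<Sum>\<gamma>\<in>Poly_Mapping.keys P. if \<delta> + \<gamma> = \<theta> then c * Poly_Mapping.lookup P \<gamma> else 0)"
  by (subst poly_mapping_sum_single[of "Poly_Mapping.keys P" P])
     (simp_all add: sum_distrib_left mult_single lookup_sum lookup_single when_def)

text \<open>The exponents of the \<open>u\<close>-variables determine \<open>a\<close>, so different terms of the symbol do not
  interfere.\<close>

lemma lookup_symb:
  assumes T: "\<And>a. a \<in> (\<Pi>\<^sub>E i\<in>{..<n}. {..\<kappa> i}) \<Longrightarrow> T (Monom (exps 0 n a)) \<in> polys_in m"
    and a: "a \<in> (\<Pi>\<^sub>E i\<in>{..<n}. {..\<kappa> i})" and \<beta>: "Poly_Mapping.keys \<beta> \<subseteq> {..<m}"
  shows "Poly_Mapping.lookup (symb n \<kappa> m T) (exps m n (\<lambda>i. \<kappa> i - a i) + \<beta>)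
    = binom_prod n \<kappa> a * Poly_Mapping.lookup (T (Monom (exps 0 n a))) \<beta>"
proof -
  let ?B = "\<Pi>\<^sub>E i\<in>{..<n}. {..\<kappa> i}"
  let ?e = "\<lambda>a. exps m n (\<lambda>i. \<kappa> i - a i)"
  have fin: "finite ?B" by (intro finite_PiE) auto
  have outside: "Poly_Mapping.lookup \<gamma> (m + i) = 0" if "Poly_Mapping.keys \<gamma> \<subseteq> {..<m}" for \<gamma> :: "nat \<Rightarrow>\<^sub>0 nat" and i
    using that by (auto simp: in_keys_iff subset_iff)
  have summand: "Poly_Mapping.lookup (Poly_Mapping.single (?e a') (binom_prod n \<kappa> a') * T (Monom (exps 0 n a'))) (?e a + \<beta>)
      = (if a' = a then binom_prod n \<kappa> a * Poly_Mapping.lookup (T (Monom (exps 0 n a))) \<beta> else 0)"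
    if a': "a' \<in> ?B" for a'
  proof -
    have eq: "a' = a \<and> \<gamma> = \<beta>" if \<gamma>: "\<gamma> \<in> Poly_Mapping.keys (T (Monom (exps 0 n a')))" and e: "?e a' + \<gamma> = ?e a + \<beta>" for \<gamma>
    proof -
      have k: "Poly_Mapping.keys \<gamma> \<subseteq> {..<m}" using T[OF a'] \<gamma> by (auto simp: polys_in_def)
      have l: "Poly_Mapping.lookup (?e a') j + Poly_Mapping.lookup \<gamma> j = Poly_Mapping.lookup (?e a) j + Poly_Mapping.lookup \<beta> j" for j
        using e by (metis lookup_add)
      have "a' i = a i" if "i < n" for i
      proof -
        have "\<kappa> i - a' i = \<kappa> i - a i"
          using l[of "m + i"] that outside[OF k] outside[OF \<beta>] by (simp add: lookup_exps)
        moreover have "a' i \<le> \<kappa> i" "a i \<le> \<kappa> i" using a a' that by (auto simp: PiE_iff)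
        ultimately show ?thesis by simp
      qed
      then have "a' = a" using a a' by (intro PiE_ext[of _ _ "\<lambda>i. {..\<kappa> i}"]) auto
      moreover have "\<gamma> = \<beta>"
        by (rule poly_mapping_eqI) (use l \<open>a' = a\<close> in simp)
      ultimately show ?thesis ..
    qed
    show ?thesis
    proof (cases "a' = a")
      case True
      have "(\<Sum>\<gamma>\<in>Poly_Mapping.keys (T (Monom (exps 0 n a))). if ?e a + \<gamma> = ?e a + \<beta>
            then binom_prod n \<kappa> a * Poly_Mapping.lookup (T (Monom (exps 0 n a))) \<gamma> else 0)
        = (\<Sum>\<gamma>\<in>Poly_Mapping.keys (T (Monom (exps 0 n a))). if \<gamma> = \<beta>
            then binom_prod n \<kappa> a * Poly_Mapping.lookup (T (Monom (exps 0 n a))) \<gamma> else 0)"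
        using eq True by (intro sum.cong) auto
      also have "\<dots> = binom_prod n \<kappa> a * Poly_Mapping.lookup (T (Monom (exps 0 n a))) \<beta>"
        by (simp add: sum.delta) (auto simp: in_keys_iff)
      finally show ?thesis using True by (simp add: lookup_single_mult)
    next
      case False
      then show ?thesis using eq by (simp add: lookup_single_mult) (intro sum.neutral, auto)
    qed
  qed
  have "Poly_Mapping.lookup (symb n \<kappa> m T) (?e a + \<beta>) = (\<Sum>a'\<in>?B. if a' = a
      then binom_prod n \<kappa> a * Poly_Mapping.lookup (T (Monom (exps 0 n a))) \<beta> else 0)"
    unfolding symb_expand lookup_sum by (rule sum.cong[OF refl summand])
  then show ?thesis using a fin by (simp add: sum.delta)
qed

lemma polys_bounded_add: "f \<in> polys_bounded n \<kappa> \<Longrightarrow> g \<in> polys_bounded n \<kappa> \<Longrightarrow> f + g \<in> polys_bounded n \<kappa>"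
  unfolding polys_bounded_def polys_in_def using keys_add[of f g] by blast

lemma polys_bounded_zero: "0 \<in> polys_bounded n \<kappa>"
  by (simp add: polys_bounded_def polys_in_def)

lemma polys_bounded_single:
  assumes "a \<in> (\<Pi>\<^sub>E i\<in>{..<n}. {..\<kappa> i})"
  shows "Poly_Mapping.single (exps 0 n a) c \<in> polys_bounded n \<kappa>"
  using assms
  by (auto simp: polys_bounded_def polys_in_def in_keys_iff lookup_exps PiE_iff split: if_splits)

lemma polys_bounded_expand:
  assumes "f \<in> polys_bounded n \<kappa>"
  shows "f = (\<Sum>a\<in>(\<Pi>\<^sub>E i\<in>{..<n}. {..\<kappa> i}).
    Poly_Mapping.single (exps 0 n a) (Poly_Mapping.lookup f (exps 0 n a)))"
proof -
  let ?B = "\<Pi>\<^sub>E i\<in>{..<n}. {..\<kappa> i}"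
  have fin: "finite ?B" by (intro finite_PiE) auto
  have inj: "inj_on (exps 0 n) ?B"
  proof
    fix a a' assume a: "a \<in> ?B" "a' \<in> ?B" "exps 0 n a = exps 0 n a'"
    have "a i = a' i" if "i < n" for i
      using arg_cong[OF a(3), of "\<lambda>p. Poly_Mapping.lookup p i"] that by (simp add: lookup_exps)
    then show "a = a'" using a by (intro PiE_ext[of _ _ "\<lambda>i. {..\<kappa> i}"]) auto
  qed
  have "Poly_Mapping.keys f \<subseteq> exps 0 n ` ?B"
  proof
    fix \<alpha> assume \<alpha>: "\<alpha> \<in> Poly_Mapping.keys f"
    define a where "a = restrict (Poly_Mapping.lookup \<alpha>) {..<n}"
    have k: "Poly_Mapping.keys \<alpha> \<subseteq> {..<n}" "\<And>i. i < n \<Longrightarrow> Poly_Mapping.lookup \<alpha> i \<le> \<kappa> i"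
      using assms \<alpha> by (auto simp: polys_bounded_def polys_in_def)
    have "\<alpha> = exps 0 n a"
      by (rule poly_mapping_eqI) (use k(1) in \<open>auto simp: lookup_exps a_def in_keys_iff subset_iff\<close>)
    moreover have "a \<in> ?B" using k by (auto simp: a_def)
    ultimately show "\<alpha> \<in> exps 0 n ` ?B" by blast
  qed
  then have "f = (\<Sum>\<alpha>\<in>exps 0 n ` ?B. Poly_Mapping.single \<alpha> (Poly_Mapping.lookup f \<alpha>))"
    by (intro poly_mapping_sum_single) (use fin in auto)
  also have "\<dots> = (\<Sum>a\<in>?B. Poly_Mapping.single (exps 0 n a) (Poly_Mapping.lookup f (exps 0 n a)))"
    by (simp add: sum.reindex[OF inj])
  finally show ?thesis .
qed

lemma linear_operator_expand:
  assumes T: "linear_operator n \<kappa> m \<gamma> T" and f: "f \<in> polys_bounded n \<kappa>"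
  shows "T f = (\<Sum>a\<in>(\<Pi>\<^sub>E i\<in>{..<n}. {..\<kappa> i}).
    Const (Poly_Mapping.lookup f (exps 0 n a)) * T (Monom (exps 0 n a)))"
proof -
  let ?B = "\<Pi>\<^sub>E i\<in>{..<n}. {..\<kappa> i}"
  have fin: "finite ?B" by (intro finite_PiE) auto
  have add: "\<And>f g. f \<in> polys_bounded n \<kappa> \<Longrightarrow> g \<in> polys_bounded n \<kappa> \<Longrightarrow> T (f + g) = T f + T g"
    and scale: "\<And>c f. f \<in> polys_bounded n \<kappa> \<Longrightarrow> T (Const c * f) = Const c * T f"
    using T by (auto simp: linear_operator_def)
  have zero: "T 0 = 0" using scale[OF polys_bounded_zero, of 0] by (simp add: Const_def)
  have sum: "(\<Sum>a\<in>A. h a) \<in> polys_bounded n \<kappa> \<and> T (\<Sum>a\<in>A. h a) = (\<Sum>a\<in>A. T (h a))"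
    if "finite A" "\<And>a. a \<in> A \<Longrightarrow> h a \<in> polys_bounded n \<kappa>" for h and A :: "(nat \<Rightarrow> nat) set"
    using that by (induction A rule: finite_induct) (auto simp: zero polys_bounded_zero polys_bounded_add add)
  have "T f = (\<Sum>a\<in>?B. T (Poly_Mapping.single (exps 0 n a) (Poly_Mapping.lookup f (exps 0 n a))))"
    using sum[OF fin, of "\<lambda>a. Poly_Mapping.single (exps 0 n a) (Poly_Mapping.lookup f (exps 0 n a))"]
      polys_bounded_single polys_bounded_expand[OF f] by metis
  also have "\<dots> = (\<Sum>a\<in>?B. Const (Poly_Mapping.lookup f (exps 0 n a)) * T (Monom (exps 0 n a)))"
  proof (rule sum.cong[OF refl])
    fix a assume a: "a \<in> ?B"
    have "Monom (exps 0 n a) \<in> polys_bounded n \<kappa>"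
      unfolding Monom_def by (rule polys_bounded_single[OF a])
    from scale[OF this] show "T (Poly_Mapping.single (exps 0 n a) (Poly_Mapping.lookup f (exps 0 n a)))
        = Const (Poly_Mapping.lookup f (exps 0 n a)) * T (Monom (exps 0 n a))"
      unfolding Const_mult_Monom .
  qed
  finally show ?thesis .
qed


section \<open>Components of the positivity set\<close>

abbreviation positivity :: "nat \<Rightarrow> ((nat \<Rightarrow> real) \<Rightarrow> real) \<Rightarrow> (nat \<Rightarrow> real) topology" where
  "positivity m f \<equiv> subtopology (Euclidean_space m) {x. 0 < f x}"

lemma topspace_positivity: "topspace (positivity m f) = {x. (\<forall>i\<ge>m. x i = 0) \<and> 0 < f x}"
  by (auto simp: topspace_Euclidean_space)

lemma continuous_map_coord_Euclidean: "continuous_map (subtopology (Euclidean_space m) S) euclideanreal (\<lambda>x. x i)"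
  unfolding Euclidean_space_def
  by (intro continuous_map_from_subtopology continuous_map_product_projection) auto

lemma continuous_map_polyfun:
  "f \<in> polyfun N \<Longrightarrow> continuous_map (subtopology (Euclidean_space m) S) euclideanreal f"
  by (induction rule: polyfun.induct)
     (auto intro: continuous_map_coord_Euclidean continuous_map_add continuous_map_real_mult)

lemma connectedin_positive_segment:
  assumes "x \<in> topspace (Euclidean_space m)" "y \<in> topspace (Euclidean_space m)"
    and pos: "\<And>t. 0 \<le> t \<Longrightarrow> t \<le> 1 \<Longrightarrow> 0 < f (\<lambda>j. x j + t * (y j - x j))"
  shows "connectedin (positivity m f) ((\<lambda>t j. x j + t * (y j - x j)) ` {0..1})"
proof (rule connectedin_continuous_map_image)
  show "connectedin (top_of_set {0..1::real}) {0..1}"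
    by (simp add: connectedin_subtopology)
  show "continuous_map (top_of_set {0..1}) (positivity m f) (\<lambda>t j. x j + t * (y j - x j))"
    unfolding continuous_map_in_subtopology Euclidean_space_def continuous_map_componentwise_UNIV
  proof (intro conjI allI)
    fix j
    show "continuous_map (top_of_set {0..1}) euclideanreal (\<lambda>t. x j + t * (y j - x j))"
      by (auto intro!: continuous_intros)
  qed (use assms in \<open>auto simp: topspace_Euclidean_space\<close>)
qed

lemma positive_segment_in_component:
  assumes C: "C \<in> connected_components_of (positivity m f)" and x: "x \<in> C"
    and y: "y \<in> topspace (Euclidean_space m)"
    and pos: "\<And>t. 0 \<le> t \<Longrightarrow> t \<le> 1 \<Longrightarrow> 0 < f (\<lambda>j. y j + t * (x j - y j))"
  shows "y \<in> C"
proof -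
  let ?S = "(\<lambda>t j. y j + t * (x j - y j)) ` {0..1}"
  have "x \<in> topspace (Euclidean_space m)"
    using connected_components_of_subset[OF C] x by auto
  then have con: "connectedin (positivity m f) ?S"
    using connectedin_positive_segment[OF y] pos by blast
  have "x \<in> ?S" "y \<in> ?S"
    by (auto intro: image_eqI[of _ _ 1] image_eqI[of _ _ 0])
  then have "\<not> disjnt C ?S" using x by (auto simp: disjnt_iff)
  with connected_components_of_maximal[OF C con] have "?S \<subseteq> C" by blast
  with \<open>y \<in> ?S\<close> show ?thesis by blast
qed

lemma Gamma_plus_in_closure: "Gamma_plus m \<subseteq> Euclidean_space m closure_of Gamma_plus m"
  by (rule closure_of_subset) (auto simp: Gamma_plus_def)

text \<open>Along a coordinate ray in \<open>C\<close> a multi-affine function is affine; if it is nonnegative, its slope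
  is. So all iterated derivatives are nonnegative on \<open>C\<close>. A point of positivity with nonnegative
  derivatives is joined to \<open>C\<close> by its diagonal ray, so it lies in \<open>C\<close>, and so does a point slightly
  below it.\<close>

lemma PRT_component_lowerable:
  assumes \<phi>: "\<phi> \<in> polyfun m" "multiaffine \<phi>"
    and C: "C \<in> connected_components_of (positivity m \<phi>)" and c: "c \<in> C" and prt: "passes_PRT m C"
  shows "lowerable \<phi> \<and> nonneg_derivs \<phi> c"
proof -
  have CE: "y i = 0" if "y \<in> C" "m \<le> i" for y i
    using connected_components_of_subset[OF C] that by (auto simp: topspace_Euclidean_space)
  have Cpos: "0 < \<phi> y" if "y \<in> C" for y
    using connected_components_of_subset[OF C] that by auto
  have up: "(\<lambda>i. y i + v i) \<in> C" if "y \<in> C" "\<And>i. i < m \<Longrightarrow> 0 < v i" "\<And>i. m \<le> i \<Longrightarrow> v i = 0" for y v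
    using prt that Gamma_plus_in_closure[of m] unfolding passes_PRT_def Gamma_plus_def
    by (auto simp: topspace_Euclidean_space subset_iff)
  have pd_nonneg: "\<forall>y\<in>C. 0 \<le> pd i \<psi> y"
    if \<psi>: "\<psi> \<in> polyfun m" "multiaffine \<psi>" and pos: "\<forall>y\<in>C. 0 \<le> \<psi> y" for \<psi> i
  proof (cases "i < m")
    case True
    show ?thesis
    proof (rule ballI, rule ccontr)
      fix y assume y: "y \<in> C" and neg: "\<not> 0 \<le> pd i \<psi> y"
      define L where "L = (\<psi> y + 1) / - pd i \<psi> y"
      have L: "0 \<le> L" "\<psi> y + L * pd i \<psi> y = - 1"
        using neg pos y by (auto simp: L_def field_simps)
      define z where "z = (\<lambda>e j. y j + (if j = i then L else 0) + (if j < m then e else 0) :: real)"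
      have "- \<psi> (z 0) \<le> 0"
      proof (rule right_limit_le[of "\<lambda>e. - \<psi> (z e)" 0 1])
        show "continuous_on UNIV (\<lambda>e. - \<psi> (z e))"
          unfolding z_def by (intro continuous_intros polyfun_continuous[OF \<psi>(1)]) (auto intro!: continuous_intros)
        fix e :: real assume "0 < e"
        then have "(\<lambda>j. y j + ((if j = i then L else 0) + (if j < m then e else 0))) \<in> C"
          using L True by (intro up[OF y]) auto
        then show "- \<psi> (z e) \<le> 0" using pos by (auto simp: z_def add.assoc)
      qed simp
      moreover have "z 0 = y(i := y i + L)" by (auto simp: z_def)
      ultimately show False
        using affine_in_coord[OF \<psi>(1) multiaffineD[OF \<psi>(2)], where x = y and i = i and v = "y i + L"] L(2) by simp
    qed
  qed (simp add: pd_outside[OF \<psi>(1)])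
  have pds_nonneg: "\<forall>y\<in>C. 0 \<le> pds is \<psi> y"
    if "\<psi> \<in> polyfun m" "multiaffine \<psi>" "\<forall>y\<in>C. 0 \<le> \<psi> y" for \<psi> "is"
    using that
    by (induction "is" arbitrary: \<psi>) (simp_all add: polyfun_pd multiaffine_pd[where N = m] pd_nonneg)
  have nn: "nonneg_derivs \<phi> y" if "y \<in> C" for y
    using pds_nonneg[OF \<phi>] Cpos that by (auto simp: nonneg_derivs_def less_imp_le)
  have "lowerable \<phi>"
    unfolding lowerable_def
  proof (intro allI impI)
    fix x assume x: "0 < \<phi> x" "nonneg_derivs \<phi> x"
    define x' where "x' = (\<lambda>i. if i < m then x i else 0)"
    obtain T where "0 < T" "\<forall>i<m. c i < x i + T" using exists_shift by blast
    then have T: "0 < T" "\<And>i. i < m \<Longrightarrow> c i < x i + T" by auto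
    \<comment> \<open>Points of the Euclidean space have zeros from index \<open>m\<close> on, so the point is truncated.\<close>
    define w where "w = (\<lambda>i. if i < m then x i + T else 0)"
    have "(\<lambda>i. c i + (w i - c i)) \<in> C"
      by (rule up[OF c]) (use T CE[OF c] in \<open>auto simp: w_def\<close>)
    then have w: "w \<in> C" by simp
    have x'C: "x' \<in> C"
    proof (rule positive_segment_in_component[OF C w])
      show "x' \<in> topspace (Euclidean_space m)" by (auto simp: x'_def topspace_Euclidean_space)
      fix t :: real assume t: "0 \<le> t"
      have "\<phi> x \<le> \<phi> (\<lambda>j. x' j + t * (w j - x' j))"
        by (rule nonneg_derivs_imp_le[OF \<phi>(1) x(2)]) (use t T(1) in \<open>auto simp: x'_def w_def\<close>)
      then show "0 < \<phi> (\<lambda>j. x' j + t * (w j - x' j))" using x(1) by simp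
    qed
    define z where "z = (\<lambda>e i. if i < m then x i - e else 0 :: real)"
    have z0: "z 0 = x'" by (auto simp: z_def x'_def)
    have "continuous_on UNIV (\<lambda>e. \<phi> (z e))"
      unfolding z_def by (intro polyfun_continuous[OF \<phi>(1)]) (auto intro!: continuous_intros)
    then have "((\<lambda>e. \<phi> (z e)) \<longlongrightarrow> \<phi> (z 0)) (at 0)"
      unfolding continuous_on_def by (metis UNIV_I)
    then have "eventually (\<lambda>e. 0 < \<phi> (z e)) (at 0)"
      using Cpos[OF x'C] z0 by (intro order_tendstoD(1)[of _ "\<phi> (z 0)"]) auto
    then obtain d where d: "0 < d" "\<And>e. e \<noteq> 0 \<Longrightarrow> \<bar>e\<bar> < d \<Longrightarrow> 0 < \<phi> (z e)"
      unfolding eventually_at by (auto simp: dist_real_def)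
    have d': "0 < \<phi> (z e)" if "\<bar>e\<bar> < d" for e
      using d(2)[of e] that Cpos[OF x'C] z0 by (cases "e = 0") auto
    define e where "e = d / 2"
    have "z e \<in> C"
    proof (rule positive_segment_in_component[OF C x'C])
      show "z e \<in> topspace (Euclidean_space m)" by (auto simp: z_def topspace_Euclidean_space)
      fix t :: real assume t: "0 \<le> t" "t \<le> 1"
      have "(\<lambda>j. z e j + t * (x' j - z e j)) = z ((1 - t) * e)"
        by (auto simp: z_def x'_def algebra_simps)
      moreover have "\<bar>(1 - t) * e\<bar> < d"
        using t d(1) mult_right_mono[of "1 - t" 1 e] by (auto simp: e_def abs_mult)
      ultimately show "0 < \<phi> (\<lambda>j. z e j + t * (x' j - z e j))" using d' by simp
    qed
    then have "nonneg_derivs \<phi> (\<lambda>j. x j - e)"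
      by (intro nonneg_derivs_mono[OF \<phi>(1) nn]) (auto simp: z_def)
    then show "\<exists>e>0. nonneg_derivs \<phi> (\<lambda>j. x j - e)"
      using d(1) by (intro exI[of _ e]) (auto simp: e_def)
  qed
  then show ?thesis using nn[OF c] by blast
qed

text \<open>The component is the set \<open>D\<close> of points of positivity with nonnegative derivatives. Any two of its
  points are joined through their coordinatewise maximum, and \<open>D\<close> is open and closed in the set of
  points of positivity.\<close>

lemma lowerable_multiaffine_garding:
  assumes g: "g \<in> polys_bounded m (\<lambda>_. 1)" and low: "lowerable (poly_eval g)"
    and n0: "nonneg_derivs (poly_eval g) (\<lambda>_. 0)" and nz: "poly_eval g \<noteq> (\<lambda>_. 0)"
  shows "multiaffine_garding m g"
proof -
  define \<phi> where "\<phi> = poly_eval g"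
  have \<phi>: "\<phi> \<in> polyfun m" unfolding \<phi>_def using g by (intro polyfun_poly_eval) (simp add: polys_bounded_def)
  let ?X = "positivity m \<phi>"
  define D where "D = {x. (\<forall>i\<ge>m. x i = 0) \<and> 0 < \<phi> x \<and> nonneg_derivs \<phi> x}"
  define one where "one = (\<lambda>i. if i < m then 1 else 0 :: real)"
  have n1: "nonneg_derivs \<phi> one"
    by (rule nonneg_derivs_mono[OF \<phi> n0[folded \<phi>_def]]) (simp add: one_def)
  have "\<phi> one \<noteq> 0"
    using nonneg_derivs_zero_above[OF \<phi> n0[folded \<phi>_def], of one] nz by (auto simp: one_def \<phi>_def)
  then have one: "one \<in> D" using nonneg_derivs_value[OF n1] n1 by (auto simp: D_def one_def)
  have up: "y \<in> D" if "x \<in> D" "\<And>i. x i \<le> y i" "\<And>i. m \<le> i \<Longrightarrow> y i = 0" for x y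
    using that nonneg_derivs_imp_le[OF \<phi>, of x y] nonneg_derivs_mono[OF \<phi>, of x y] by (auto simp: D_def)
  have DX: "D \<subseteq> topspace ?X" unfolding topspace_positivity by (auto simp: D_def)
  have seg: "connected_component_of ?X x y" if xy: "x \<in> D" "y \<in> D" "\<And>i. x i \<le> y i" for x y
  proof -
    let ?S = "(\<lambda>t j. x j + t * (y j - x j)) ` {0..1}"
    have "connectedin ?X ?S"
    proof (rule connectedin_positive_segment)
      show "x \<in> topspace (Euclidean_space m)" "y \<in> topspace (Euclidean_space m)"
        using xy by (auto simp: D_def topspace_Euclidean_space)
      fix t :: real assume "0 \<le> t"
      then have "(\<lambda>j. x j + t * (y j - x j)) \<in> D"
        using xy by (intro up[OF xy(1)]) (auto simp: D_def)
      then show "0 < \<phi> (\<lambda>j. x j + t * (y j - x j))" by (simp add: D_def)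
    qed
    moreover have "x \<in> ?S" "y \<in> ?S" by (auto intro: image_eqI[of _ _ 1] image_eqI[of _ _ 0])
    ultimately show ?thesis unfolding connected_component_of_def by blast
  qed
  have "D \<subseteq> connected_component_of_set ?X one"
  proof
    fix x assume x: "x \<in> D"
    define w where "w = (\<lambda>i. max (x i) (one i))"
    have w: "w \<in> D" by (rule up[OF x]) (use x in \<open>auto simp: w_def D_def one_def\<close>)
    have "connected_component_of ?X x w" by (rule seg[OF x w]) (simp add: w_def)
    moreover have "connected_component_of ?X one w" by (rule seg[OF one w]) (simp add: w_def)
    ultimately show "x \<in> connected_component_of_set ?X one"
      using connected_component_of_sym connected_component_of_trans by (metis mem_Collect_eq)
  qed
  moreover have "connected_component_of_set ?X one \<subseteq> D"
  proof -
    have closed: "closedin ?X D"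
    proof -
      have "D = (\<Inter>is. {x \<in> topspace ?X. pds is \<phi> x \<in> {0..}})"
        unfolding topspace_positivity D_def nonneg_derivs_def by auto
      moreover have "closedin ?X {x \<in> topspace ?X. pds is \<phi> x \<in> {0..}}" for "is"
        by (rule closedin_continuous_map_preimage[OF continuous_map_polyfun[OF polyfun_pds[OF \<phi>]]]) simp
      ultimately show ?thesis by (metis (no_types, lifting) closedin_INT UNIV_not_empty)
    qed
    have "openin ?X D"
    proof (subst openin_subopen, intro ballI)
      fix x assume x: "x \<in> D"
      then obtain e where e: "0 < e" "nonneg_derivs \<phi> (\<lambda>j. x j - e)"
        using low unfolding lowerable_def \<phi>_def[symmetric] D_def by blast
      let ?U = "(\<Inter>i\<in>{..<m}. {y \<in> topspace ?X. y i \<in> {x i - e<..}}) \<inter> topspace ?X"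
      have "openin ?X ?U"
      proof (rule openin_INT)
        fix i
        show "openin ?X {y \<in> topspace ?X. y i \<in> {x i - e<..}}"
          by (rule openin_continuous_map_preimage[OF continuous_map_coord_Euclidean]) simp
      qed simp
      moreover have "x \<in> ?U" using x DX e by auto
      moreover have "?U \<subseteq> D"
      proof
        fix y assume y: "y \<in> ?U"
        have "nonneg_derivs \<phi> y"
          by (rule nonneg_derivs_mono[OF \<phi> e(2)]) (use y in \<open>auto intro: less_imp_le\<close>)
        then show "y \<in> D" using y unfolding topspace_positivity D_def by auto
      qed
      ultimately show "\<exists>T. openin ?X T \<and> x \<in> T \<and> T \<subseteq> D" by blast
    qed
    with closed have "connected_component_of_set ?X one \<subseteq> D \<or> disjnt (connected_component_of_set ?X one) D"
      by (intro connectedin_clopen_cases[OF connectedin_connected_component_of])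
    moreover have "one \<in> connected_component_of_set ?X one"
      using one DX connected_component_of_refl by (metis mem_Collect_eq subsetD)
    ultimately show ?thesis using one by (auto simp: disjnt_iff)
  qed
  ultimately have "D = connected_component_of_set ?X one" by blast
  then have "D \<in> connected_components_of ?X"
    using connected_component_in_connected_components_of[of ?X one] one DX by auto
  moreover have "passes_PRT m D"
    unfolding passes_PRT_def
  proof (intro ballI)
    fix x v assume x: "x \<in> D" and v: "v \<in> Euclidean_space m closure_of Gamma_plus m"
    have "0 \<le> v i" if "i < m" for i
    proof -
      have "continuous_map (Euclidean_space m) euclideanreal (\<lambda>x. x i)"
        using continuous_map_coord_Euclidean[of m UNIV i] by simp
      then have "closedin (Euclidean_space m) {y \<in> topspace (Euclidean_space m). y i \<in> {0..}}"
        by (rule closedin_continuous_map_preimage) simp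
      then have "Euclidean_space m closure_of Gamma_plus m \<subseteq> {y \<in> topspace (Euclidean_space m). y i \<in> {0..}}"
        using that by (intro closure_of_minimal) (auto simp: Gamma_plus_def less_imp_le)
      then show ?thesis using v by auto
    qed
    moreover have "v i = 0" if "m \<le> i" for i
      using v closure_of_subset_topspace[of "Euclidean_space m" "Gamma_plus m"] that
      by (auto simp: topspace_Euclidean_space)
    ultimately have v0: "0 \<le> v i" "m \<le> i \<Longrightarrow> v i = 0" for i
      by (cases "i < m"; simp)+
    show "(\<lambda>i. x i + v i) \<in> D"
      by (rule up[OF x]) (use x v0 in \<open>auto simp: D_def\<close>)
  qed
  ultimately have "\<exists>C\<in>connected_components_of ?X. C \<noteq> {} \<and> passes_PRT m C" using one by blast
  then show ?thesis
    unfolding multiaffine_garding_def \<phi>_def using g by simp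
qed

lemma polyfun_translate: "f \<in> polyfun N \<Longrightarrow> (\<lambda>x. f (\<lambda>j. x j + c j)) \<in> polyfun N"
  by (rule polyfun_compose) (auto intro: polyfun.intros)

lemma pd_translate:
  assumes "f \<in> polyfun N"
  shows "pd i (\<lambda>x. f (\<lambda>j. x j + c j)) = (\<lambda>x. pd i f (\<lambda>j. x j + c j))"
proof (rule pd_eqI)
  fix x :: "nat \<Rightarrow> real"
  have "((\<lambda>t. f (\<lambda>j. (x(i := t)) j + c j)) has_real_derivative
      (\<Sum>j<N. (if j = i then 1 else 0) * pd j f (\<lambda>j. (x(i := x i)) j + c j))) (at (x i))"
    by (rule polyfun_chain_rule[OF assms]) (auto intro!: derivative_eq_intros)
  also have "(\<Sum>j<N. (if j = i then 1 else 0) * pd j f (\<lambda>j. (x(i := x i)) j + c j)) = pd i f (\<lambda>j. x j + c j)"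
    using pd_outside[OF assms, of i] by (cases "i < N") (simp_all add: sum.delta if_distrib[of "\<lambda>z. z * _"] cong: if_cong)
  finally show "((\<lambda>t. f (\<lambda>j. (x(i := t)) j + c j)) has_real_derivative pd i f (\<lambda>j. x j + c j)) (at (x i))" .
qed

lemma pds_translate:
  "f \<in> polyfun N \<Longrightarrow> pds is (\<lambda>x. f (\<lambda>j. x j + c j)) = (\<lambda>x. pds is f (\<lambda>j. x j + c j))"
  by (induction "is" arbitrary: f) (simp_all add: pd_translate polyfun_pd)

lemma nonneg_derivs_translate:
  "f \<in> polyfun N \<Longrightarrow> nonneg_derivs (\<lambda>x. f (\<lambda>j. x j + c j)) x \<longleftrightarrow> nonneg_derivs f (\<lambda>j. x j + c j)"
  by (simp add: nonneg_derivs_def pds_translate)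

lemma lowerable_translate:
  assumes "f \<in> polyfun N" "lowerable f"
  shows "lowerable (\<lambda>x. f (\<lambda>j. x j + c j))"
  using assms unfolding lowerable_def nonneg_derivs_translate[OF assms(1)]
  by (simp add: algebra_simps)

lemma multiaffine_translate:
  "f \<in> polyfun N \<Longrightarrow> multiaffine f \<Longrightarrow> multiaffine (\<lambda>x. f (\<lambda>j. x j + c j))"
  unfolding multiaffine_def by (simp add: pd_translate[of _ N] polyfun_pd)

text \<open>Translating the multi-affine polynomial by a point \<open>c\<close> of its component makes its Taylor
  coefficients at the origin nonnegative; the affine map absorbs the translation. The offset \<open>k\<close>
  leaves room for the variables of another polynomial.\<close>

lemma garding_imp_garding_fun:
  assumes f: "garding n f" and k: "k + n \<le> N"
  shows "garding_fun (\<lambda>x. poly_eval f (\<lambda>i. x (k + i)))"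
proof -
  from f obtain M g \<mu> where fn: "f \<in> polys_in n" and g: "multiaffine_garding M g"
    and \<mu>: "strictly_positive_affine n M \<mu>"
    and eq: "\<And>x. x \<in> topspace (Euclidean_space n) \<Longrightarrow> poly_eval f x = poly_eval g (\<mu> x)"
    unfolding garding_def by blast
  from \<mu> obtain A b where A: "\<And>i j. i < M \<Longrightarrow> j < n \<Longrightarrow> 0 \<le> A i j" "\<And>i. i < M \<Longrightarrow> 0 < (\<Sum>j<n. A i j)"
    and \<mu>_eq: "\<mu> = affine_map n M A b"
    unfolding strictly_positive_affine_def by blast
  have f_eq: "poly_eval f (\<lambda>i. x (k + i)) = poly_eval g (affine_map n M A b (\<lambda>i. x (k + i)))" for x
  proof -
    let ?x = "\<lambda>i. if i < n then x (k + i) else 0"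
    have "poly_eval f (\<lambda>i. x (k + i)) = poly_eval f ?x"
      by (rule polyfun_cong[OF polyfun_poly_eval[OF fn]]) simp
    also have "\<dots> = poly_eval g (affine_map n M A b ?x)"
      using eq[of ?x] by (simp add: topspace_Euclidean_space \<mu>_eq)
    also have "affine_map n M A b ?x = affine_map n M A b (\<lambda>i. x (k + i))"
      by (auto simp: affine_map_def intro!: sum.cong)
    finally show ?thesis .
  qed
  show ?thesis
  proof (cases "g = 0")
    case True
    then show ?thesis by (simp add: f_eq garding_fun_zero)
  next
    case False
    have gb: "g \<in> polys_bounded M (\<lambda>_. 1)" using g by (simp add: multiaffine_garding_def)
    then have gM: "poly_eval g \<in> polyfun M" by (intro polyfun_poly_eval) (simp add: polys_bounded_def)
    have gma: "multiaffine (poly_eval g)" by (rule multiaffine_poly_eval[OF gb])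
    obtain C c where "C \<in> connected_components_of (positivity M (poly_eval g))" "c \<in> C" "passes_PRT M C"
      using g False unfolding multiaffine_garding_def by blast
    from PRT_component_lowerable[OF gM gma this]
    have low: "lowerable (poly_eval g)" and nc: "nonneg_derivs (poly_eval g) c" by auto
    define h where "h = (\<lambda>x. poly_eval g (\<lambda>j. x j + c j))"
    have h: "h \<in> polyfun M" "multiaffine h" "lowerable h" "nonneg_derivs h (\<lambda>_. 0)"
      unfolding h_def using polyfun_translate[OF gM] multiaffine_translate[OF gM gma]
        lowerable_translate[OF gM low] nonneg_derivs_translate[OF gM, of c "\<lambda>_. 0"] nc by auto
    define B where "B = (\<lambda>i j. if k \<le> j \<and> j < k + n then A i (j - k) else 0)"
    have sum_B: "(\<Sum>j<N. B i j * x j) = (\<Sum>j<n. A i j * x (k + j))" for i x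
    proof -
      have "(\<Sum>j<N. B i j * x j) = (\<Sum>j\<in>(+) k ` {..<n}. B i j * x j)"
      proof (rule sum.mono_neutral_right)
        show "(+) k ` {..<n} \<subseteq> {..<N}" using k by auto
        show "\<forall>j\<in>{..<N} - (+) k ` {..<n}. B i j * x j = 0"
        proof
          fix j assume j: "j \<in> {..<N} - (+) k ` {..<n}"
          have "\<not> (k \<le> j \<and> j < k + n)"
          proof
            assume "k \<le> j \<and> j < k + n"
            then have "j \<in> (+) k ` {..<n}" by (intro image_eqI[of _ _ "j - k"]) auto
            with j show False by blast
          qed
          then show "B i j * x j = 0" by (auto simp: B_def)
        qed
      qed simp
      also have "\<dots> = (\<Sum>j<n. A i j * x (k + j))"
        by (subst sum.reindex) (auto simp: B_def inj_on_def)
      finally show ?thesis .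
    qed
    have "garding_fun (\<lambda>x. h (affine_map N M B (\<lambda>j. b j - c j) x))"
    proof (rule garding_fun_affine[OF h])
      show "0 \<le> B j i" if "j < M" for i j using A(1)[OF that] by (auto simp: B_def)
      show "0 < (\<Sum>i<N. B j i)" if "j < M" for j using sum_B[of j "\<lambda>_. 1"] A(2)[OF that] by simp
    qed
    moreover have "h (affine_map N M B (\<lambda>j. b j - c j) x) = poly_eval f (\<lambda>i. x (k + i))" for x
      unfolding h_def f_eq
      by (rule polyfun_cong[OF gM]) (simp add: affine_map_def sum_B)
    ultimately show ?thesis by simp
  qed
qed

lemma garding_fun_imp_garding:
  assumes f: "f \<in> polys_bounded n \<kappa>" and gf: "garding_fun (poly_eval f)" and n0: "nonneg_derivs (poly_eval f) (\<lambda>_. 0)"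
  shows "garding n f"
proof -
  have fn: "f \<in> polys_in n" using f by (simp add: polys_bounded_def)
  obtain M G \<rho> where G: "G \<in> polyfun M" "multiaffine G" "lowerable G" "nonneg_derivs G (\<lambda>_. 0)"
    and \<rho>: "\<And>j. j < M \<Longrightarrow> \<rho> j < n" and eq: "\<And>x. poly_eval f x = G (\<lambda>j. x (\<rho> j))"
    using polarization_exists[OF polyfun_poly_eval[OF fn] gf n0 funpow_pd_poly_eval[OF f]] by blast
  have "\<exists>g. multiaffine_garding M g \<and> (\<forall>x. poly_eval g x = G x)"
  proof (cases "G = (\<lambda>_. 0)")
    case True
    then show ?thesis
      by (intro exI[of _ 0]) (simp add: multiaffine_garding_def polys_bounded_zero)
  next
    case False
    obtain g where g: "g \<in> polys_bounded M (\<lambda>_. 1)" "\<forall>x. poly_eval g x = G x"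
      using multiaffine_imp_poly_eval[OF G(1,2)] by blast
    then have "poly_eval g = G" by auto
    then show ?thesis using lowerable_multiaffine_garding[OF g(1)] G False g(2) by auto
  qed
  then obtain g where g: "multiaffine_garding M g" "\<And>x. poly_eval g x = G x" by blast
  define A where "A = (\<lambda>j i. if i = \<rho> j then 1 else 0 :: real)"
  have row: "(\<Sum>i<n. A j i * x i) = x (\<rho> j)" if "j < M" for j x
    using \<rho>[OF that] by (simp add: A_def if_distrib[of "\<lambda>z. z * _"] sum.delta cong: if_cong)
  have "strictly_positive_affine n M (affine_map n M A (\<lambda>_. 0))"
    unfolding strictly_positive_affine_def
  proof (intro exI conjI allI impI)
    show "0 \<le> A i j" for i j by (simp add: A_def)
    show "0 < (\<Sum>j<n. A i j)" if "i < M" for i using row[OF that, of "\<lambda>_. 1"] by simp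
  qed simp
  moreover have "poly_eval f x = poly_eval g (affine_map n M A (\<lambda>_. 0) x)" for x
    unfolding eq g(2) by (rule polyfun_cong[OF G(1)]) (simp add: affine_map_def row)
  ultimately show ?thesis unfolding garding_def using fn g(1) by blast
qed


section \<open>The operator as an apolar pairing with its symbol\<close>

text \<open>The variables are arranged in the order \<open>y\<close>, \<open>u\<close>, \<open>x\<close>: index \<open>m + l\<close> is \<open>u\<^sub>l\<close> and index
  \<open>m + n + l\<close> is \<open>x\<^sub>l\<close>.\<close>

primrec apolars :: "nat \<Rightarrow> nat \<Rightarrow> (nat \<Rightarrow> nat) \<Rightarrow> nat \<Rightarrow> ((nat \<Rightarrow> real) \<Rightarrow> real) \<Rightarrow> (nat \<Rightarrow> real) \<Rightarrow> real" where
  "apolars m n \<kappa> 0 h = h"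
| "apolars m n \<kappa> (Suc l) h = apolar (\<kappa> l) (m + n + l) (m + l) (apolars m n \<kappa> l h)"

lemma apolars_garding:
  assumes h: "h \<in> polyfun (m + n + n)" "garding_fun h" "nonneg_derivs h (\<lambda>_. 0)"
    and deg: "\<And>i. i < n \<Longrightarrow> (pd (m + n + i) ^^ Suc (\<kappa> i)) h = (\<lambda>_. 0)"
      "\<And>i. i < n \<Longrightarrow> (pd (m + i) ^^ Suc (\<kappa> i)) h = (\<lambda>_. 0)"
    and l: "l \<le> n"
  shows "apolars m n \<kappa> l h \<in> polyfun (m + n + n) \<and> garding_fun (apolars m n \<kappa> l h) \<and>
    nonneg_derivs (apolars m n \<kappa> l h) (\<lambda>_. 0) \<and>
    (\<forall>i. l \<le> i \<longrightarrow> i < n \<longrightarrow> (pd (m + n + i) ^^ Suc (\<kappa> i)) (apolars m n \<kappa> l h) = (\<lambda>_. 0) \<and>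
      (pd (m + i) ^^ Suc (\<kappa> i)) (apolars m n \<kappa> l h) = (\<lambda>_. 0))"
  using l
proof (induction l)
  case 0
  then show ?case using h deg by (simp del: funpow.simps)
next
  case (Suc l)
  let ?h = "apolars m n \<kappa> l h"
  have IH: "?h \<in> polyfun (m + n + n)" "garding_fun ?h" "nonneg_derivs ?h (\<lambda>_. 0)"
    and d: "\<And>i. l \<le> i \<Longrightarrow> i < n \<Longrightarrow> (pd (m + n + i) ^^ Suc (\<kappa> i)) ?h = (\<lambda>_. 0)"
      "\<And>i. l \<le> i \<Longrightarrow> i < n \<Longrightarrow> (pd (m + i) ^^ Suc (\<kappa> i)) ?h = (\<lambda>_. 0)"
    using Suc by (auto simp del: funpow.simps)
  have "m + n + l < m + n + n" "m + l < m + n + n" "m + n + l \<noteq> m + l" using Suc.prems by auto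
  from apolar_garding[OF IH this d(1)[OF order_refl] d(2)[OF order_refl]]
  have A: "apolars m n \<kappa> (Suc l) h \<in> polyfun (m + n + n)" "garding_fun (apolars m n \<kappa> (Suc l) h)"
    "nonneg_derivs (apolars m n \<kappa> (Suc l) h) (\<lambda>_. 0)"
    and o: "\<And>j k. j \<noteq> m + n + l \<Longrightarrow> j \<noteq> m + l \<Longrightarrow> (pd j ^^ k) ?h = (\<lambda>_. 0) \<Longrightarrow>
      (pd j ^^ k) (apolars m n \<kappa> (Suc l) h) = (\<lambda>_. 0)"
    using Suc.prems by auto
  have "(pd (m + n + i) ^^ Suc (\<kappa> i)) (apolars m n \<kappa> (Suc l) h) = (\<lambda>_. 0)"
    "(pd (m + i) ^^ Suc (\<kappa> i)) (apolars m n \<kappa> (Suc l) h) = (\<lambda>_. 0)" if "Suc l \<le> i" "i < n" for i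
    using that by (intro o d; simp)+
  then show ?case using A by blast
qed

definition pair_weight :: "nat \<Rightarrow> nat \<Rightarrow> nat \<Rightarrow> real" where
  "pair_weight k a b = (if a + b = k then inverse (real (k choose a)) else 0)"

lemma apolars_monomials:
  assumes C: "\<And>j. j \<in> J \<Longrightarrow> C j \<in> polyfun m"
    and p: "\<And>i j. j \<in> J \<Longrightarrow> i < n \<Longrightarrow> p j i \<le> \<kappa> i" and q: "\<And>i j. j \<in> J \<Longrightarrow> i < n \<Longrightarrow> q j i \<le> \<kappa> i"
    and l: "l \<le> n"
  shows "apolars m n \<kappa> l (\<lambda>x. \<Sum>j\<in>J. C j x * (\<Prod>i<n. x (m + n + i) ^ p j i * x (m + i) ^ q j i)) =
    (\<lambda>x. \<Sum>j\<in>J. (\<Prod>i<l. pair_weight (\<kappa> i) (p j i) (q j i)) *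
       (C j x * (\<Prod>i\<in>{l..<n}. x (m + n + i) ^ p j i * x (m + i) ^ q j i)))"
  using l
proof (induction l)
  case 0
  then show ?case by (simp add: lessThan_atLeast0)
next
  case (Suc l)
  let ?M = "\<lambda>j i x. x (m + n + i) ^ p j i * x (m + i) ^ q j i"
  define D where "D = (\<lambda>j x. (\<Prod>i<l. pair_weight (\<kappa> i) (p j i) (q j i)) * (C j x * (\<Prod>i\<in>{Suc l..<n}. ?M j i x)))"
  have ln: "l < n" using Suc.prems by simp
  have CN: "C j \<in> polyfun (m + n + n)" if "j \<in> J" for j
    by (rule polyfun_mono[OF C[OF that]]) simp
  have D: "D j \<in> polyfun (m + n + n)" if "j \<in> J" for j
    unfolding D_def by (intro polyfun_cmult polyfun.mult polyfun_prod polyfun_power polyfun.coord CN that) auto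
  have ind: "D j (x(k := v)) = D j x" if j: "j \<in> J" and k: "k = m + n + l \<or> k = m + l" for j x v k
  proof -
    have "C j (x(k := v)) = C j x" by (rule polyfun_cong[OF C[OF j]]) (use k in auto)
    moreover have "(\<Prod>i\<in>{Suc l..<n}. ?M j i (x(k := v))) = (\<Prod>i\<in>{Suc l..<n}. ?M j i x)"
      using k ln by (intro prod.cong refl) auto
    ultimately show ?thesis by (simp add: D_def)
  qed
  have lt: "m + n + l < m + n + n" "m + l < m + n + n" "m + n + l \<noteq> m + l" using ln by auto
  have "apolars m n \<kappa> (Suc l) (\<lambda>x. \<Sum>j\<in>J. C j x * (\<Prod>i<n. ?M j i x)) =
      apolar (\<kappa> l) (m + n + l) (m + l) (\<lambda>x. \<Sum>j\<in>J. D j x * (x (m + n + l) ^ p j l * x (m + l) ^ q j l))"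
  proof -
    have split: "(\<Prod>i\<in>{l..<n}. ?M j i x) = ?M j l x * (\<Prod>i\<in>{Suc l..<n}. ?M j i x)" for j x
      using ln by (rule prod.atLeast_Suc_lessThan)
    have "apolars m n \<kappa> l (\<lambda>x. \<Sum>j\<in>J. C j x * (\<Prod>i<n. ?M j i x)) = (\<lambda>x. \<Sum>j\<in>J. D j x * ?M j l x)"
      unfolding Suc.IH[OF less_imp_le[OF ln]] split D_def by (simp only: mult_ac)
    then show ?thesis by (simp only: apolars.simps)
  qed
  also have "\<dots> = (\<lambda>x. \<Sum>j\<in>J. apolar (\<kappa> l) (m + n + l) (m + l) (\<lambda>x. D j x * (x (m + n + l) ^ p j l * x (m + l) ^ q j l)) x)"
    by (rule apolar_sum[OF _ lt(1,2)]) (intro polyfun.mult polyfun_power polyfun.coord D lt)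
  also have "\<dots> = (\<lambda>x. \<Sum>j\<in>J. pair_weight (\<kappa> l) (p j l) (q j l) * D j x)"
  proof (intro ext sum.cong refl)
    fix j x assume j: "j \<in> J"
    show "apolar (\<kappa> l) (m + n + l) (m + l) (\<lambda>x. D j x * (x (m + n + l) ^ p j l * x (m + l) ^ q j l)) x
        = pair_weight (\<kappa> l) (p j l) (q j l) * D j x"
      unfolding pair_weight_def
      by (rule fun_cong[OF apolar_monomial[OF D[OF j] ind[OF j] ind[OF j] lt p[OF j ln] q[OF j ln]]]) simp_all
  qed
  finally show ?case by (simp add: D_def mult_ac)
qed

lemma funpow_pd_sum_monomials:
  assumes D: "\<And>j. j \<in> J \<Longrightarrow> D j \<in> polyfun N" and k: "k < N"
    and ind: "\<And>j x v. j \<in> J \<Longrightarrow> D j (x(k := v)) = D j x" and e: "\<And>j. j \<in> J \<Longrightarrow> e j < K"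
  shows "(pd k ^^ K) (\<lambda>x. \<Sum>j\<in>J. D j x * x k ^ e j) = (\<lambda>_. 0)"
proof (rule funpow_pd_sum[where N = N])
  fix j assume j: "j \<in> J"
  show "(\<lambda>x. D j x * x k ^ e j) \<in> polyfun N"
    by (intro polyfun.mult polyfun_power polyfun.coord D j k)
  show "(pd k ^^ K) (\<lambda>x. D j x * x k ^ e j) = (\<lambda>_. 0)"
    by (rule funpow_pd_monomial[OF D[OF j] k ind[OF j] e[OF j]])
qed

context
  fixes n m :: nat and \<kappa> \<gamma> :: "nat \<Rightarrow> nat" and T :: "real mpoly \<Rightarrow> real mpoly" and f :: "real mpoly"
  assumes T: "linear_operator n \<kappa> m \<gamma> T" and f: "f \<in> polys_bounded n \<kappa>"
begin

abbreviation "exponents \<equiv> \<Pi>\<^sub>E i\<in>{..<n}. {..\<kappa> i}"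
abbreviation "image_monom a \<equiv> T (Monom (exps 0 n a))"
abbreviation "coeff_at a \<equiv> Poly_Mapping.lookup f (exps 0 n a)"
abbreviation "symbol_times_f \<equiv> \<lambda>x. poly_eval (symb n \<kappa> m T) x * poly_eval f (\<lambda>i. x (m + n + i))"
abbreviation "term_coeff j x \<equiv> binom_prod n \<kappa> (fst j) * coeff_at (snd j) * poly_eval (image_monom (fst j)) x"

lemma image_monom_in: "a \<in> exponents \<Longrightarrow> image_monom a \<in> polys_in m"
  using T polys_bounded_single[of a n \<kappa> 1]
  unfolding Monom_def linear_operator_def polys_bounded_def[of m] by blast

lemma exponents_le: "a \<in> exponents \<Longrightarrow> i < n \<Longrightarrow> a i \<le> \<kappa> i"
  using PiE_mem by fastforce

lemma binom_prod_pos: "a \<in> exponents \<Longrightarrow> 0 < binom_prod n \<kappa> a"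
  unfolding binom_prod_def by (intro prod_pos) (simp add: exponents_le zero_less_binomial_iff)

lemma image_monom_nonneg:
  assumes S: "nonneg_coeffs (symb n \<kappa> m T)" and a: "a \<in> exponents"
  shows "0 \<le> Poly_Mapping.lookup (image_monom a) \<beta>"
proof (cases "\<beta> \<in> Poly_Mapping.keys (image_monom a)")
  case True
  then have k: "Poly_Mapping.keys \<beta> \<subseteq> {..<m}" using image_monom_in[OF a] by (auto simp: polys_in_def)
  have "0 \<le> binom_prod n \<kappa> a * Poly_Mapping.lookup (image_monom a) \<beta>"
    using S lookup_symb[where T = T and n = n and \<kappa> = \<kappa> and m = m and a = a, OF image_monom_in a k]
    unfolding nonneg_coeffs_def by metis
  then show ?thesis using binom_prod_pos[OF a] by (simp add: zero_le_mult_iff)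
qed (simp add: in_keys_iff)

lemma nonneg_coeffs_image:
  assumes S: "nonneg_coeffs (symb n \<kappa> m T)" and nf: "nonneg_coeffs f"
  shows "nonneg_coeffs (T f)"
  unfolding nonneg_coeffs_def linear_operator_expand[OF T f] lookup_sum
proof (intro allI sum_nonneg)
  fix \<beta> a assume a: "a \<in> exponents"
  have "Poly_Mapping.lookup (Const (coeff_at a) * image_monom a) \<beta>
      = (\<Sum>\<gamma>\<in>Poly_Mapping.keys (image_monom a). if \<gamma> = \<beta> then coeff_at a * Poly_Mapping.lookup (image_monom a) \<gamma> else 0)"
    unfolding Const_def lookup_single_mult by simp
  also have "0 \<le> \<dots>"
    using nf image_monom_nonneg[OF S a] by (intro sum_nonneg) (auto simp: nonneg_coeffs_def)
  finally show "0 \<le> Poly_Mapping.lookup (Const (coeff_at a) * image_monom a) \<beta>" .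
qed

lemma poly_eval_expand: "poly_eval f x = (\<Sum>b\<in>exponents. coeff_at b * (\<Prod>i<n. x i ^ b i))"
proof -
  have "poly_eval f x = poly_eval (\<Sum>b\<in>exponents. Poly_Mapping.single (exps 0 n b) (coeff_at b)) x"
    using polys_bounded_expand[OF f] by simp
  then show ?thesis by (simp add: poly_eval_sum poly_eval_single monom_val_exps)
qed

lemma symbol_times_f_expand:
  "symbol_times_f = (\<lambda>x. \<Sum>j\<in>exponents \<times> exponents. term_coeff j x *
     (\<Prod>i<n. x (m + n + i) ^ snd j i * x (m + i) ^ (\<kappa> i - fst j i)))"
proof
  fix x
  have S: "poly_eval (symb n \<kappa> m T) x
      = (\<Sum>a\<in>exponents. binom_prod n \<kappa> a * (\<Prod>i<n. x (m + i) ^ (\<kappa> i - a i)) * poly_eval (image_monom a) x)"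
    unfolding symb_expand by (simp add: poly_eval_sum poly_eval_mult poly_eval_single monom_val_exps)
  have "symbol_times_f x = (\<Sum>j\<in>exponents \<times> exponents.
      (binom_prod n \<kappa> (fst j) * (\<Prod>i<n. x (m + i) ^ (\<kappa> i - fst j i)) * poly_eval (image_monom (fst j)) x) *
      (coeff_at (snd j) * (\<Prod>i<n. x (m + n + i) ^ snd j i)))"
    unfolding S poly_eval_expand sum_product sum.cartesian_product case_prod_unfold ..
  also have "\<dots> = (\<Sum>j\<in>exponents \<times> exponents. term_coeff j x *
      (\<Prod>i<n. x (m + n + i) ^ snd j i * x (m + i) ^ (\<kappa> i - fst j i)))"
    unfolding prod.distrib by (rule sum.cong[OF refl]) (simp only: mult_ac)
  finally show "symbol_times_f x = (\<Sum>j\<in>exponents \<times> exponents. term_coeff j x *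
      (\<Prod>i<n. x (m + n + i) ^ snd j i * x (m + i) ^ (\<kappa> i - fst j i)))" .
qed

lemma term_coeff_polyfun: "j \<in> exponents \<times> exponents \<Longrightarrow> term_coeff j \<in> polyfun m"
  by (intro polyfun_cmult polyfun_poly_eval image_monom_in) (simp add: mem_Times_iff)

lemma symbol_times_f_degree:
  assumes i: "i < n"
  shows "(pd (m + n + i) ^^ Suc (\<kappa> i)) symbol_times_f = (\<lambda>_. 0)"
    and "(pd (m + i) ^^ Suc (\<kappa> i)) symbol_times_f = (\<lambda>_. 0)"
proof -
  let ?N = "m + n + n"
  define C where "C = (\<lambda>j x. term_coeff j x)"
  have C: "C j \<in> polyfun m" if "j \<in> exponents \<times> exponents" for j
    unfolding C_def by (rule term_coeff_polyfun[OF that])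
  have expand: "symbol_times_f = (\<lambda>x. \<Sum>j\<in>exponents \<times> exponents. C j x *
      (\<Prod>i<n. x (m + n + i) ^ snd j i * x (m + i) ^ (\<kappa> i - fst j i)))"
    unfolding C_def by (rule symbol_times_f_expand)
  let ?P = "\<lambda>j x. C j x * (\<Prod>l\<in>{..<n} - {i}. x (m + n + l) ^ snd j l * x (m + l) ^ (\<kappa> l - fst j l))"
  have P: "?P j \<in> polyfun ?N" if "j \<in> exponents \<times> exponents" for j
  proof -
    have "C j \<in> polyfun ?N" by (rule polyfun_mono[OF C[OF that]]) simp
    moreover have "(\<lambda>x. \<Prod>l\<in>{..<n} - {i}. x (m + n + l) ^ snd j l * x (m + l) ^ (\<kappa> l - fst j l)) \<in> polyfun ?N"
      by (intro polyfun_prod polyfun.mult polyfun_power polyfun.coord) auto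
    ultimately show ?thesis by (rule polyfun.mult)
  qed
  have ind: "?P j (x(k := v)) = ?P j x" if "j \<in> exponents \<times> exponents" "k = m + n + i \<or> k = m + i" for j x k v
  proof -
    have "C j (x(k := v)) = C j x"
      by (rule polyfun_cong[OF C[OF that(1)]]) (use that(2) in auto)
    moreover have "(\<Prod>l\<in>{..<n} - {i}. (x(k := v)) (m + n + l) ^ snd j l * (x(k := v)) (m + l) ^ (\<kappa> l - fst j l))
        = (\<Prod>l\<in>{..<n} - {i}. x (m + n + l) ^ snd j l * x (m + l) ^ (\<kappa> l - fst j l))"
      using that(2) i by (intro prod.cong refl) auto
    ultimately show ?thesis by simp
  qed
  have split: "C j x * (\<Prod>l<n. x (m + n + l) ^ snd j l * x (m + l) ^ (\<kappa> l - fst j l))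
      = ?P j x * (x (m + n + i) ^ snd j i * x (m + i) ^ (\<kappa> i - fst j i))" for j x
    using i by (simp add: prod.remove[of "{..<n}" i] mult_ac)
  have swap: "a * (b * c) = (a * c) * b" for a b c :: real by simp
  have 1: "symbol_times_f = (\<lambda>x. \<Sum>j\<in>exponents \<times> exponents. (?P j x * x (m + i) ^ (\<kappa> i - fst j i)) * x (m + n + i) ^ snd j i)"
    unfolding expand split swap ..
  show "(pd (m + n + i) ^^ Suc (\<kappa> i)) symbol_times_f = (\<lambda>_. 0)"
    unfolding 1
  proof (rule funpow_pd_sum_monomials[where N = ?N])
    fix j assume j: "j \<in> exponents \<times> exponents"
    show "(\<lambda>x. ?P j x * x (m + i) ^ (\<kappa> i - fst j i)) \<in> polyfun ?N"
      by (rule polyfun.mult[OF P[OF j] polyfun_power[OF polyfun.coord]]) (use i in simp)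
    show "?P j (x(m + n + i := v)) * (x(m + n + i := v)) (m + i) ^ (\<kappa> i - fst j i) = ?P j x * x (m + i) ^ (\<kappa> i - fst j i)" for x v
      unfolding ind[OF j disjI1[OF refl]] using i by simp
    show "snd j i < Suc (\<kappa> i)" using exponents_le[of "snd j" i] j i by (simp add: mem_Times_iff)
  qed (use i in simp)
  have 2: "symbol_times_f = (\<lambda>x. \<Sum>j\<in>exponents \<times> exponents. (?P j x * x (m + n + i) ^ snd j i) * x (m + i) ^ (\<kappa> i - fst j i))"
    unfolding expand split mult.assoc ..
  show "(pd (m + i) ^^ Suc (\<kappa> i)) symbol_times_f = (\<lambda>_. 0)"
    unfolding 2
  proof (rule funpow_pd_sum_monomials[where N = ?N])
    fix j assume j: "j \<in> exponents \<times> exponents"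
    show "(\<lambda>x. ?P j x * x (m + n + i) ^ snd j i) \<in> polyfun ?N"
      by (rule polyfun.mult[OF P[OF j] polyfun_power[OF polyfun.coord]]) (use i in simp)
    show "?P j (x(m + i := v)) * (x(m + i := v)) (m + n + i) ^ snd j i = ?P j x * x (m + n + i) ^ snd j i" for x v
      unfolding ind[OF j disjI2[OF refl]] using i by simp
    show "\<kappa> i - fst j i < Suc (\<kappa> i)" by simp
  qed (use i in simp)
qed

text \<open>The term of the symbol with \<open>u\<close>-exponents \<open>\<kappa> - a\<close> pairs only with the monomial of \<open>f\<close> with exponents
  \<open>a\<close>, and the inverse binomial coefficients cancel those of the symbol.\<close>

lemma apolars_symbol: "apolars m n \<kappa> n symbol_times_f = poly_eval (T f)"
proof
  fix x
  have weight: "(\<Prod>i<n. pair_weight (\<kappa> i) (b i) (\<kappa> i - a i)) = (if b = a then inverse (binom_prod n \<kappa> a) else 0)"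
    if ab: "a \<in> exponents" "b \<in> exponents" for a b
  proof (cases "b = a")
    case True
    have "pair_weight (\<kappa> i) (a i) (\<kappa> i - a i) = inverse (real (\<kappa> i choose a i))" if "i < n" for i
      using exponents_le[OF ab(1) that] by (simp add: pair_weight_def)
    then show ?thesis using True by (simp add: binom_prod_def prod_inversef[symmetric] comp_def)
  next
    case False
    then obtain i where i: "i < n" "a i \<noteq> b i"
      using PiE_ext[OF ab] by auto
    moreover have "a i \<le> \<kappa> i" "b i \<le> \<kappa> i" using ab i exponents_le by blast+
    ultimately have "pair_weight (\<kappa> i) (b i) (\<kappa> i - a i) = 0"
      by (auto simp: pair_weight_def)
    then show ?thesis using False i by (auto intro!: prod_zero)
  qed
  have "apolars m n \<kappa> n symbol_times_f = (\<lambda>x. \<Sum>j\<in>exponents \<times> exponents.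
      (\<Prod>i<n. pair_weight (\<kappa> i) (snd j i) (\<kappa> i - fst j i)) *
      (term_coeff j x * (\<Prod>i\<in>{n..<n}. x (m + n + i) ^ snd j i * x (m + i) ^ (\<kappa> i - fst j i))))"
    unfolding symbol_times_f_expand
  proof (rule apolars_monomials[where C = term_coeff and p = snd and q = "\<lambda>j i. \<kappa> i - fst j i"])
    show "snd j i \<le> \<kappa> i" if "j \<in> exponents \<times> exponents" "i < n" for i j
      using that exponents_le by (simp add: mem_Times_iff)
  qed (rule term_coeff_polyfun diff_le_self order_refl; assumption?)+
  then have "apolars m n \<kappa> n symbol_times_f x
      = (\<Sum>j\<in>exponents \<times> exponents. (\<Prod>i<n. pair_weight (\<kappa> i) (snd j i) (\<kappa> i - fst j i)) * term_coeff j x)"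
    by (simp only: atLeastLessThan_empty[OF order_refl] prod.empty mult_1_right)
  also have "\<dots> = (\<Sum>a\<in>exponents. \<Sum>b\<in>exponents. (\<Prod>i<n. pair_weight (\<kappa> i) (b i) (\<kappa> i - a i)) * term_coeff (a, b) x)"
    by (simp add: sum.cartesian_product case_prod_unfold)
  also have "\<dots> = (\<Sum>a\<in>exponents. \<Sum>b\<in>exponents. if b = a then coeff_at a * poly_eval (image_monom a) x else 0)"
    using weight binom_prod_pos by (intro sum.cong refl) (auto simp: less_le)
  also have "\<dots> = (\<Sum>a\<in>exponents. coeff_at a * poly_eval (image_monom a) x)"
    using finite_PiE[of "{..<n}" "\<lambda>i. {..\<kappa> i}"] by (simp add: sum.delta)
  also have "\<dots> = poly_eval (T f) x"
    unfolding linear_operator_expand[OF T f] by (simp add: poly_eval_sum poly_eval_mult)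
  finally show "apolars m n \<kappa> n symbol_times_f x = poly_eval (T f) x" .
qed

lemma symbol_times_f_garding:
  assumes gS: "garding (m + n) (symb n \<kappa> m T)" and nS: "nonneg_coeffs (symb n \<kappa> m T)"
    and gf: "garding n f" and nf: "nonneg_coeffs f"
  shows "symbol_times_f \<in> polyfun (m + n + n)" "garding_fun symbol_times_f" "nonneg_derivs symbol_times_f (\<lambda>_. 0)"
proof -
  let ?S = "poly_eval (symb n \<kappa> m T)" and ?\<phi> = "\<lambda>x. poly_eval f (\<lambda>i. x (m + n + i))"
  have Sn: "symb n \<kappa> m T \<in> polys_in (m + n)" and fn: "f \<in> polys_in n"
    using gS gf by (auto simp: garding_def)
  note S = polyfun_poly_eval[OF Sn]
  have SN: "?S \<in> polyfun (m + n + n)" by (rule polyfun_mono[OF S]) simp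
  have \<phi>: "?\<phi> \<in> polyfun (m + n + n)"
    by (rule polyfun_compose[OF polyfun_poly_eval[OF fn]]) (auto intro: polyfun.coord)
  have n\<phi>: "nonneg_derivs ?\<phi> (\<lambda>_. 0)"
    unfolding poly_eval_expand using nf
    by (intro nonneg_derivs_sum[of _ _ "m + n + n"] nonneg_derivs_cmult[of _ "m + n + n"] nonneg_derivs_prod[of _ _ "m + n + n"]
        nonneg_derivs_power[of _ "m + n + n"] nonneg_derivs_coord polyfun_cmult polyfun_prod polyfun_power polyfun.coord)
       (auto simp: nonneg_coeffs_def)
  have disj: "pd i ?S = (\<lambda>_. 0) \<or> pd i ?\<phi> = (\<lambda>_. 0)" for i
  proof (cases "i < m + n")
    case True
    then have "pd i ?\<phi> = (\<lambda>_. 0)"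
      by (intro indep_imp_pd_zero arg_cong[of _ _ "poly_eval f"]) auto
    then show ?thesis ..
  next
    case False
    then show ?thesis using pd_outside[OF S, of i] by simp
  qed
  have g: "garding_fun ?S" "garding_fun ?\<phi>"
    using garding_imp_garding_fun[OF gS, of 0 "m + n"] garding_imp_garding_fun[OF gf, of "m + n" "m + n + n"] by simp_all
  note nS = nonneg_derivs_poly_eval[OF Sn nS]
  show "symbol_times_f \<in> polyfun (m + n + n)" by (rule polyfun.mult[OF SN \<phi>])
  show "garding_fun symbol_times_f" by (rule garding_fun_mult[OF SN g(1) nS \<phi> g(2) n\<phi> disj])
  show "nonneg_derivs symbol_times_f (\<lambda>_. 0)" by (rule nonneg_derivs_mult[OF SN \<phi> nS n\<phi>])
qed

end

theorem theorem10p3: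
  fixes n m :: nat and \<kappa> \<gamma> :: "nat \<Rightarrow> nat" and T :: "real mpoly \<Rightarrow> real mpoly"
  assumes "linear_operator n \<kappa> m \<gamma> T"
    and "garding (m + n) (symb n \<kappa> m T)"
    and "nonneg_coeffs (symb n \<kappa> m T)"
  shows "\<forall>f \<in> polys_bounded n \<kappa>. garding n f \<and> nonneg_coeffs f \<longrightarrow>
           T f \<in> polys_bounded m \<gamma> \<and> garding m (T f) \<and> nonneg_coeffs (T f)"
proof (intro ballI impI)
  fix f assume f: "f \<in> polys_bounded n \<kappa>" and gf: "garding n f \<and> nonneg_coeffs f"
  note Tf = assms(1) f
  have bounded: "T f \<in> polys_bounded m \<gamma>" using Tf by (simp add: linear_operator_def)
  note h = symbol_times_f_garding[OF Tf assms(2,3) conjunct1[OF gf] conjunct2[OF gf]]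
  note H = apolars_garding[OF h symbol_times_f_degree[OF Tf] order_refl, unfolded apolars_symbol[OF Tf]]
  have "garding m (T f)"
    using garding_fun_imp_garding[OF bounded] H by blast
  moreover have "nonneg_coeffs (T f)"
    using nonneg_coeffs_image[OF Tf assms(3)] gf by blast
  ultimately show "T f \<in> polys_bounded m \<gamma> \<and> garding m (T f) \<and> nonneg_coeffs (T f)"
    using bounded by blast
qed


end
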